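(* If $T$ is a free amalgamation theory then $T$ has elimination of hyperimaginaries and weak elimination of imaginaries.
   Context: A ternary relation $\mathop{\downarrow}$ on small subsets of a monster model $\mathbb M$ of $T$ is a free amalgamation relation if it satisfies invariance, monotonicity, symmetry, full transitivity (for $D\subseteq C\subseteq B$: $A\mathop{\downarrow}_D B$ iff $A\mathop{\downarrow}_C B$ and $A\mathop{\downarrow}_D C$), full existence (for closed $C$, any $B$, tuple $a$, there is $a'\equiv_C a$ with $a'\mathop{\downarrow}_C B$), stationarity (for closed $C$ and closed tuples $a,a',b$ with $C\subseteq a\cap b$: $a\mathop{\downarrow}_C b$, $a'\mathop{\downarrow}_C b$, $a'\equiv_C a$ imply $ab\equiv_C a'b$), freedom ($A\mathop{\downarrow}_C B$ and $C\cap AB\subseteq D\subseteq C$ imply $A\mathop{\downarrow}_D B$), and closure (for closed $A,B,C$ with $C\subseteq A\cap B$, $A\mathop{\downarrow}_C B$ implies $AB$ closed). Here "closed" means algebraically closed, $\equiv_C$ means conjugate under $\operatorname{Aut}(\mathbb M/C)$, $AB=A\cup B$. $T$ is a free amalgamation theory if it has a free amalgamation relation. Elimination of hyperimaginaries: every hyperimaginary is interdefinable with a sequence of imaginaries. Weak elimination of imaginaries: every imaginary $e$ has a weak canonical parameter, i.e. a finite real tuple $c$ with $c\in\operatorname{acl}^{eq}(e)$ and $e\in\operatorname{dcl}^{eq}(c)$. *)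

theory Defs
  imports Main
begin

unbundle cardinal_syntax

datatype ('f,'v,'a) trm = Var 'v | Par 'a | App 'f "('f,'v,'a) trm list"

datatype ('f,'r,'v,'a) fm =
    FF
  | Eq "('f,'v,'a) trm" "('f,'v,'a) trm"
  | Rel 'r "('f,'v,'a) trm list"
  | Neg "('f,'r,'v,'a) fm"
  | Conj "('f,'r,'v,'a) fm" "('f,'r,'v,'a) fm"
  | Ex 'v "('f,'r,'v,'a) fm"

record ('f,'r,'a) struc =
  carr :: "'a set"
  far  :: "'f \<Rightarrow> nat"
  rar  :: "'r \<Rightarrow> nat"
  fint :: "'f \<Rightarrow> 'a list \<Rightarrow> 'a"
  rint :: "'r \<Rightarrow> 'a list \<Rightarrow> bool"

primrec evt :: "('f,'r,'a) struc \<Rightarrow> ('v \<Rightarrow> 'a) \<Rightarrow> ('f,'v,'a) trm \<Rightarrow> 'a" where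
  "evt M s (Var v) = s v"
| "evt M s (Par a) = a"
| "evt M s (App f ts) = fint M f (map (evt M s) ts)"

primrec sat :: "('f,'r,'a) struc \<Rightarrow> ('v \<Rightarrow> 'a) \<Rightarrow> ('f,'r,'v,'a) fm \<Rightarrow> bool" where
  "sat M s FF = False"
| "sat M s (Eq t u) = (evt M s t = evt M s u)"
| "sat M s (Rel r ts) = rint M r (map (evt M s) ts)"
| "sat M s (Neg \<phi>) = (\<not> sat M s \<phi>)"
| "sat M s (Conj \<phi> \<psi>) = (sat M s \<phi> \<and> sat M s \<psi>)"
| "sat M s (Ex v \<phi>) = (\<exists>x\<in>carr M. sat M (s(v := x)) \<phi>)"

primrec wft :: "('f \<Rightarrow> nat) \<Rightarrow> ('f,'v,'a) trm \<Rightarrow> bool" where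
  "wft ar (Var v) = True"
| "wft ar (Par a) = True"
| "wft ar (App f ts) = (length ts = ar f \<and> list_all (wft ar) ts)"

primrec fvt :: "('f,'v,'a) trm \<Rightarrow> 'v set" where
  "fvt (Var v) = {v}"
| "fvt (Par a) = {}"
| "fvt (App f ts) = \<Union> (set (map fvt ts))"

primrec part :: "('f,'v,'a) trm \<Rightarrow> 'a set" where
  "part (Var v) = {}"
| "part (Par a) = {a}"
| "part (App f ts) = \<Union> (set (map part ts))"

primrec wff :: "('f,'r,'a) struc \<Rightarrow> ('f,'r,'v,'a) fm \<Rightarrow> bool" where
  "wff M FF = True"
| "wff M (Eq t u) = (wft (far M) t \<and> wft (far M) u)"
| "wff M (Rel r ts) = (length ts = rar M r \<and> list_all (wft (far M)) ts)"
| "wff M (Neg \<phi>) = wff M \<phi>"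
| "wff M (Conj \<phi> \<psi>) = (wff M \<phi> \<and> wff M \<psi>)"
| "wff M (Ex v \<phi>) = wff M \<phi>"

primrec fv :: "('f,'r,'v,'a) fm \<Rightarrow> 'v set" where
  "fv FF = {}"
| "fv (Eq t u) = fvt t \<union> fvt u"
| "fv (Rel r ts) = \<Union> (set (map fvt ts))"
| "fv (Neg \<phi>) = fv \<phi>"
| "fv (Conj \<phi> \<psi>) = fv \<phi> \<union> fv \<psi>"
| "fv (Ex v \<phi>) = fv \<phi> - {v}"

primrec params :: "('f,'r,'v,'a) fm \<Rightarrow> 'a set" where
  "params FF = {}"
| "params (Eq t u) = part t \<union> part u"
| "params (Rel r ts) = \<Union> (set (map part ts))"
| "params (Neg \<phi>) = params \<phi>"
| "params (Conj \<phi> \<psi>) = params \<phi> \<union> params \<psi>"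
| "params (Ex v \<phi>) = params \<phi>"

text \<open>We use one variable type throughout: 'a \<times> nat (an infinite supply of
variables; for a tuple indexed by I, the variables (i,0) and (i,1), i \<in> I, serve as
the two copies x_i, y_i).  A formula of the structure M is a well-formed formula
whose parameters are elements of the universe.\<close>

type_synonym ('f,'r,'a) form = "('f,'r,'a \<times> nat,'a) fm"

definition wf_fm :: "('f,'r,'a) struc \<Rightarrow> ('f,'r,'a) form \<Rightarrow> bool" where
  "wf_fm M \<phi> \<longleftrightarrow> wff M \<phi> \<and> params \<phi> \<subseteq> carr M"

definition struct :: "('f,'r,'a) struc \<Rightarrow> bool" where
  "struct M \<longleftrightarrow> carr M \<noteq> {} \<and>
     (\<forall>f xs. length xs = far M f \<and> set xs \<subseteq> carr M \<longrightarrow> fint M f xs \<in> carr M)"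

definition aut :: "('f,'r,'a) struc \<Rightarrow> ('a \<Rightarrow> 'a) \<Rightarrow> bool" where
  "aut M \<sigma> \<longleftrightarrow> bij_betw \<sigma> (carr M) (carr M) \<and>
     (\<forall>f xs. length xs = far M f \<and> set xs \<subseteq> carr M \<longrightarrow> \<sigma> (fint M f xs) = fint M f (map \<sigma> xs)) \<and>
     (\<forall>r xs. length xs = rar M r \<and> set xs \<subseteq> carr M \<longrightarrow> (rint M r xs \<longleftrightarrow> rint M r (map \<sigma> xs)))"

definition autC :: "('f,'r,'a) struc \<Rightarrow> 'a set \<Rightarrow> ('a \<Rightarrow> 'a) set" where
  "autC M C = {\<sigma>. aut M \<sigma> \<and> (\<forall>x\<in>C. \<sigma> x = x)}"

text \<open>Smallness: cardinality strictly below the cardinal of K (the monster's kappa).\<close>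
definition small :: "'k set \<Rightarrow> 'b set \<Rightarrow> bool" where
  "small K A \<longleftrightarrow> |A| <o |K|"

definition saturated :: "('f,'r,'a) struc \<Rightarrow> 'k set \<Rightarrow> bool" where
  "saturated M K \<longleftrightarrow>
    (\<forall>A (p :: ('f,'r,'a) form set).
       A \<subseteq> carr M \<and> small K A \<and> (\<forall>\<phi>\<in>p. wf_fm M \<phi> \<and> params \<phi> \<subseteq> A) \<and>
       (\<forall>q. finite q \<and> q \<subseteq> p \<longrightarrow> (\<exists>b\<in>carr M. \<forall>\<phi>\<in>q. sat M (\<lambda>_. b) \<phi>))
       \<longrightarrow> (\<exists>b\<in>carr M. \<forall>\<phi>\<in>p. sat M (\<lambda>_. b) \<phi>))"

definition strongly_homogeneous :: "('f,'r,'a) struc \<Rightarrow> 'k set \<Rightarrow> bool" where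
  "strongly_homogeneous M K \<longleftrightarrow>
    (\<forall>A g. A \<subseteq> carr M \<and> small K A \<and> g ` A \<subseteq> carr M \<and>
       (\<forall>(\<phi> :: ('f,'r,'a) form) s. wf_fm M \<phi> \<and> params \<phi> = {} \<and> range s \<subseteq> A
          \<longrightarrow> (sat M s \<phi> \<longleftrightarrow> sat M (g \<circ> s) \<phi>))
       \<longrightarrow> (\<exists>\<sigma>. aut M \<sigma> \<and> (\<forall>x\<in>A. \<sigma> x = g x)))"

definition monster :: "('f,'r,'a) struc \<Rightarrow> 'k set \<Rightarrow> bool" where
  "monster M K \<longleftrightarrow> struct M \<and>
     |UNIV :: 'f set| <o |K| \<and> |UNIV :: 'r set| <o |K| \<and> |UNIV :: nat set| <o |K| \<and>
     saturated M K \<and> strongly_homogeneous M K"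

definition acl :: "('f,'r,'a) struc \<Rightarrow> 'a set \<Rightarrow> 'a set" where
  "acl M A = {a \<in> carr M. \<exists>\<phi> :: ('f,'r,'a) form. wf_fm M \<phi> \<and> params \<phi> \<subseteq> A \<and>
       finite {b \<in> carr M. sat M (\<lambda>_. b) \<phi>} \<and> sat M (\<lambda>_. a) \<phi>}"

definition closed :: "('f,'r,'a) struc \<Rightarrow> 'a set \<Rightarrow> bool" where
  "closed M A \<longleftrightarrow> A \<subseteq> carr M \<and> acl M A = A"

definition free_amalgamation_rel ::
  "('f,'r,'a) struc \<Rightarrow> 'k set \<Rightarrow> ('a set \<Rightarrow> 'a set \<Rightarrow> 'a set \<Rightarrow> bool) \<Rightarrow> bool" where
  "free_amalgamation_rel M K ind \<longleftrightarrow>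
   (let sm = (\<lambda>X. X \<subseteq> carr M \<and> small K X) in
    \<comment> \<open>ind A C B means A independent from B over C\<close>
    \<comment> \<open>invariance\<close>
    (\<forall>\<sigma> A B C. aut M \<sigma> \<and> sm A \<and> sm B \<and> sm C \<and> ind A C B \<longrightarrow> ind (\<sigma> ` A) (\<sigma> ` C) (\<sigma> ` B)) \<and>
    \<comment> \<open>monotonicity\<close>
    (\<forall>A A' B B' C. sm A \<and> sm B \<and> sm C \<and> ind A C B \<and> A' \<subseteq> A \<and> B' \<subseteq> B \<longrightarrow> ind A' C B') \<and>
    \<comment> \<open>symmetry\<close>
    (\<forall>A B C. sm A \<and> sm B \<and> sm C \<and> ind A C B \<longrightarrow> ind B C A) \<and>
    \<comment> \<open>full transitivity\<close>
    (\<forall>A B C D. sm A \<and> sm B \<and> sm C \<and> sm D \<and> D \<subseteq> C \<and> C \<subseteq> B \<longrightarrow>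
       (ind A D B \<longleftrightarrow> ind A C B \<and> ind A D C)) \<and>
    \<comment> \<open>full existence\<close>
    (\<forall>A B C. sm A \<and> sm B \<and> sm C \<and> closed M C \<longrightarrow> (\<exists>\<sigma>\<in>autC M C. ind (\<sigma> ` A) C B)) \<and>
    \<comment> \<open>stationarity (the tuple a' is the image of the tuple a under \<sigma> \<in> Aut(M/C))\<close>
    (\<forall>A B C \<sigma>. sm A \<and> sm B \<and> sm C \<and> closed M A \<and> closed M B \<and> closed M C \<and>
       C \<subseteq> A \<inter> B \<and> \<sigma> \<in> autC M C \<and> ind A C B \<and> ind (\<sigma> ` A) C B \<longrightarrow>
       (\<exists>\<tau>\<in>autC M C. (\<forall>x\<in>A. \<tau> x = \<sigma> x) \<and> (\<forall>x\<in>B. \<tau> x = x))) \<and>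
    \<comment> \<open>freedom\<close>
    (\<forall>A B C D. sm A \<and> sm B \<and> sm C \<and> sm D \<and> ind A C B \<and> C \<inter> (A \<union> B) \<subseteq> D \<and> D \<subseteq> C \<longrightarrow> ind A D B) \<and>
    \<comment> \<open>closure\<close>
    (\<forall>A B C. sm A \<and> sm B \<and> sm C \<and> closed M A \<and> closed M B \<and> closed M C \<and>
       C \<subseteq> A \<inter> B \<and> ind A C B \<longrightarrow> closed M (A \<union> B)))"

definition asg :: "('a \<Rightarrow> 'a) \<Rightarrow> ('a \<Rightarrow> 'a) \<Rightarrow> 'a \<times> nat \<Rightarrow> 'a" where
  "asg x y = (\<lambda>(i,n). if n = 0 then x i else y i)"

definition Erel :: "('f,'r,'a) struc \<Rightarrow> ('f,'r,'a) form set \<Rightarrow> ('a \<Rightarrow> 'a) \<Rightarrow> ('a \<Rightarrow> 'a) \<Rightarrow> bool" where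
  "Erel M \<Phi> x y \<longleftrightarrow> (\<forall>\<phi>\<in>\<Phi>. sat M (asg x y) \<phi>)"

text \<open>(I, Phi, a) represents the hyperimaginary a_E: a is a tuple indexed by I,
E is the equivalence relation on M^I type-defined over the empty set by Phi.\<close>
definition hypimag :: "('f,'r,'a) struc \<Rightarrow> 'a set \<Rightarrow> ('f,'r,'a) form set \<Rightarrow> ('a \<Rightarrow> 'a) \<Rightarrow> bool" where
  "hypimag M I \<Phi> a \<longleftrightarrow>
     (\<forall>\<phi>\<in>\<Phi>. wf_fm M \<phi> \<and> params \<phi> = {} \<and> fv \<phi> \<subseteq> I \<times> {0,1}) \<and>
     a ` I \<subseteq> carr M \<and>
     (\<forall>x. x ` I \<subseteq> carr M \<longrightarrow> Erel M \<Phi> x x) \<and>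
     (\<forall>x y. x ` I \<subseteq> carr M \<and> y ` I \<subseteq> carr M \<and> Erel M \<Phi> x y \<longrightarrow> Erel M \<Phi> y x) \<and>
     (\<forall>x y z. x ` I \<subseteq> carr M \<and> y ` I \<subseteq> carr M \<and> z ` I \<subseteq> carr M \<and>
        Erel M \<Phi> x y \<and> Erel M \<Phi> y z \<longrightarrow> Erel M \<Phi> x z)"

definition imag :: "('f,'r,'a) struc \<Rightarrow> 'a set \<Rightarrow> ('f,'r,'a) form \<Rightarrow> ('a \<Rightarrow> 'a) \<Rightarrow> bool" where
  "imag M I \<phi> a \<longleftrightarrow> finite I \<and> hypimag M I {\<phi>} a"

definition fixes_h :: "('f,'r,'a) struc \<Rightarrow> ('f,'r,'a) form set \<Rightarrow> ('a \<Rightarrow> 'a) \<Rightarrow> ('a \<Rightarrow> 'a) \<Rightarrow> bool" where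
  "fixes_h M \<Phi> a \<sigma> \<longleftrightarrow> Erel M \<Phi> (\<sigma> \<circ> a) a"

text \<open>Elimination of hyperimaginaries: every hyperimaginary is interdefinable
(same pointwise stabiliser in Aut(M)) with a (small) sequence of imaginaries.\<close>
definition EHI :: "('f,'r,'a) struc \<Rightarrow> 'k set \<Rightarrow> bool" where
  "EHI M K \<longleftrightarrow>
    (\<forall>I \<Phi> a. small K I \<and> hypimag M I \<Phi> a \<longrightarrow>
       (\<exists>S :: ('a set \<times> ('f,'r,'a) form \<times> ('a \<Rightarrow> 'a)) set.
          small K S \<and> (\<forall>(J,\<phi>,b)\<in>S. imag M J \<phi> b) \<and>
          (\<forall>\<sigma>. aut M \<sigma> \<longrightarrow> (fixes_h M \<Phi> a \<sigma> \<longleftrightarrow> (\<forall>(J,\<phi>,b)\<in>S. fixes_h M {\<phi>} b \<sigma>)))))"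

text \<open>Weak elimination of imaginaries: every imaginary e has a weak canonical
parameter: a finite real tuple c with c in acl^eq(e) (finite orbit under Aut(M/e))
and e in dcl^eq(c) (fixed by Aut(M/c)).\<close>
definition WEI :: "('f,'r,'a) struc \<Rightarrow> bool" where
  "WEI M \<longleftrightarrow>
    (\<forall>I \<phi> a. imag M I \<phi> a \<longrightarrow>
       (\<exists>c :: 'a list. set c \<subseteq> carr M \<and>
          finite {map \<sigma> c | \<sigma>. aut M \<sigma> \<and> fixes_h M {\<phi>} a \<sigma>} \<and>
          (\<forall>\<sigma>. aut M \<sigma> \<and> (\<forall>x\<in>set c. \<sigma> x = x) \<longrightarrow> fixes_h M {\<phi>} a \<sigma>)))"

end

theory Submission
  imports Defs
begin

text \<open>
  The automorphisms fixing a hyperimaginary \<open>e\<close> form a group \<open>G\<close>; call a small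
  algebraically closed set \<open>A\<close> a support if every automorphism fixing \<open>A\<close> pointwise lies
  in \<open>G\<close>. If \<open>A\<close> and \<open>B\<close> are supports, choose \<open>A'\<close> conjugate to \<open>A\<close> over
  \<open>B\<close> and free from \<open>A\<close> over \<open>B\<close>; freedom lowers the base to \<open>A \<inter> B\<close>, and
  stationarity then shows that \<open>A \<inter> B\<close> is a support. Intersecting a support \<open>A\<close> with
  conjugates of it under \<open>G\<close>, and using compactness once, the set \<open>C\<close> of those points whose
  \<open>G\<close>-orbit stays in \<open>A\<close> is a support; by compactness again its \<open>G\<close>-orbits are finite.
  For an imaginary \<open>e\<close> a finite part of \<open>C\<close> is already a support, hence a weak canonical
  parameter. In general \<open>e\<close> is interdefinable with the imaginaries coding the action of
  \<open>G\<close> on the finite \<open>G\<close>-invariant subsets of \<open>C\<close>.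
\<close>

section \<open>Formulas\<close>

text \<open>The support with finite orbits is an intersection of infinitely many conjugates of
  \<open>A\<close>, whereas freedom and stationarity only intersect two supports at a time. The way
  out is a single conjugate of \<open>A\<close> that meets \<open>A\<close> in nothing but points of
  \<open>C\<close>: one element of \<open>G\<close> must move all of \<open>A - C\<close> off
  \<open>A\<close>, and compactness reduces this to finitely many points. Those are removed from
  \<open>A\<close> by finitely many intersections, leaving a support \<open>B\<close>; a conjugate
  of \<open>A\<close> over \<open>B\<close> that is free from \<open>A\<close> meets
  \<open>A\<close> only inside \<open>B\<close>, because a closed set free from itself over
  \<open>B\<close> lies in \<open>B\<close>. For two supports, every automorphism
  \<open>\<tau>\<close> over \<open>A \<inter> B\<close> is a quotient of two automorphisms over
  \<open>A \<inter> B\<close> that carry \<open>A\<close> to a set free from \<open>A\<close>, and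
  stationarity puts such automorphisms into \<open>G\<close>. The monster model provides saturation
  for one variable and strong homogeneity; compactness for automorphisms is built from these
  two.\<close>

lemma finite_set2_trm: "finite (set2_trm t)"
  by (induction t) auto

lemma finite_set3_fm: "finite (set3_fm \<phi>)"
  by (induction \<phi>) (auto simp: finite_set2_trm)

lemma fvt_subset: "fvt t \<subseteq> set2_trm t"
  by (induction t) auto

lemma fv_subset: "fv \<phi> \<subseteq> set3_fm \<phi>"
  by (induction \<phi>) (use fvt_subset in fastforce)+

lemma finite_fv: "finite (fv \<phi>)"
  by (rule finite_subset[OF fv_subset finite_set3_fm])

lemma evt_cong:
  assumes "\<And>v. v \<in> fvt t \<Longrightarrow> s v = s' v"
  shows "evt M s t = evt M s' t"
  using assms
proof (induction t)
  case (App f ts)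
  then have "map (evt M s) ts = map (evt M s') ts" by auto
  then show ?case by (simp only: evt.simps)
qed auto

lemma sat_cong:
  assumes "\<And>v. v \<in> fv \<phi> \<Longrightarrow> s v = s' v"
  shows "sat M s \<phi> \<longleftrightarrow> sat M s' \<phi>"
  using assms
proof (induction \<phi> arbitrary: s s')
  case FF
  show ?case by simp
next
  case (Eq t u)
  have "evt M s t = evt M s' t" "evt M s u = evt M s' u"
    by (rule evt_cong; simp add: Eq)+
  then show ?case by simp
next
  case (Rel r ts)
  have "map (evt M s) ts = map (evt M s') ts"
    by (rule map_cong[OF refl]; rule evt_cong) (use Rel in auto)
  then show ?case by (simp only: sat.simps)
next
  case (Neg \<phi>)
  show ?case using Neg.IH[of s s'] Neg.prems by simp
next
  case (Conj \<phi> \<psi>)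
  show ?case using Conj.IH(1)[of s s'] Conj.IH(2)[of s s'] Conj.prems by simp
next
  case (Ex v \<phi>)
  have "sat M (s(v := x)) \<phi> \<longleftrightarrow> sat M (s'(v := x)) \<phi>" for x
    by (rule Ex.IH) (simp add: Ex.prems)
  then show ?case by simp
qed

lemma evt_map_trm: "evt M s (map_trm (\<lambda>x. x) f (\<lambda>x. x) t) = evt M (s \<circ> f) t"
  by (induction t) (auto intro!: arg_cong[where f = "fint M _"])

text \<open>\<open>set3_fm\<close> also collects the bound variables, so injectivity on it rules out
  capture.\<close>

lemma sat_rename:
  assumes "inj_on f (set3_fm \<phi>)" and "\<And>v. v \<in> set3_fm \<phi> \<Longrightarrow> s' v = s (f v)"
  shows "sat M s (map_fm (\<lambda>x. x) (\<lambda>x. x) f (\<lambda>x. x) \<phi>) \<longleftrightarrow> sat M s' \<phi>"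
  using assms
proof (induction \<phi> arbitrary: s s')
  case (Eq t u)
  have "evt M s' t = evt M (s \<circ> f) t" "evt M s' u = evt M (s \<circ> f) u"
    by (rule evt_cong; use Eq.prems(2) fvt_subset in force)+
  then show ?case by (simp add: evt_map_trm)
next
  case (Rel r ts)
  have "map (evt M s') ts = map (evt M (s \<circ> f)) ts"
    using Rel.prems(2) fvt_subset by (fastforce intro!: evt_cong)
  then have "map (evt M s) (map (map_trm (\<lambda>x. x) f (\<lambda>x. x)) ts) = map (evt M s') ts"
    by (simp add: evt_map_trm comp_def)
  then show ?case by (simp only: fm.map sat.simps)
next
  case (Neg \<phi>)
  show ?case using Neg.IH[of s' s] Neg.prems by simp
next
  case (Conj \<phi> \<psi>)
  have "inj_on f (set3_fm \<phi>)" "inj_on f (set3_fm \<psi>)"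
    using Conj.prems(1) by (auto intro: inj_on_subset)
  then show ?case using Conj.IH(1)[of s' s] Conj.IH(2)[of s' s] Conj.prems(2) by simp
next
  case (Ex v \<phi>)
  have "sat M (s(f v := x)) (map_fm (\<lambda>x. x) (\<lambda>x. x) f (\<lambda>x. x) \<phi>) \<longleftrightarrow> sat M (s'(v := x)) \<phi>" for x
  proof (rule Ex.IH)
    show "inj_on f (set3_fm \<phi>)" using Ex.prems(1) by (auto intro: inj_on_subset)
    show "(s'(v := x)) w = (s(f v := x)) (f w)" if "w \<in> set3_fm \<phi>" for w
      using Ex.prems that by (auto simp: inj_on_def)
  qed
  then show ?case by simp
qed auto

lemma wft_map_trm: "wft ar (map_trm (\<lambda>x. x) f g t) \<longleftrightarrow> wft ar t"
  by (induction t) (auto simp: list_all_iff)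

lemma wff_map_fm: "wff M (map_fm (\<lambda>x. x) (\<lambda>x. x) f g \<phi>) \<longleftrightarrow> wff M \<phi>"
  by (induction \<phi>) (auto simp: wft_map_trm list_all_iff)

lemma part_map_trm: "part (map_trm (\<lambda>x. x) f g t) = g ` part t"
  by (induction t) auto

lemma params_map_fm: "params (map_fm (\<lambda>x. x) (\<lambda>x. x) f g \<phi>) = g ` params \<phi>"
  by (induction \<phi>) (auto simp: part_map_trm)

lemma finite_part: "finite (part t)"
  by (induction t) auto

lemma finite_params: "finite (params \<phi>)"
  by (induction \<phi>) (auto simp: finite_part)

section \<open>Substitution of parameters for free variables\<close>

primrec inst_trm :: "('v \<Rightarrow> 'a option) \<Rightarrow> ('f,'v,'a) trm \<Rightarrow> ('f,'v,'a) trm" where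
  "inst_trm \<theta> (Var v) = (case \<theta> v of None \<Rightarrow> Var v | Some c \<Rightarrow> Par c)"
| "inst_trm \<theta> (Par a) = Par a"
| "inst_trm \<theta> (App f ts) = App f (map (inst_trm \<theta>) ts)"

text \<open>Only parameters are substituted, so no capture can arise. This is how a condition on a
  tuple with some entries known becomes a formula to which saturation applies.\<close>

primrec inst :: "('v \<Rightarrow> 'a option) \<Rightarrow> ('f,'r,'v,'a) fm \<Rightarrow> ('f,'r,'v,'a) fm" where
  "inst \<theta> FF = FF"
| "inst \<theta> (Eq t u) = Eq (inst_trm \<theta> t) (inst_trm \<theta> u)"
| "inst \<theta> (Rel r ts) = Rel r (map (inst_trm \<theta>) ts)"
| "inst \<theta> (Neg \<phi>) = Neg (inst \<theta> \<phi>)"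
| "inst \<theta> (Conj \<phi> \<psi>) = Conj (inst \<theta> \<phi>) (inst \<theta> \<psi>)"
| "inst \<theta> (Ex v \<phi>) = Ex v (inst (\<theta>(v := None)) \<phi>)"

lemma evt_inst_trm:
  "evt M s (inst_trm \<theta> t) = evt M (\<lambda>v. case \<theta> v of None \<Rightarrow> s v | Some c \<Rightarrow> c) t"
  by (induction t) (auto split: option.split intro!: arg_cong[where f = "fint M _"])

lemma sat_inst:
  "sat M s (inst \<theta> \<phi>) \<longleftrightarrow> sat M (\<lambda>v. case \<theta> v of None \<Rightarrow> s v | Some c \<Rightarrow> c) \<phi>"
proof (induction \<phi> arbitrary: s \<theta>)
  case (Ex v \<phi>)
  have "(\<lambda>w. case (\<theta>(v := None)) w of None \<Rightarrow> (s(v := x)) w | Some c \<Rightarrow> c) =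
        (\<lambda>w. case \<theta> w of None \<Rightarrow> s w | Some c \<Rightarrow> c)(v := x)" for x
    by (auto split: option.split)
  then show ?case using Ex by simp
qed (simp_all add: evt_inst_trm comp_def)

lemma wft_inst_trm: "wft ar (inst_trm \<theta> t) \<longleftrightarrow> wft ar t"
  by (induction t) (auto simp: list_all_iff split: option.split)

lemma wff_inst: "wff M (inst \<theta> \<phi>) \<longleftrightarrow> wff M \<phi>"
  by (induction \<phi> arbitrary: \<theta>) (auto simp: wft_inst_trm list_all_iff)

lemma part_inst_trm: "part (inst_trm \<theta> t) \<subseteq> part t \<union> ran \<theta>"
  by (induction t) (auto split: option.split simp: ran_def)

lemma params_inst: "params (inst \<theta> \<phi>) \<subseteq> params \<phi> \<union> ran \<theta>"
proof (induction \<phi> arbitrary: \<theta>)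
  case (Ex v \<phi>)
  have "ran (\<theta>(v := None)) \<subseteq> ran \<theta>" by (auto simp: ran_def)
  then show ?case using Ex[of "\<theta>(v := None)"] unfolding inst.simps params.simps by blast
next
  case (Conj \<phi> \<psi>)
  show ?case using Conj[of \<theta>] by auto
next
  case (Eq t u)
  show ?case using part_inst_trm[of \<theta> t] part_inst_trm[of \<theta> u] by auto
next
  case (Rel r ts)
  show ?case using part_inst_trm[of \<theta>] by fastforce
qed auto

section \<open>Finite conjunctions and disjunctions\<close>

lemma ex_finite_conj:
  assumes "finite Q"
  obtains \<phi> :: "('f,'r,'v,'a) fm" where "params \<phi> = \<Union> (params ` Q)" and "fv \<phi> = \<Union> (fv ` Q)"
    and "\<And>M :: ('f,'r,'a) struc. wff M \<phi> \<longleftrightarrow> (\<forall>\<psi>\<in>Q. wff M \<psi>)"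
    and "\<And>(M :: ('f,'r,'a) struc) s. sat M s \<phi> \<longleftrightarrow> (\<forall>\<psi>\<in>Q. sat M s \<psi>)"
proof -
  have "\<exists>\<phi> :: ('f,'r,'v,'a) fm. params \<phi> = \<Union> (params ` Q) \<and> fv \<phi> = \<Union> (fv ` Q) \<and>
    (\<forall>M :: ('f,'r,'a) struc. wff M \<phi> \<longleftrightarrow> (\<forall>\<psi>\<in>Q. wff M \<psi>)) \<and>
    (\<forall>(M :: ('f,'r,'a) struc) s. sat M s \<phi> \<longleftrightarrow> (\<forall>\<psi>\<in>Q. sat M s \<psi>))"
    using assms
  proof induction
    case empty
    show ?case by (rule exI[of _ "Neg FF"]) simp
  next
    case (insert \<psi> Q)
    then obtain \<phi> :: "('f,'r,'v,'a) fm" where "params \<phi> = \<Union> (params ` Q)" "fv \<phi> = \<Union> (fv ` Q)"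
      "\<forall>M :: ('f,'r,'a) struc. wff M \<phi> \<longleftrightarrow> (\<forall>\<psi>\<in>Q. wff M \<psi>)"
      "\<forall>(M :: ('f,'r,'a) struc) s. sat M s \<phi> \<longleftrightarrow> (\<forall>\<psi>\<in>Q. sat M s \<psi>)" by blast
    then show ?case by (intro exI[of _ "Conj \<psi> \<phi>"]) simp
  qed
  then show thesis using that by blast
qed

lemma ex_finite_disj:
  assumes "finite Q"
  obtains \<phi> :: "('f,'r,'v,'a) fm" where "params \<phi> = \<Union> (params ` Q)" and "fv \<phi> = \<Union> (fv ` Q)"
    and "\<And>M :: ('f,'r,'a) struc. wff M \<phi> \<longleftrightarrow> (\<forall>\<psi>\<in>Q. wff M \<psi>)"
    and "\<And>(M :: ('f,'r,'a) struc) s. sat M s \<phi> \<longleftrightarrow> (\<exists>\<psi>\<in>Q. sat M s \<psi>)"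
proof -
  obtain \<phi> :: "('f,'r,'v,'a) fm" where "params \<phi> = \<Union> (params ` Neg ` Q)" "fv \<phi> = \<Union> (fv ` Neg ` Q)"
    "\<And>M :: ('f,'r,'a) struc. wff M \<phi> \<longleftrightarrow> (\<forall>\<psi>\<in>Neg ` Q. wff M \<psi>)"
    "\<And>(M :: ('f,'r,'a) struc) s. sat M s \<phi> \<longleftrightarrow> (\<forall>\<psi>\<in>Neg ` Q. sat M s \<psi>)"
    by (rule ex_finite_conj[OF finite_imageI[OF assms, of Neg]]) blast
  then show thesis by (intro that[of "Neg \<phi>"]) auto
qed

section \<open>Automorphisms\<close>

lemma autD:
  assumes "aut M \<sigma>"
  shows "bij_betw \<sigma> (carr M) (carr M)" "x \<in> carr M \<Longrightarrow> \<sigma> x \<in> carr M" "inj_on \<sigma> (carr M)"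
  using assms by (auto simp: aut_def bij_betw_def)

lemma aut_fint:
  "aut M \<sigma> \<Longrightarrow> length xs = far M f \<Longrightarrow> set xs \<subseteq> carr M \<Longrightarrow> \<sigma> (fint M f xs) = fint M f (map \<sigma> xs)"
  unfolding aut_def by blast

lemma aut_rint:
  "aut M \<sigma> \<Longrightarrow> length xs = rar M r \<Longrightarrow> set xs \<subseteq> carr M \<Longrightarrow> rint M r xs \<longleftrightarrow> rint M r (map \<sigma> xs)"
  unfolding aut_def by blast

lemma evt_carr:
  assumes "struct M" "wft (far M) t" "part t \<subseteq> carr M" "s ` fvt t \<subseteq> carr M"
  shows "evt M s t \<in> carr M"
  using assms(2-)
proof (induction t)
  case (App f ts)
  have "evt M s t \<in> carr M" if "t \<in> set ts" for t
    by (rule App.IH[OF that]) (use App.prems that in \<open>auto simp: list_all_iff image_subset_iff\<close>)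
  then have "set (map (evt M s) ts) \<subseteq> carr M" by auto
  moreover have "length (map (evt M s) ts) = far M f" using App.prems(1) by simp
  ultimately show ?case using assms(1) unfolding struct_def evt.simps by blast
qed simp_all

lemma evt_aut:
  assumes "struct M" "aut M \<sigma>" "wft (far M) t" "part t \<subseteq> carr M" "s ` fvt t \<subseteq> carr M"
  shows "evt M (\<sigma> \<circ> s) (map_trm (\<lambda>x. x) (\<lambda>x. x) \<sigma> t) = \<sigma> (evt M s t)"
  using assms(3-)
proof (induction t)
  case (App f ts)
  have wf: "wft (far M) t" "part t \<subseteq> carr M" "s ` fvt t \<subseteq> carr M" if "t \<in> set ts" for t
    using App.prems that by (auto simp: list_all_iff image_subset_iff)
  have "map (evt M (\<sigma> \<circ> s)) (map (map_trm (\<lambda>x. x) (\<lambda>x. x) \<sigma>) ts) = map \<sigma> (map (evt M s) ts)"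
    unfolding map_map by (rule map_cong[OF refl]) (simp only: comp_apply App.IH wf)
  moreover have "\<sigma> (fint M f (map (evt M s) ts)) = fint M f (map \<sigma> (map (evt M s) ts))"
    by (rule aut_fint[OF assms(2)]) (use App.prems(1) in \<open>auto intro!: evt_carr[OF assms(1)] wf simp del: image_subset_iff\<close>)
  ultimately show ?case by (simp only: trm.map evt.simps)
qed auto

lemma sat_aut:
  assumes "struct M" "aut M \<sigma>" "wff M \<phi>" "params \<phi> \<subseteq> carr M" "s ` fv \<phi> \<subseteq> carr M"
  shows "sat M (\<sigma> \<circ> s) (map_fm (\<lambda>x. x) (\<lambda>x. x) (\<lambda>x. x) \<sigma> \<phi>) \<longleftrightarrow> sat M s \<phi>"
  using assms(3-)
proof (induction \<phi> arbitrary: s)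
  case (Eq t u)
  have "evt M s t \<in> carr M" "evt M s u \<in> carr M"
    using Eq by (auto intro!: evt_carr[OF assms(1)])
  moreover have "evt M (\<sigma> \<circ> s) (map_trm (\<lambda>x. x) (\<lambda>x. x) \<sigma> t) = \<sigma> (evt M s t)"
    "evt M (\<sigma> \<circ> s) (map_trm (\<lambda>x. x) (\<lambda>x. x) \<sigma> u) = \<sigma> (evt M s u)"
    using Eq by (auto intro!: evt_aut[OF assms(1,2)])
  ultimately show ?case
    using inj_on_eq_iff[OF autD(3)[OF assms(2)]] by (simp only: fm.map sat.simps)
next
  case (Rel r ts)
  have wf: "wft (far M) t" "part t \<subseteq> carr M" "s ` fvt t \<subseteq> carr M" if "t \<in> set ts" for t
    using Rel.prems that by (auto simp: list_all_iff image_subset_iff)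
  have "map (evt M (\<sigma> \<circ> s)) (map (map_trm (\<lambda>x. x) (\<lambda>x. x) \<sigma>) ts) = map \<sigma> (map (evt M s) ts)"
    unfolding map_map by (rule map_cong[OF refl]) (simp only: comp_apply evt_aut[OF assms(1,2)] wf)
  moreover have "rint M r (map (evt M s) ts) \<longleftrightarrow> rint M r (map \<sigma> (map (evt M s) ts))"
    by (rule aut_rint[OF assms(2)]) (use Rel.prems(1) in \<open>auto intro!: evt_carr[OF assms(1)] wf simp del: image_subset_iff\<close>)
  ultimately show ?case by (simp only: fm.map sat.simps)
next
  case (Conj \<phi> \<psi>)
  have "s ` fv \<phi> \<subseteq> carr M" "s ` fv \<psi> \<subseteq> carr M" using Conj.prems(3) by (auto simp: image_Un)
  then show ?case using Conj.IH(1)[of s] Conj.IH(2)[of s] Conj.prems by simp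
next
  case (Ex v \<phi>)
  let ?\<psi> = "map_fm (\<lambda>x. x) (\<lambda>x. x) (\<lambda>x. x) \<sigma> \<phi>"
  have *: "sat M ((\<sigma> \<circ> s)(v := \<sigma> x)) ?\<psi> \<longleftrightarrow> sat M (s(v := x)) \<phi>" if "x \<in> carr M" for x
  proof -
    have "s(v := x) ` fv \<phi> \<subseteq> carr M" using Ex.prems(3) that by (auto simp: image_subset_iff)
    moreover have "(\<sigma> \<circ> s)(v := \<sigma> x) = \<sigma> \<circ> s(v := x)" by (rule ext) simp
    ultimately show ?thesis using Ex.IH[of "s(v := x)"] Ex.prems by (simp only: wff.simps params.simps)
  qed
  have "(\<exists>y\<in>carr M. sat M ((\<sigma> \<circ> s)(v := y)) ?\<psi>) \<longleftrightarrow>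
      (\<exists>y\<in>\<sigma> ` carr M. sat M ((\<sigma> \<circ> s)(v := y)) ?\<psi>)"
    using autD(1)[OF assms(2)] by (simp only: bij_betw_def)
  also have "\<dots> \<longleftrightarrow> (\<exists>x\<in>carr M. sat M (s(v := x)) \<phi>)"
    using * by blast
  finally show ?case by (simp only: fm.map sat.simps)
qed auto

text \<open>An automorphism is a total function with arbitrary values outside \<open>carr M\<close>,
  so it can only be inverted on \<open>carr M\<close>, and the group laws hold only there.\<close>

definition ainv :: "('f,'r,'a) struc \<Rightarrow> ('a \<Rightarrow> 'a) \<Rightarrow> 'a \<Rightarrow> 'a" where
  "ainv M \<sigma> = inv_into (carr M) \<sigma>"

lemma aut_id: "aut M (\<lambda>x. x)"
  by (simp add: aut_def bij_betw_def)

lemma aut_comp: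
  assumes "aut M \<sigma>" "aut M \<tau>"
  shows "aut M (\<sigma> \<circ> \<tau>)"
  unfolding aut_def
proof (intro conjI allI impI)
  show "bij_betw (\<sigma> \<circ> \<tau>) (carr M) (carr M)"
    using autD(1)[OF assms(1)] autD(1)[OF assms(2)] by (rule bij_betw_trans[rotated])
  have im: "set (map \<tau> xs) \<subseteq> carr M" if "set xs \<subseteq> carr M" for xs
    using that autD(2)[OF assms(2)] by auto
  show "(\<sigma> \<circ> \<tau>) (fint M f xs) = fint M f (map (\<sigma> \<circ> \<tau>) xs)"
    if "length xs = far M f \<and> set xs \<subseteq> carr M" for f xs
    using that im[of xs] assms unfolding aut_def by (metis comp_def length_map map_map)
  show "rint M r xs \<longleftrightarrow> rint M r (map (\<sigma> \<circ> \<tau>) xs)"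
    if "length xs = rar M r \<and> set xs \<subseteq> carr M" for r xs
    using that im[of xs] assms unfolding aut_def by (metis length_map map_map)
qed

lemma ainv_simps:
  assumes "aut M \<sigma>" "x \<in> carr M"
  shows "\<sigma> (ainv M \<sigma> x) = x" "ainv M \<sigma> (\<sigma> x) = x" "ainv M \<sigma> x \<in> carr M"
  using assms autD[OF assms(1)]
  by (simp_all add: ainv_def bij_betw_def f_inv_into_f inv_into_into)

lemma aut_ainv:
  assumes "struct M" "aut M \<sigma>"
  shows "aut M (ainv M \<sigma>)"
  unfolding aut_def
proof (intro conjI allI impI)
  note inv = ainv_simps[OF assms(2)]
  show "bij_betw (ainv M \<sigma>) (carr M) (carr M)"
    using autD(1)[OF assms(2)] by (simp add: ainv_def bij_betw_inv_into)
  have im: "set (map (ainv M \<sigma>) xs) \<subseteq> carr M" "map \<sigma> (map (ainv M \<sigma>) xs) = xs"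
    if "set xs \<subseteq> carr M" for xs
    using that inv by (auto simp: map_idI subset_iff)
  show "ainv M \<sigma> (fint M f xs) = fint M f (map (ainv M \<sigma>) xs)"
    if "length xs = far M f \<and> set xs \<subseteq> carr M" for f xs
  proof -
    let ?ys = "map (ainv M \<sigma>) xs"
    have "\<sigma> (fint M f ?ys) = fint M f xs"
      using that im[of xs] assms(2) unfolding aut_def by (metis length_map)
    moreover have "fint M f ?ys \<in> carr M" using assms(1) that im[of xs] by (simp add: struct_def)
    ultimately show ?thesis using inv(2) by metis
  qed
  show "rint M r xs \<longleftrightarrow> rint M r (map (ainv M \<sigma>) xs)"
    if "length xs = rar M r \<and> set xs \<subseteq> carr M" for r xs
    using that im[of xs] assms(2) unfolding aut_def by (metis length_map)
qed

lemma ainv_image: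
  assumes "aut M \<sigma>" "A \<subseteq> carr M"
  shows "ainv M \<sigma> ` \<sigma> ` A = A" "\<sigma> ` ainv M \<sigma> ` A = A"
  using assms ainv_simps[OF assms(1)] by (auto simp: subset_iff image_iff)

lemma autC_I:
  assumes "aut M \<sigma>" "\<And>x. x \<in> C \<Longrightarrow> \<sigma> x = x"
  shows "\<sigma> \<in> autC M C"
  using assms by (simp add: autC_def)

lemma autC_D:
  assumes "\<sigma> \<in> autC M C"
  shows "aut M \<sigma>" "x \<in> C \<Longrightarrow> \<sigma> x = x"
  using assms by (simp_all add: autC_def)

lemma autC_image: "\<sigma> \<in> autC M C \<Longrightarrow> \<sigma> ` C = C"
  by (auto simp: autC_def)

lemma autC_ainv:
  assumes "struct M" "\<sigma> \<in> autC M C" "C \<subseteq> carr M"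
  shows "ainv M \<sigma> \<in> autC M C"
proof (rule autC_I)
  show "aut M (ainv M \<sigma>)" by (rule aut_ainv[OF assms(1) autC_D(1)[OF assms(2)]])
  show "ainv M \<sigma> x = x" if "x \<in> C" for x
    using ainv_simps(2)[OF autC_D(1)[OF assms(2)], of x] autC_D(2)[OF assms(2) that] that assms(3)
    by auto
qed

lemma autC_comp: "\<sigma> \<in> autC M C \<Longrightarrow> \<tau> \<in> autC M C \<Longrightarrow> \<sigma> \<circ> \<tau> \<in> autC M C"
  by (simp add: autC_def aut_comp)

section \<open>Algebraic closure\<close>

lemma acl_subset: "acl M X \<subseteq> carr M"
  by (auto simp: acl_def)

lemma acl_mono: "X \<subseteq> Y \<Longrightarrow> acl M X \<subseteq> acl M Y"
  unfolding acl_def by blast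

lemma acl_increasing:
  fixes M :: "('f,'r,'a) struc"
  assumes "X \<subseteq> carr M"
  shows "X \<subseteq> acl M X"
proof
  fix x assume x: "x \<in> X"
  let ?\<phi> = "Eq (Var undefined) (Par x) :: ('f,'r,'a) form"
  have "wf_fm M ?\<phi>" "params ?\<phi> \<subseteq> X" using x assms by (auto simp: wf_fm_def)
  moreover have "{b \<in> carr M. sat M (\<lambda>_. b) ?\<phi>} \<subseteq> {x}" by auto
  then have "finite {b \<in> carr M. sat M (\<lambda>_. b) ?\<phi>}" by (rule finite_subset) simp
  moreover have "sat M (\<lambda>_. x) ?\<phi>" by simp
  ultimately show "x \<in> acl M X" unfolding acl_def using x assms by blast
qed

lemma closedI: "X \<subseteq> carr M \<Longrightarrow> acl M X \<subseteq> X \<Longrightarrow> closed M X"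
  using acl_increasing[of X M] by (auto simp: closed_def)

lemma closedD: "closed M X \<Longrightarrow> X \<subseteq> carr M" "closed M X \<Longrightarrow> acl M X = X"
  by (simp_all add: closed_def)

lemma closed_Int:
  assumes "closed M A" "closed M B"
  shows "closed M (A \<inter> B)"
  using assms acl_mono[of "A \<inter> B" A M] acl_mono[of "A \<inter> B" B M]
  by (intro closedI) (auto simp: closed_def)

lemma acl_image_subset:
  fixes M :: "('f,'r,'a) struc"
  assumes "struct M" "aut M \<sigma>" "X \<subseteq> carr M"
  shows "\<sigma> ` acl M X \<subseteq> acl M (\<sigma> ` X)"
proof
  fix y assume "y \<in> \<sigma> ` acl M X"
  then obtain x \<phi> where x: "y = \<sigma> x" "x \<in> carr M" and \<phi>: "wf_fm M \<phi>" "params \<phi> \<subseteq> X"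
    "finite {b \<in> carr M. sat M (\<lambda>_. b) \<phi>}" "sat M (\<lambda>_. x) (\<phi> :: ('f,'r,'a) form)"
    unfolding acl_def by blast
  let ?\<psi> = "map_fm (\<lambda>x. x) (\<lambda>x. x) (\<lambda>x. x) \<sigma> \<phi>"
  have s: "sat M (\<lambda>_. \<sigma> b) ?\<psi> \<longleftrightarrow> sat M (\<lambda>_. b) \<phi>" if "b \<in> carr M" for b
    using sat_aut[OF assms(1,2), of \<phi> "\<lambda>_. b"] \<phi>(1) that by (auto simp: wf_fm_def comp_def)
  have surj: "carr M = \<sigma> ` carr M" using autD(1)[OF assms(2)] by (simp add: bij_betw_def)
  have "{b \<in> carr M. sat M (\<lambda>_. b) ?\<psi>} \<subseteq> \<sigma> ` {b \<in> carr M. sat M (\<lambda>_. b) \<phi>}"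
  proof
    fix c assume c: "c \<in> {b \<in> carr M. sat M (\<lambda>_. b) ?\<psi>}"
    then obtain b where "b \<in> carr M" "c = \<sigma> b" using surj by blast
    then show "c \<in> \<sigma> ` {b \<in> carr M. sat M (\<lambda>_. b) \<phi>}" using c s by blast
  qed
  then have "finite {b \<in> carr M. sat M (\<lambda>_. b) ?\<psi>}" using \<phi>(3) finite_subset by blast
  moreover have "wf_fm M ?\<psi>" "params ?\<psi> \<subseteq> \<sigma> ` X"
    using \<phi>(1,2) autD(2)[OF assms(2)] by (auto simp: wf_fm_def wff_map_fm params_map_fm)
  ultimately show "y \<in> acl M (\<sigma> ` X)"
    using x s[of x] \<phi>(4) autD(2)[OF assms(2), of x] unfolding acl_def by blast
qed

lemma closed_image:
  assumes "struct M" "aut M \<sigma>" "closed M X"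
  shows "closed M (\<sigma> ` X)"
proof (rule closedI)
  have X: "X \<subseteq> carr M" and "acl M X = X" using assms(3) by (auto simp: closed_def)
  show \<sigma>X: "\<sigma> ` X \<subseteq> carr M" using X autD(2)[OF assms(2)] by auto
  have "ainv M \<sigma> ` acl M (\<sigma> ` X) \<subseteq> acl M (ainv M \<sigma> ` \<sigma> ` X)"
    by (rule acl_image_subset[OF assms(1) aut_ainv[OF assms(1,2)] \<sigma>X])
  then have "ainv M \<sigma> ` acl M (\<sigma> ` X) \<subseteq> X"
    using ainv_image(1)[OF assms(2) X] \<open>acl M X = X\<close> by simp
  then have "\<sigma> ` ainv M \<sigma> ` acl M (\<sigma> ` X) \<subseteq> \<sigma> ` X" by (rule image_mono)
  then show "acl M (\<sigma> ` X) \<subseteq> \<sigma> ` X"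
    by (simp add: ainv_image(2)[OF assms(2) acl_subset])
qed

section \<open>Small sets\<close>

lemma finite_card_ordLess:
  assumes "finite A" "infinite B"
  shows "|A| <o |B|"
  by (rule finite_ordLess_infinite) (use assms in \<open>simp_all add: card_of_well_order_on Field_card_of\<close>)

lemma card_lists_ordLeq:
  assumes "infinite W"
  shows "|lists W| \<le>o |W|"
proof -
  have "|{xs \<in> lists W. length xs = n}| \<le>o |W|" for n
  proof (induction n)
    case 0
    have "{xs \<in> lists W. length xs = 0} = {[]}" by auto
    then show ?case using assms by (simp add: ordLess_imp_ordLeq finite_card_ordLess)
  next
    case (Suc n)
    have "{xs \<in> lists W. length xs = Suc n} = (\<lambda>(x, xs). x # xs) ` (W \<times> {xs \<in> lists W. length xs = n})"
      by (auto simp: length_Suc_conv image_iff)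
    moreover have "|W \<times> {xs \<in> lists W. length xs = n}| \<le>o |W|"
      using Suc by (intro card_of_Sigma_ordLeq_infinite assms) (auto simp: card_of_refl ordIso_imp_ordLeq)
    ultimately show ?case using ordLeq_transitive[OF card_of_image] by simp
  qed
  moreover have "|UNIV :: nat set| \<le>o |W|"
    using assms infinite_iff_card_of_nat by blast
  ultimately have "|\<Union>n. {xs \<in> lists W. length xs = n}| \<le>o |W|"
    by (intro card_of_UNION_ordLeq_infinite assms) simp_all
  moreover have "(\<Union>n. {xs \<in> lists W. length xs = n}) = lists W" by auto
  ultimately show ?thesis by simp
qed

section \<open>Counting formulas by encoding them as words\<close>

type_synonym ('f,'r,'a) token = "'a + 'f + 'r + nat"

abbreviation tokP :: "'a \<Rightarrow> ('f,'r,'a) token" where "tokP a \<equiv> Inl a"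
abbreviation tokF :: "'f \<Rightarrow> ('f,'r,'a) token" where "tokF f \<equiv> Inr (Inl f)"
abbreviation tokR :: "'r \<Rightarrow> ('f,'r,'a) token" where "tokR r \<equiv> Inr (Inr (Inl r))"
abbreviation tokN :: "nat \<Rightarrow> ('f,'r,'a) token" where "tokN n \<equiv> Inr (Inr (Inr n))"

text \<open>The leading number marks the constructor. The number of arguments is written out because
  the terms that are counted need not respect arities, so the symbol alone does not tell where its
  arguments end.\<close>

primrec enc_trm :: "('f,nat,'a) trm \<Rightarrow> ('f,'r,'a) token list" where
  "enc_trm (Var n) = [tokN 0, tokN n]"
| "enc_trm (Par a) = [tokN 1, tokP a]"
| "enc_trm (App f ts) = tokN 2 # tokF f # tokN (length ts) # concat (map enc_trm ts)"

primrec enc_fm :: "('f,'r,nat,'a) fm \<Rightarrow> ('f,'r,'a) token list" where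
  "enc_fm FF = [tokN 0]"
| "enc_fm (Eq t u) = tokN 1 # enc_trm t @ enc_trm u"
| "enc_fm (Rel r ts) = tokN 2 # tokR r # tokN (length ts) # concat (map enc_trm ts)"
| "enc_fm (Neg \<phi>) = tokN 3 # enc_fm \<phi>"
| "enc_fm (Conj \<phi> \<psi>) = tokN 4 # enc_fm \<phi> @ enc_fm \<psi>"
| "enc_fm (Ex n \<phi>) = tokN 5 # tokN n # enc_fm \<phi>"

lemma concat_prefix_free:
  assumes "\<And>t u xs ys. t \<in> set ts \<Longrightarrow> e t @ xs = e u @ ys \<Longrightarrow> t = u \<and> xs = ys"
    and "length ts = length us" "concat (map e ts) @ xs = concat (map e us) @ ys"
  shows "ts = us \<and> xs = ys"
  using assms
proof (induction ts arbitrary: us)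
  case (Cons t ts)
  obtain u us' where us: "us = u # us'" using Cons.prems(2) by (cases us) auto
  have "e t @ (concat (map e ts) @ xs) = e u @ (concat (map e us') @ ys)"
    using Cons.prems(3) us by simp
  then have "t = u \<and> concat (map e ts) @ xs = concat (map e us') @ ys"
    by (rule Cons.prems(1)[rotated]) simp
  then show ?case
    using Cons.IH[of us'] Cons.prems(1,2) us by (metis length_Cons list.set_intros(2) nat.inject)
qed simp

text \<open>Injectivity alone would not survive the induction, since the arguments are concatenated;
  with arbitrary continuations \<open>xs\<close> and \<open>ys\<close> the words can be parsed from
  the left.\<close>

lemma enc_trm_prefix_free:
  "enc_trm t @ xs = enc_trm u @ ys \<Longrightarrow> t = u \<and> xs = ys"
proof (induction t arbitrary: u xs ys)
  case (Var n)
  then show ?case by (cases u) auto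
next
  case (Par a)
  then show ?case by (cases u) auto
next
  case (App f ts)
  from App.prems obtain us where u: "u = App f us" "length ts = length us"
    "concat (map enc_trm ts) @ xs = concat (map enc_trm us) @ ys"
    by (cases u) auto
  have "ts = us \<and> xs = ys"
    by (rule concat_prefix_free[OF _ u(2,3)]) (rule App.IH)
  then show ?case using u(1) by blast
qed

lemma enc_fm_prefix_free:
  "enc_fm \<phi> @ xs = enc_fm \<psi> @ ys \<Longrightarrow> \<phi> = \<psi> \<and> xs = ys"
proof (induction \<phi> arbitrary: \<psi> xs ys)
  case FF
  then show ?case by (cases \<psi>) auto
next
  case (Eq t u)
  from Eq.prems obtain t' u' where *: "\<psi> = Eq t' u'"
    "enc_trm t @ (enc_trm u @ xs) = enc_trm t' @ (enc_trm u' @ ys)"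
    by (cases \<psi>) auto
  have "t = t' \<and> enc_trm u @ xs = enc_trm u' @ ys" by (rule enc_trm_prefix_free[OF *(2)])
  then show ?case using *(1) enc_trm_prefix_free[of u xs u' ys] by blast
next
  case (Rel r ts)
  from Rel.prems obtain us where *: "\<psi> = Rel r us" "length ts = length us"
    "concat (map enc_trm ts) @ xs = concat (map enc_trm us) @ ys"
    by (cases \<psi>) auto
  have "ts = us \<and> xs = ys"
    by (rule concat_prefix_free[OF _ *(2,3)]) (rule enc_trm_prefix_free)
  then show ?case using *(1) by blast
next
  case (Neg \<phi>)
  from Neg.prems obtain \<psi>' where *: "\<psi> = Neg \<psi>'" "enc_fm \<phi> @ xs = enc_fm \<psi>' @ ys" by (cases \<psi>) auto
  show ?case using Neg.IH[OF *(2)] *(1) by simp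
next
  case (Conj \<phi>1 \<phi>2)
  from Conj.prems obtain \<psi>1 \<psi>2 where *: "\<psi> = Conj \<psi>1 \<psi>2"
    "enc_fm \<phi>1 @ (enc_fm \<phi>2 @ xs) = enc_fm \<psi>1 @ (enc_fm \<psi>2 @ ys)"
    by (cases \<psi>) auto
  have "\<phi>1 = \<psi>1 \<and> enc_fm \<phi>2 @ xs = enc_fm \<psi>2 @ ys" by (rule Conj.IH(1)[OF *(2)])
  then show ?case using *(1) Conj.IH(2)[of xs \<psi>2 ys] by blast
next
  case (Ex n \<phi>)
  from Ex.prems obtain \<psi>' where *: "\<psi> = Ex n \<psi>'" "enc_fm \<phi> @ xs = enc_fm \<psi>' @ ys" by (cases \<psi>) auto
  show ?case using Ex.IH[OF *(2)] *(1) by simp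
qed

lemma inj_enc_fm: "inj enc_fm"
  by (rule injI) (use enc_fm_prefix_free[of _ "[]" _ "[]"] in auto)

lemma enc_trm_tokens: "part t \<subseteq> X \<Longrightarrow> set (enc_trm t) \<subseteq> X <+> UNIV"
  by (induction t) auto

lemma enc_fm_tokens: "params \<phi> \<subseteq> X \<Longrightarrow> set (enc_fm \<phi>) \<subseteq> X <+> UNIV"
proof (induction \<phi>)
  case (Eq t u)
  then show ?case using enc_trm_tokens[of t X] enc_trm_tokens[of u X] by auto
next
  case (Rel r ts)
  then have "set (enc_trm t) \<subseteq> X <+> UNIV" if "t \<in> set ts" for t
    using that by (intro enc_trm_tokens) auto
  then show ?case by auto
qed auto

lemma card_fm_ordLeq:
  assumes "infinite W" "|X| \<le>o |W|" "|UNIV :: 'f set| \<le>o |W|" "|UNIV :: 'r set| \<le>o |W|"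
  shows "|{\<phi> :: ('f,'r,nat,'a) fm. params \<phi> \<subseteq> X}| \<le>o |W|"
proof -
  let ?T = "X <+> (UNIV :: ('f + 'r + nat) set)"
  have plus: "|A <+> B| \<le>o |W|" if "|A| \<le>o |W|" "|B| \<le>o |W|" for A :: "'x set" and B :: "'y set"
    using ordLeq_ordIso_trans[OF card_of_Plus_mono[OF that] card_of_Plus_infinite1[OF assms(1)]]
    by (simp add: card_of_refl ordIso_imp_ordLeq)
  have nat: "|UNIV :: nat set| \<le>o |W|" using assms(1) infinite_iff_card_of_nat by blast
  have T: "|?T| \<le>o |W|"
    using plus[OF assms(2) plus[OF assms(3) plus[OF assms(4) nat]]] by (simp add: UNIV_Plus_UNIV)
  have "infinite ?T" by (simp add: finite_Plus_iff)
  then have lists: "|lists ?T| \<le>o |W|" by (rule ordLeq_transitive[OF card_lists_ordLeq T])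
  have "enc_fm ` {\<phi> :: ('f,'r,nat,'a) fm. params \<phi> \<subseteq> X} \<subseteq> lists ?T"
    using enc_fm_tokens by fastforce
  then have "|{\<phi> :: ('f,'r,nat,'a) fm. params \<phi> \<subseteq> X}| \<le>o |lists ?T|"
    using inj_on_subset[OF inj_enc_fm subset_UNIV] by (intro card_of_ordLeqI) auto
  then show ?thesis by (rule ordLeq_transitive[OF _ lists])
qed

text \<open>The variables range over \<open>'a \<times> nat\<close>, which may be larger than \<open>K\<close>; renaming
  them into \<open>nat\<close> makes the formulas over a small set few enough.\<close>

lemma acl_nat:
  fixes M :: "('f,'r,'a) struc"
  assumes "x \<in> acl M X"
  shows "\<exists>\<phi> :: ('f,'r,nat,'a) fm. params \<phi> \<subseteq> X \<and> finite {b \<in> carr M. sat M (\<lambda>_. b) \<phi>} \<and>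
    x \<in> {b \<in> carr M. sat M (\<lambda>_. b) \<phi>}"
proof -
  obtain \<phi> :: "('f,'r,'a) form" where \<phi>: "params \<phi> \<subseteq> X"
    "finite {b \<in> carr M. sat M (\<lambda>_. b) \<phi>}" "sat M (\<lambda>_. x) \<phi>" and "x \<in> carr M"
    using assms unfolding acl_def by blast
  obtain f :: "'a \<times> nat \<Rightarrow> nat" where "inj_on f (set3_fm \<phi>)"
    using finite_imp_inj_to_nat_seg[OF finite_set3_fm[of \<phi>]] by (elim exE conjE)
  then have *: "sat M (\<lambda>_. b) (map_fm (\<lambda>x. x) (\<lambda>x. x) f (\<lambda>x. x) \<phi>) \<longleftrightarrow> sat M (\<lambda>_. b) \<phi>" for b
    by (rule sat_rename) simp
  show ?thesis
    by (rule exI[of _ "map_fm (\<lambda>x. x) (\<lambda>x. x) f (\<lambda>x. x) \<phi>"])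
      (use \<phi> \<open>x \<in> carr M\<close> in \<open>simp add: params_map_fm *\<close>)
qed

text \<open>The closure is covered by finite solution sets, one for each formula over
  \<open>X\<close>, and these formulas are counted by \<open>card_fm_ordLeq\<close>.\<close>

lemma card_acl_ordLeq:
  fixes M :: "('f,'r,'a) struc"
  assumes "infinite W" "|X| \<le>o |W|" "|UNIV :: 'f set| \<le>o |W|" "|UNIV :: 'r set| \<le>o |W|"
  shows "|acl M X| \<le>o |W|"
proof -
  let ?F = "{\<phi> :: ('f,'r,nat,'a) fm. params \<phi> \<subseteq> X}"
  let ?S = "\<lambda>\<phi> :: ('f,'r,nat,'a) fm. {b \<in> carr M. sat M (\<lambda>_. b) \<phi>}"
  \<comment> \<open>Infinite solution sets are replaced by the empty set, which makes every member
    of the union finite.\<close>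
  let ?S' = "\<lambda>\<phi>. if finite (?S \<phi>) then ?S \<phi> else {}"
  have "|?S' \<phi>| \<le>o |W|" for \<phi>
    by (rule ordLess_imp_ordLeq[OF finite_card_ordLess[OF _ assms(1)]]) simp
  then have "|\<Union>\<phi>\<in>?F. ?S' \<phi>| \<le>o |W|"
    by (intro card_of_UNION_ordLeq_infinite[OF assms(1) card_fm_ordLeq[OF assms]] ballI)
  moreover have "acl M X \<subseteq> (\<Union>\<phi>\<in>?F. ?S' \<phi>)"
  proof
    fix x assume "x \<in> acl M X"
    then obtain \<phi> :: "('f,'r,nat,'a) fm" where "\<phi> \<in> ?F" "finite (?S \<phi>)" "x \<in> ?S \<phi>"
      using acl_nat[OF \<open>x \<in> acl M X\<close>] by (elim exE conjE) simp
    then show "x \<in> (\<Union>\<phi>\<in>?F. ?S' \<phi>)" by (intro UN_I[of \<phi>]) simp_all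
  qed
  then have "|acl M X| \<le>o |\<Union>\<phi>\<in>?F. ?S' \<phi>|" by (rule card_of_mono1)
  ultimately show ?thesis by (rule ordLeq_transitive[rotated])
qed

section \<open>The monster model and its small sets\<close>

locale monster_model =
  fixes M :: "('f,'r,'a) struc" and K :: "'k set"
  assumes monster: "monster M K"
begin

lemma struct: "struct M"
  using monster by (simp add: monster_def)

lemma card_index: "|UNIV :: 'f set| <o |K|" "|UNIV :: 'r set| <o |K|" "|UNIV :: nat set| <o |K|"
  using monster by (simp_all add: monster_def)

lemma infinite_K: "infinite K"
  using ordLess_imp_ordLeq[OF card_index(3)] by (simp add: infinite_iff_card_of_nat)

lemma small_subset: "small K A \<Longrightarrow> B \<subseteq> A \<Longrightarrow> small K B"
  unfolding small_def by (rule ordLeq_ordLess_trans[OF card_of_mono1])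

lemma small_Un: "small K A \<Longrightarrow> small K B \<Longrightarrow> small K (A \<union> B)"
  unfolding small_def by (rule card_of_Un_ordLess_infinite[OF infinite_K])

lemma small_image: "small K A \<Longrightarrow> small K (f ` A)"
  unfolding small_def by (rule ordLeq_ordLess_trans[OF card_of_image])

lemma small_finite: "finite A \<Longrightarrow> small K A"
  unfolding small_def using infinite_K by (simp add: finite_card_ordLess)

text \<open>The cardinal of \<open>K\<close> may be singular, so a union of few small sets could
  fail to be small. All counting is therefore done with \<open>\<le>o\<close> against one infinite
  \<open>W\<close> strictly below \<open>K\<close> that bounds both \<open>X\<close> and the
  language.\<close>

lemma small_bound:
  assumes "small K X"
  obtains W :: "('a + 'f + 'r + nat) set" where "infinite W" "|W| <o |K|"
    "|X :: 'a set| \<le>o |W|" "|UNIV :: 'f set| \<le>o |W|" "|UNIV :: 'r set| \<le>o |W|"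
proof -
  let ?W = "X <+> (UNIV :: 'f set) <+> (UNIV :: 'r set) <+> (UNIV :: nat set)"
  have lt: "|?W| <o |K|"
    using assms card_index unfolding small_def
    by (intro card_of_Plus_ordLess_infinite[OF infinite_K])
  have "infinite ?W" by (simp add: finite_Plus_iff)
  moreover have "|UNIV :: 'f set| \<le>o |?W|"
    by (rule ordLeq_transitive[OF card_of_Plus1 card_of_Plus2])
  moreover have "|UNIV :: 'r set| \<le>o |?W|"
    by (rule ordLeq_transitive[OF ordLeq_transitive[OF card_of_Plus1 card_of_Plus2] card_of_Plus2])
  ultimately show thesis by (intro that[of ?W] lt card_of_Plus1)
qed

text \<open>A finite subset of \<open>X\<close> is the set of letters of a word, and there are at
  most as many words over \<open>W\<close> as elements of \<open>W\<close>. These subsets will index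
  the imaginaries equivalent to a hyperimaginary.\<close>

lemma small_finite_subsets:
  assumes "small K (X :: 'a set)"
  shows "small K {F. finite F \<and> F \<subseteq> X}"
proof -
  obtain W :: "('a + 'f + 'r + nat) set" where W: "infinite W" "|W| <o |K|" "|X| \<le>o |W|"
    "|UNIV :: 'f set| \<le>o |W|" "|UNIV :: 'r set| \<le>o |W|" by (rule small_bound[OF assms])
  obtain g where g: "inj_on g X" "g ` X \<subseteq> W" 
    using W(3)[unfolded card_of_ordLeq[symmetric]] by blast
  have "{F. finite F \<and> F \<subseteq> X} \<subseteq> (\<lambda>xs. inv_into X g ` set xs) ` lists W"
  proof
    fix F assume F: "F \<in> {F. finite F \<and> F \<subseteq> X}"
    then obtain xs where xs: "set xs = F" using finite_list by blast
    then have "inv_into X g ` set (map g xs) = F"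
      using F g(1) by (simp add: inv_into_image_cancel)
    moreover have "map g xs \<in> lists W" using xs F g(2) by (auto simp: image_subset_iff subset_iff)
    ultimately show "F \<in> (\<lambda>xs. inv_into X g ` set xs) ` lists W" by (metis imageI)
  qed
  moreover have "small K (lists W)"
    unfolding small_def by (rule ordLeq_ordLess_trans[OF card_lists_ordLeq[OF W(1)] W(2)])
  ultimately show ?thesis using small_subset[OF small_image] by simp
qed

lemma ex_small_closed:
  assumes "X \<subseteq> carr M" "small K X"
  obtains A where "X \<subseteq> A" "closed M A" "small K A"
proof -
  obtain W :: "('a + 'f + 'r + nat) set" where W: "infinite W" "|W| <o |K|" "|X| \<le>o |W|"
    "|UNIV :: 'f set| \<le>o |W|" "|UNIV :: 'r set| \<le>o |W|" by (rule small_bound[OF assms(2)])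
  \<comment> \<open>The union of these iterates is closed: the finitely many parameters of an
    algebraic formula already lie in one \<open>C n\<close>, so its solutions lie in
    \<open>C (Suc n)\<close>.\<close>
  define C where "C n = (acl M ^^ n) X" for n
  have C_carr: "C n \<subseteq> carr M" for n
    by (induction n) (simp_all add: C_def assms(1) acl_subset)
  have mono: "C m \<subseteq> C n" if "m \<le> n" for m n
  proof (rule lift_Suc_mono_le[OF _ that])
    show "C n \<subseteq> C (Suc n)" for n using acl_increasing[OF C_carr[of n]] by (simp add: C_def)
  qed
  have "|C n| \<le>o |W|" for n
    by (induction n) (simp_all add: C_def W(3) card_acl_ordLeq[OF W(1) _ W(4,5)])
  moreover have "|UNIV :: nat set| \<le>o |W|" using W(1) by (simp add: infinite_iff_card_of_nat)
  ultimately have "|\<Union>n. C n| \<le>o |W|" by (intro card_of_UNION_ordLeq_infinite W(1)) simp_all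
  then have "small K (\<Union>n. C n)" unfolding small_def by (rule ordLeq_ordLess_trans[OF _ W(2)])
  moreover have "closed M (\<Union>n. C n)"
  proof (rule closedI)
    show "(\<Union>n. C n) \<subseteq> carr M" using C_carr by blast
    show "acl M (\<Union>n. C n) \<subseteq> (\<Union>n. C n)"
    proof
      fix x assume "x \<in> acl M (\<Union>n. C n)"
      then obtain \<phi> :: "('f,'r,'a) form" where \<phi>: "x \<in> carr M" "wf_fm M \<phi>" "params \<phi> \<subseteq> (\<Union>n. C n)"
        "finite {b \<in> carr M. sat M (\<lambda>_. b) \<phi>}" "sat M (\<lambda>_. x) \<phi>"
        unfolding acl_def by (elim CollectE conjE exE)
      have "\<exists>n. P \<subseteq> C n" if "finite P" "P \<subseteq> (\<Union>n. C n)" for P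
        using that
      proof (induction P)
        case (insert p P)
        then obtain m n where "P \<subseteq> C m" "p \<in> C n" by auto
        then show ?case using mono[of m "max m n"] mono[of n "max m n"] by (intro exI[of _ "max m n"]) auto
      qed simp
      then obtain n where "params \<phi> \<subseteq> C n" using \<phi>(3) finite_params[of \<phi>] by meson
      then have "x \<in> acl M (C n)"
        using \<phi>(1,2,4,5) unfolding acl_def by (intro CollectI conjI exI[of _ \<phi>])
      then have "x \<in> C (Suc n)" by (simp add: C_def)
      then show "x \<in> (\<Union>n. C n)" by blast
    qed
  qed
  moreover have "X \<subseteq> (\<Union>n. C n)" using UN_upper[of 0 UNIV C] by (simp add: C_def)
  ultimately show thesis by (intro that)
qed

end

section \<open>Parameter-free formulas and merging of variables\<close>

lemma params_eq_set4_trm: "part t = set3_trm t"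
  by (induction t) auto

lemma params_eq_set4_fm: "params \<phi> = set4_fm \<phi>"
  by (induction \<phi>) (auto simp: params_eq_set4_trm)

lemma map_fm_params_empty:
  assumes "params \<phi> = {}"
  shows "map_fm (\<lambda>x. x) (\<lambda>x. x) (\<lambda>x. x) \<sigma> \<phi> = \<phi>"
proof -
  have "map_fm (\<lambda>x. x) (\<lambda>x. x) (\<lambda>x. x) \<sigma> \<phi> = map_fm (\<lambda>x. x) (\<lambda>x. x) (\<lambda>x. x) (\<lambda>x. x) \<phi>"
    by (rule fm.map_cong) (use assms in \<open>simp_all add: params_eq_set4_fm\<close>)
  then show ?thesis by (simp add: fm.map_ident)
qed

lemma sat_aut_params_empty:
  assumes "struct M" "aut M \<sigma>" "wff M \<phi>" "params \<phi> = {}" "s ` fv \<phi> \<subseteq> carr M"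
  shows "sat M (\<sigma> \<circ> s) \<phi> \<longleftrightarrow> sat M s \<phi>"
  using sat_aut[OF assms(1-3) _ assms(5)] assms(4) by (simp add: map_fm_params_empty)

text \<open>Putting \<open>\<psi>\<close> under a quantifier over \<open>w\<close> together with
  \<open>w = v\<close> merges \<open>w\<close> into \<open>v\<close> without any substitution, hence
  without capture. The quantifier ranges over the universe, whence the condition on
  \<open>s v\<close>. The lemma serves \<open>dfn_ex\<close>, where several variables may denote the
  entry to be quantified.\<close>

lemma ex_identify:
  fixes \<phi> :: "('f,'r,'v,'a) fm" and M :: "('f,'r,'a) struc"
  assumes "finite V" "v \<notin> V"
  shows "\<exists>\<psi>. params \<psi> = params \<phi> \<and> (wff M \<psi> \<longleftrightarrow> wff M \<phi>) \<and>
    (\<forall>s. s v \<in> carr M \<longrightarrow> (sat M s \<psi> \<longleftrightarrow> sat M (\<lambda>w. if w \<in> V then s v else s w) \<phi>))"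
  using assms
proof (induction V)
  case empty
  show ?case by (rule exI[of _ \<phi>]) simp
next
  case (insert w V)
  then obtain \<psi> where \<psi>: "params \<psi> = params \<phi>" "wff M \<psi> \<longleftrightarrow> wff M \<phi>"
    "\<And>s. s v \<in> carr M \<Longrightarrow> sat M s \<psi> \<longleftrightarrow> sat M (\<lambda>w. if w \<in> V then s v else s w) \<phi>" by auto
  let ?\<psi> = "Ex w (Conj (Eq (Var w) (Var v)) \<psi>)"
  have "sat M s ?\<psi> \<longleftrightarrow> sat M (\<lambda>u. if u \<in> insert w V then s v else s u) \<phi>" if "s v \<in> carr M" for s
  proof -
    have "v \<noteq> w" using insert.prems by simp
    then have "sat M s ?\<psi> \<longleftrightarrow> sat M (s(w := s v)) \<psi>" using that by auto
    also have "\<dots> \<longleftrightarrow> sat M (\<lambda>u. if u \<in> V then s v else (s(w := s v)) u) \<phi>"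
    proof -
      have "(s(w := s v)) v = s v" using \<open>v \<noteq> w\<close> by simp
      then show ?thesis using \<psi>(3)[of "s(w := s v)"] that by (simp only:)
    qed
    also have "(\<lambda>u. if u \<in> V then s v else (s(w := s v)) u) = (\<lambda>u. if u \<in> insert w V then s v else s u)"
      by (rule ext) simp
    finally show ?thesis .
  qed
  then show ?case using \<psi>(1,2) by (intro exI[of _ ?\<psi>]) simp
qed

section \<open>Compactness\<close>

context monster_model
begin

text \<open>Here \<open>h\<close> stands for the tuple \<open>h x\<close>, \<open>x \<in> A\<close>, and \<open>s\<close> tells which entry of the
  tuple a variable denotes; different variables may denote the same entry.\<close>

definition dfn :: "'a set \<Rightarrow> 'a set \<Rightarrow> (('a \<Rightarrow> 'a) \<Rightarrow> bool) \<Rightarrow> bool" where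
  "dfn A B Q \<longleftrightarrow> (\<exists>s (\<phi> :: ('f,'r,'a) form). range s \<subseteq> A \<and> wff M \<phi> \<and> params \<phi> \<subseteq> B \<and>
     (\<forall>h. h ` A \<subseteq> carr M \<longrightarrow> (Q h \<longleftrightarrow> sat M (h \<circ> s) \<phi>)))"

lemma dfnI:
  assumes "range s \<subseteq> A" "wff M (\<phi> :: ('f,'r,'a) form)" "params \<phi> \<subseteq> B"
    and "\<And>h. h ` A \<subseteq> carr M \<Longrightarrow> Q h \<longleftrightarrow> sat M (h \<circ> s) \<phi>"
  shows "dfn A B Q"
  unfolding dfn_def using assms by (intro exI[of _ s] exI[of _ \<phi>] conjI allI impI)

lemma dfnE:
  assumes "dfn A B Q"
  obtains s and \<phi> :: "('f,'r,'a) form" where "range s \<subseteq> A" "wff M \<phi>" "params \<phi> \<subseteq> B"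
    "\<And>h. h ` A \<subseteq> carr M \<Longrightarrow> Q h \<longleftrightarrow> sat M (h \<circ> s) \<phi>"
  using assms unfolding dfn_def by (elim exE conjE) simp

lemma dfn_cong:
  assumes "dfn A B Q" "\<And>h. h ` A \<subseteq> carr M \<Longrightarrow> Q h \<longleftrightarrow> Q' h"
  shows "dfn A B Q'"
  using assms(1)
proof (rule dfnE)
  fix s and \<phi> :: "('f,'r,'a) form"
  assume "range s \<subseteq> A" "wff M \<phi>" "params \<phi> \<subseteq> B"
    "\<And>h. h ` A \<subseteq> carr M \<Longrightarrow> Q h \<longleftrightarrow> sat M (h \<circ> s) \<phi>"
  then show ?thesis using assms(2) by (intro dfnI[of s A \<phi>]) simp_all
qed

lemma dfn_not: "dfn A B Q \<Longrightarrow> dfn A B (\<lambda>h. \<not> Q h)"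
  by (erule dfnE, rule dfnI[where \<phi> = "Neg _"]) simp_all

lemma dfn_conj:
  assumes "dfn A B Q1" "dfn A B Q2"
  shows "dfn A B (\<lambda>h. Q1 h \<and> Q2 h)"
proof -
  obtain s1 and \<phi>1 :: "('f,'r,'a) form" where 1: "range s1 \<subseteq> A" "wff M \<phi>1" "params \<phi>1 \<subseteq> B"
    "\<And>h. h ` A \<subseteq> carr M \<Longrightarrow> Q1 h \<longleftrightarrow> sat M (h \<circ> s1) \<phi>1" by (rule dfnE[OF assms(1)]) blast
  obtain s2 and \<phi>2 :: "('f,'r,'a) form" where 2: "range s2 \<subseteq> A" "wff M \<phi>2" "params \<phi>2 \<subseteq> B"
    "\<And>h. h ` A \<subseteq> carr M \<Longrightarrow> Q2 h \<longleftrightarrow> sat M (h \<circ> s2) \<phi>2" by (rule dfnE[OF assms(2)]) blast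
  \<comment> \<open>The second components of the variables are sent to even numbers for one formula
    and to odd ones for the other. The variables become disjoint, and one \<open>s\<close> can carry
    both assignments.\<close>
  define s where "s = (\<lambda>(i, n). if even n then s1 (i, n div 2) else s2 (i, n div 2))"
  let ?f1 = "\<lambda>(i, n). (i, 2 * n) :: 'a \<times> nat" and ?f2 = "\<lambda>(i, n). (i, 2 * n + 1) :: 'a \<times> nat"
  let ?\<psi>1 = "map_fm (\<lambda>x. x) (\<lambda>x. x) ?f1 (\<lambda>x. x) \<phi>1"
  let ?\<psi>2 = "map_fm (\<lambda>x. x) (\<lambda>x. x) ?f2 (\<lambda>x. x) \<phi>2"
  have s1: "sat M (h \<circ> s) ?\<psi>1 \<longleftrightarrow> sat M (h \<circ> s1) \<phi>1" for h
    by (rule sat_rename) (auto simp: inj_on_def s_def)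
  have s2: "sat M (h \<circ> s) ?\<psi>2 \<longleftrightarrow> sat M (h \<circ> s2) \<phi>2" for h
    by (rule sat_rename) (auto simp: inj_on_def s_def)
  show ?thesis
  proof (rule dfnI)
    show "range s \<subseteq> A" using 1(1) 2(1) by (auto simp: s_def image_subset_iff)
    show "wff M (Conj ?\<psi>1 ?\<psi>2)" using 1(2) 2(2) by (simp add: wff_map_fm)
    show "params (Conj ?\<psi>1 ?\<psi>2) \<subseteq> B" using 1(3) 2(3) by (simp add: params_map_fm)
    show "Q1 h \<and> Q2 h \<longleftrightarrow> sat M (h \<circ> s) (Conj ?\<psi>1 ?\<psi>2)" if "h ` A \<subseteq> carr M" for h
      using 1(4)[OF that] 2(4)[OF that] s1 s2 by simp
  qed
qed

lemma dfn_Ball: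
  assumes "finite q" "\<And>Q. Q \<in> q \<Longrightarrow> dfn A B Q" "A \<noteq> {}"
  shows "dfn A B (\<lambda>h. \<forall>Q\<in>q. Q h)"
  using assms(1,2)
proof (induction q)
  case empty
  obtain a where "a \<in> A" using assms(3) by blast
  then show ?case by (intro dfnI[of "\<lambda>_. a" A "Neg FF"]) auto
next
  case (insert Q q)
  have "dfn A B (\<lambda>h. Q h \<and> (\<forall>Q\<in>q. Q h))" by (rule dfn_conj) (use insert in simp_all)
  then show ?case by (rule dfn_cong) simp
qed

definition supported :: "'a set \<Rightarrow> 'a set \<Rightarrow> (('a \<Rightarrow> 'a) \<Rightarrow> bool) \<Rightarrow> bool" where
  "supported A F Q \<longleftrightarrow> (\<forall>h h'. h ` A \<subseteq> carr M \<longrightarrow> h' ` A \<subseteq> carr M \<longrightarrow> (\<forall>x\<in>F. h x = h' x) \<longrightarrow> (Q h \<longleftrightarrow> Q h'))"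

lemma supportedD:
  assumes "supported A F Q" "h ` A \<subseteq> carr M" "h' ` A \<subseteq> carr M" "\<And>x. x \<in> F \<Longrightarrow> h x = h' x"
  shows "Q h \<longleftrightarrow> Q h'"
  using assms(1)[unfolded supported_def, rule_format, OF assms(2-4)] .

lemma dfn_support:
  assumes "dfn A B Q"
  obtains F where "finite F" "F \<subseteq> A" "supported A F Q"
proof -
  obtain s and \<phi> :: "('f,'r,'a) form" where s: "range s \<subseteq> A"
    "\<And>h. h ` A \<subseteq> carr M \<Longrightarrow> Q h \<longleftrightarrow> sat M (h \<circ> s) \<phi>" by (rule dfnE[OF assms]) blast
  show thesis
  proof (rule that)
    show "finite (s ` fv \<phi>)" by (simp add: finite_fv)
    show "s ` fv \<phi> \<subseteq> A" using s(1) by blast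
    show "supported A (s ` fv \<phi>) Q"
      unfolding supported_def
    proof (intro allI impI)
      fix h h' assume h: "h ` A \<subseteq> carr M" "h' ` A \<subseteq> carr M" "\<forall>x\<in>s ` fv \<phi>. h x = h' x"
      show "Q h \<longleftrightarrow> Q h'"
        unfolding s(2)[OF h(1)] s(2)[OF h(2)] by (rule sat_cong) (simp add: h(3))
    qed
  qed
qed

lemma dfn_ex:
  assumes "dfn A B Q" "y \<in> A"
  shows "dfn A B (\<lambda>h. \<exists>b\<in>carr M. Q (h(y := b)))"
proof -
  obtain s and \<phi> :: "('f,'r,'a) form" where s: "range s \<subseteq> A" "wff M \<phi>" "params \<phi> \<subseteq> B"
    "\<And>h. h ` A \<subseteq> carr M \<Longrightarrow> Q h \<longleftrightarrow> sat M (h \<circ> s) \<phi>" by (rule dfnE[OF assms(1)]) blast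
  have upd: "h(y := b) ` A \<subseteq> carr M" if "h ` A \<subseteq> carr M" "b \<in> carr M" for h b
    using that by (auto simp: image_subset_iff)
  show ?thesis
  proof (cases "\<exists>v\<in>fv \<phi>. s v = y")
    case False
    obtain b0 where "b0 \<in> carr M" using struct by (auto simp: struct_def)
    have "Q (h(y := b)) \<longleftrightarrow> Q h" if "h ` A \<subseteq> carr M" "b \<in> carr M" for h b
      unfolding s(4)[OF that(1)] s(4)[OF upd[OF that]]
      by (rule sat_cong) (use False in auto)
    then have "(\<exists>b\<in>carr M. Q (h(y := b))) \<longleftrightarrow> Q h" if "h ` A \<subseteq> carr M" for h
      using that \<open>b0 \<in> carr M\<close> by auto
    then show ?thesis using dfn_cong[OF assms(1)] by simp
  next
    case True
    then obtain v where v: "v \<in> fv \<phi>" "s v = y" by blast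
    \<comment> \<open>The other variables denoting \<open>y\<close> are merged into
      \<open>v\<close>; quantifying over \<open>v\<close> then changes the whole entry
      \<open>y\<close>.\<close>
    let ?V = "{w \<in> fv \<phi>. s w = y} - {v}"
    obtain \<psi> where \<psi>: "params \<psi> = params \<phi>" "wff M \<psi> \<longleftrightarrow> wff M \<phi>"
      "\<And>s. s v \<in> carr M \<Longrightarrow> sat M s \<psi> \<longleftrightarrow> sat M (\<lambda>w. if w \<in> ?V then s v else s w) \<phi>"
      using ex_identify[of ?V v \<phi> M] finite_fv[of \<phi>] by auto
    show ?thesis
    proof (rule dfnI)
      show "range s \<subseteq> A" "wff M (Ex v \<psi>)" "params (Ex v \<psi>) \<subseteq> B" using s \<psi> by simp_all
      fix h assume h: "h ` A \<subseteq> carr M"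
      have "sat M ((h \<circ> s)(v := b)) \<psi> \<longleftrightarrow> Q (h(y := b))" if "b \<in> carr M" for b
      proof -
        have "sat M ((h \<circ> s)(v := b)) \<psi> \<longleftrightarrow>
            sat M (\<lambda>w. if w \<in> ?V then b else ((h \<circ> s)(v := b)) w) \<phi>"
          using \<psi>(3)[of "(h \<circ> s)(v := b)", unfolded fun_upd_same] that by simp
        also have "\<dots> \<longleftrightarrow> sat M (h(y := b) \<circ> s) \<phi>"
          by (rule sat_cong) (use v in auto)
        finally show ?thesis using s(4)[OF upd[OF h that]] by simp
      qed
      then show "(\<exists>b\<in>carr M. Q (h(y := b))) \<longleftrightarrow> sat M (h \<circ> s) (Ex v \<psi>)" by simp
    qed
  qed
qed

lemma dfn_ex_finite:
  assumes "finite Y" "Y \<subseteq> A" "dfn A B Q"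
  shows "dfn A B (\<lambda>h. \<exists>k. k ` Y \<subseteq> carr M \<and> Q (\<lambda>z. if z \<in> Y then k z else h z))"
  using assms(1,2)
proof (induction Y)
  case empty
  show ?case using assms(3) by simp
next
  case (insert y Y)
  have "dfn A B (\<lambda>h. \<exists>b\<in>carr M. \<exists>k. k ` Y \<subseteq> carr M \<and> Q (\<lambda>z. if z \<in> Y then k z else (h(y := b)) z))"
    by (rule dfn_ex) (use insert in simp_all)
  then show ?case
  proof (rule dfn_cong, intro iffI)
    fix h assume "\<exists>b\<in>carr M. \<exists>k. k ` Y \<subseteq> carr M \<and> Q (\<lambda>z. if z \<in> Y then k z else (h(y := b)) z)"
    then obtain b k where k: "b \<in> carr M" "k ` Y \<subseteq> carr M"
      "Q (\<lambda>z. if z \<in> Y then k z else (h(y := b)) z)" by blast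
    have "(\<lambda>z. if z \<in> insert y Y then (k(y := b)) z else h z) = (\<lambda>z. if z \<in> Y then k z else (h(y := b)) z)"
      using insert.hyps(2) by (intro ext) auto
    then show "\<exists>k. k ` insert y Y \<subseteq> carr M \<and> Q (\<lambda>z. if z \<in> insert y Y then k z else h z)"
      using k by (intro exI[of _ "k(y := b)"]) (simp add: image_subset_iff)
  next
    fix h assume "\<exists>k. k ` insert y Y \<subseteq> carr M \<and> Q (\<lambda>z. if z \<in> insert y Y then k z else h z)"
    then obtain k where k: "k ` insert y Y \<subseteq> carr M" "Q (\<lambda>z. if z \<in> insert y Y then k z else h z)"
      by blast
    have "(\<lambda>z. if z \<in> insert y Y then k z else h z) = (\<lambda>z. if z \<in> Y then k z else (h(y := k y)) z)"
      by (rule ext) auto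
    then show "\<exists>b\<in>carr M. \<exists>k. k ` Y \<subseteq> carr M \<and> Q (\<lambda>z. if z \<in> Y then k z else (h(y := b)) z)"
      using k by (intro bexI[of _ "k y"] exI[of _ k]) simp_all
  qed
qed

text \<open>\<open>saturated\<close> evaluates formulas at constant assignments. Entries in
  \<open>D\<close> are turned into parameters here, and all remaining variables carry the single
  unknown \<open>b\<close>.\<close>

lemma dfn_point:
  assumes "dfn A B Q" "D \<subseteq> A" "g ` D \<subseteq> carr M"
  obtains \<phi> :: "('f,'r,'a) form" where "wff M \<phi>" "params \<phi> \<subseteq> B \<union> g ` D"
    "\<And>b. b \<in> carr M \<Longrightarrow> sat M (\<lambda>_. b) \<phi> \<longleftrightarrow> Q (\<lambda>z. if z \<in> D then g z else b)"
proof -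
  obtain s and \<phi> :: "('f,'r,'a) form" where s: "range s \<subseteq> A" "wff M \<phi>" "params \<phi> \<subseteq> B"
    "\<And>h. h ` A \<subseteq> carr M \<Longrightarrow> Q h \<longleftrightarrow> sat M (h \<circ> s) \<phi>" by (rule dfnE[OF assms(1)]) blast
  let ?\<theta> = "\<lambda>v. if s v \<in> D then Some (g (s v)) else None"
  show thesis
  proof (rule that)
    show "wff M (inst ?\<theta> \<phi>)" using s(2) by (simp add: wff_inst)
    have "ran ?\<theta> \<subseteq> g ` D" by (auto simp: ran_def)
    then show "params (inst ?\<theta> \<phi>) \<subseteq> B \<union> g ` D" using params_inst[of ?\<theta> \<phi>] s(3) by blast
    fix b assume "b \<in> carr M"
    then have "Q (\<lambda>z. if z \<in> D then g z else b) \<longleftrightarrow> sat M ((\<lambda>z. if z \<in> D then g z else b) \<circ> s) \<phi>"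
      using assms(3) by (intro s(4)) (auto simp: image_subset_iff)
    also have "(\<lambda>z. if z \<in> D then g z else b) \<circ> s = (\<lambda>v. case ?\<theta> v of None \<Rightarrow> b | Some c \<Rightarrow> c)"
      by (rule ext) simp
    finally show "sat M (\<lambda>_. b) (inst ?\<theta> \<phi>) \<longleftrightarrow> Q (\<lambda>z. if z \<in> D then g z else b)"
      by (simp only: sat_inst)
  qed
qed

text \<open>Of the finitely many entries that \<open>Q\<close> depends on, those in \<open>D\<close>
  become parameters and those outside \<open>insert x D\<close> are quantified away, so that only
  the entry at \<open>x\<close> is left.\<close>

lemma dfn_one_point_extension:
  assumes Q: "dfn A B Q" and "D \<subseteq> A" "g ` D \<subseteq> carr M" "x \<in> A" "x \<notin> D"
  shows "\<exists>\<phi> :: ('f,'r,'a) form. wff M \<phi> \<and> params \<phi> \<subseteq> B \<union> g ` D \<and>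
    (\<forall>b\<in>carr M. sat M (\<lambda>_. b) \<phi> \<longleftrightarrow>
      (\<exists>h. h ` A \<subseteq> carr M \<and> (\<forall>z\<in>D. h z = g z) \<and> h x = b \<and> Q h))"
proof -
  obtain F where F: "finite F" "F \<subseteq> A" "supported A F Q" by (rule dfn_support[OF Q])
  let ?Y = "F - insert x D"
  let ?Q = "\<lambda>h. \<exists>k. k ` ?Y \<subseteq> carr M \<and> Q (\<lambda>z. if z \<in> ?Y then k z else h z)"
  have "dfn A B ?Q" by (rule dfn_ex_finite[OF _ _ Q]) (use F in auto)
  then obtain \<phi> :: "('f,'r,'a) form" where \<phi>: "wff M \<phi>" "params \<phi> \<subseteq> B \<union> g ` D"
    "\<And>b. b \<in> carr M \<Longrightarrow> sat M (\<lambda>_. b) \<phi> \<longleftrightarrow> ?Q (\<lambda>z. if z \<in> D then g z else b)"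
    by (rule dfn_point[OF _ assms(2,3)]) blast
  have "?Q (\<lambda>z. if z \<in> D then g z else b) \<longleftrightarrow>
      (\<exists>h. h ` A \<subseteq> carr M \<and> (\<forall>z\<in>D. h z = g z) \<and> h x = b \<and> Q h)" (is "_ \<longleftrightarrow> ?R")
    if b: "b \<in> carr M" for b
  proof
    assume "?Q (\<lambda>z. if z \<in> D then g z else b)"
    then obtain k where k: "k ` ?Y \<subseteq> carr M" "Q (\<lambda>z. if z \<in> ?Y then k z else if z \<in> D then g z else b)"
      by blast
    then show ?R using assms(3,5) b
      by (intro exI[of _ "\<lambda>z. if z \<in> ?Y then k z else if z \<in> D then g z else b"])
        (auto simp: image_subset_iff)
  next
    assume ?R
    then obtain h where h: "h ` A \<subseteq> carr M" "\<And>z. z \<in> D \<Longrightarrow> h z = g z" "h x = b" "Q h" by blast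
    let ?h = "\<lambda>z. if z \<in> ?Y then h z else if z \<in> D then g z else b"
    have "Q h \<longleftrightarrow> Q ?h"
      by (rule supportedD[OF F(3)]) (use h F(2) assms(3) b in \<open>auto simp: image_subset_iff\<close>)
    then show "?Q (\<lambda>z. if z \<in> D then g z else b)"
      using h(1,4) F(2) by (intro exI[of _ h]) (auto simp: image_subset_iff)
  qed
  then show ?thesis using \<phi> by (intro exI[of _ \<phi>] conjI ballI) simp_all
qed

section \<open>Realising types of small tuples\<close>

text \<open>\<open>R\<close> is the graph of a partial map: the case \<open>q = {}\<close> makes it single-valued.\<close>

definition partial_solution :: "'a set \<Rightarrow> (('a \<Rightarrow> 'a) \<Rightarrow> bool) set \<Rightarrow> ('a \<times> 'a) set \<Rightarrow> bool" where
  "partial_solution A P R \<longleftrightarrow> R \<subseteq> A \<times> carr M \<and> (\<forall>q. finite q \<and> q \<subseteq> P \<longrightarrow>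
     (\<exists>h. h ` A \<subseteq> carr M \<and> (\<forall>p\<in>R. h (fst p) = snd p) \<and> (\<forall>Q\<in>q. Q h)))"

lemma partial_solutionD:
  assumes "partial_solution A P R" "finite q" "q \<subseteq> P"
  obtains h where "h ` A \<subseteq> carr M" "\<forall>p\<in>R. h (fst p) = snd p" "\<forall>Q\<in>q. Q h"
proof -
  obtain h where "h ` A \<subseteq> carr M" "\<forall>p\<in>R. h (fst p) = snd p" "\<forall>Q\<in>q. Q h"
    using mp[OF spec[OF conjunct2[OF assms(1)[unfolded partial_solution_def]]] conjI[OF assms(2,3)]]
    by (elim exE conjE)
  then show thesis by (rule that)
qed

lemma partial_solution_function:
  assumes "partial_solution A P R"
  obtains h where "h ` A \<subseteq> carr M" "\<forall>p\<in>R. h (fst p) = snd p"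
proof -
  have "\<exists>h. h ` A \<subseteq> carr M \<and> (\<forall>p\<in>R. h (fst p) = snd p) \<and> (\<forall>Q\<in>{}. Q h)"
    by (intro mp[OF spec[OF conjunct2[OF assms[unfolded partial_solution_def]]]]) simp
  then obtain h where "h ` A \<subseteq> carr M" "\<forall>p\<in>R. h (fst p) = snd p" by (elim exE conjE)
  then show thesis by (rule that)
qed

lemma partial_solution_chain:
  assumes "subset.chain {R. partial_solution A P R} C" "C \<noteq> {}"
    and P: "\<And>Q. Q \<in> P \<Longrightarrow> dfn A B Q" and "A \<noteq> {}"
  shows "partial_solution A P (\<Union>C)"
  unfolding partial_solution_def
proof (intro conjI allI impI)
  have C: "partial_solution A P R" if "R \<in> C" for R
    using assms(1) that by (auto simp: subset.chain_def)
  show "\<Union>C \<subseteq> A \<times> carr M" by (rule Union_least) (use C in \<open>simp add: partial_solution_def\<close>)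
  have single: "snd p = snd p'" if "p \<in> \<Union>C" "p' \<in> \<Union>C" "fst p = fst p'" for p p'
  proof -
    have "finite {p, p'}" "{p, p'} \<subseteq> \<Union>C" using that by simp_all
    then obtain R where R: "R \<in> C" "{p, p'} \<subseteq> R"
      by (rule finite_subset_Union_chain[OF _ _ assms(2,1)])
    obtain h where "\<forall>p\<in>R. h (fst p) = snd p"
      by (rule partial_solution_function[OF C[OF R(1)]])
    then have "h (fst p) = snd p" "h (fst p') = snd p'" using R(2) by simp_all
    then show ?thesis using that(3) by simp
  qed
  fix q assume q: "finite q \<and> q \<subseteq> P"
  have "dfn A B (\<lambda>h. \<forall>Q\<in>q. Q h)"
    by (rule dfn_Ball[OF conjunct1[OF q] P[OF subsetD[OF conjunct2[OF q]]] assms(4)])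
  then obtain F where F: "finite F" "F \<subseteq> A" "supported A F (\<lambda>h. \<forall>Q\<in>q. Q h)" by (rule dfn_support)
  \<comment> \<open>The solvability of \<open>q\<close> depends only on entries in the finite set
    \<open>F\<close>; the finitely many pairs over \<open>F\<close> all lie in one member of the
    chain.\<close>
  let ?R0 = "{p \<in> \<Union>C. fst p \<in> F}"
  have "inj_on fst ?R0"
  proof (rule inj_onI)
    show "p = p'" if "p \<in> ?R0" "p' \<in> ?R0" "fst p = fst p'" for p p'
      using single[of p p'] that by (simp add: prod_eq_iff)
  qed
  then have "finite ?R0" 
    by (rule finite_imageD[rotated]) (rule finite_subset[OF _ F(1)], blast)
  moreover have "?R0 \<subseteq> \<Union>C" by blast
  ultimately obtain R where R: "R \<in> C" "?R0 \<subseteq> R"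
    by (rule finite_subset_Union_chain[OF _ _ assms(2,1)])
  obtain h where h: "h ` A \<subseteq> carr M" "\<forall>p\<in>R. h (fst p) = snd p" "\<forall>Q\<in>q. Q h"
    by (rule partial_solutionD[OF C[OF R(1)] conjunct1[OF q] conjunct2[OF q]])
  \<comment> \<open>The solution \<open>h\<close> respects only the pairs of \<open>R\<close>. The
    modification \<open>h'\<close> respects all pairs of \<open>\<Union>C\<close> and still agrees
    with \<open>h\<close> on \<open>F\<close>.\<close>
  define h' where "h' z = (if z \<in> fst ` \<Union>C then THE y. (z, y) \<in> \<Union>C else h z)" for z
  have h'_C: "h' (fst p) = snd p" if "p \<in> \<Union>C" for p
  proof -
    have "(THE y. (fst p, y) \<in> \<Union>C) = snd p"
    proof (rule the_equality)
      show "(fst p, snd p) \<in> \<Union>C" using that by simp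
      show "y = snd p" if "(fst p, y) \<in> \<Union>C" for y using single[OF that \<open>p \<in> \<Union>C\<close>] by simp
    qed
    then show ?thesis using that by (simp add: h'_def)
  qed
  have "h' ` A \<subseteq> carr M"
  proof (rule image_subsetI)
    fix z assume "z \<in> A"
    show "h' z \<in> carr M"
    proof (cases "z \<in> fst ` \<Union>C")
      case True
      then obtain p where "p \<in> \<Union>C" "z = fst p" by blast
      then show ?thesis using h'_C[of p] \<open>\<Union>C \<subseteq> A \<times> carr M\<close> by auto
    next
      case False
      then show ?thesis using h(1) \<open>z \<in> A\<close> by (auto simp: h'_def)
    qed
  qed
  moreover have "h z = h' z" if "z \<in> F" for z
  proof (cases "z \<in> fst ` \<Union>C")
    case True
    then obtain p where "p \<in> \<Union>C" "z = fst p" by blast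
    then have "p \<in> R" using R(2) \<open>z \<in> F\<close> by blast
    then show ?thesis using h'_C[OF \<open>p \<in> \<Union>C\<close>] bspec[OF h(2) \<open>p \<in> R\<close>] \<open>z = fst p\<close> by simp
  qed (simp add: h'_def)
  ultimately have "(\<forall>Q\<in>q. Q h) \<longleftrightarrow> (\<forall>Q\<in>q. Q h')" by (intro supportedD[OF F(3)] h(1))
  then have "\<forall>Q\<in>q. Q h'" using h(3) by (rule iffD1)
  then show "\<exists>h. h ` A \<subseteq> carr M \<and> (\<forall>p\<in>\<Union>C. h (fst p) = snd p) \<and> (\<forall>Q\<in>q. Q h)"
    using \<open>h' ` A \<subseteq> carr M\<close> h'_C by (intro exI[of _ h']) simp
qed

text \<open>The value \<open>b\<close> has to realise the type saying, for every finite
  \<open>q\<close>, that \<open>q\<close> has a solution extending \<open>R\<close> with value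
  \<open>b\<close> at \<open>x\<close>. Its parameters are in \<open>B\<close> or are values of
  \<open>R\<close>, hence form a small set.\<close>

lemma partial_solution_extend:
  assumes R: "partial_solution A P R" and P: "\<And>Q. Q \<in> P \<Longrightarrow> dfn A B Q"
    and A: "A \<subseteq> carr M" "small K A" "x \<in> A" "x \<notin> fst ` R" and B: "B \<subseteq> carr M" "small K B"
  obtains b where "partial_solution A P (insert (x, b) R)"
proof -
  let ?D = "fst ` R"
  obtain g where g: "g ` A \<subseteq> carr M" "\<forall>p\<in>R. g (fst p) = snd p"
    by (rule partial_solution_function[OF R])
  have D: "?D \<subseteq> A" using R by (auto simp: partial_solution_def)
  then have gD: "g ` ?D \<subseteq> carr M" using g(1) by blast
  have eqR: "(\<forall>p\<in>R. h (fst p) = snd p) \<longleftrightarrow> (\<forall>z\<in>?D. h z = g z)" for h using g(2) by simp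
  let ?E = "\<lambda>q b. \<exists>h. h ` A \<subseteq> carr M \<and> (\<forall>z\<in>?D. h z = g z) \<and> h x = b \<and> (\<forall>Q\<in>q. Q h)"
  have "\<exists>\<phi> :: ('f,'r,'a) form. wff M \<phi> \<and> params \<phi> \<subseteq> B \<union> g ` ?D \<and>
      (\<forall>b\<in>carr M. sat M (\<lambda>_. b) \<phi> \<longleftrightarrow> ?E q b)" if q: "finite q" "q \<subseteq> P" for q
  proof -
    have "dfn A B (\<lambda>h. \<forall>Q\<in>q. Q h)"
      by (rule dfn_Ball[OF q(1) P[OF subsetD[OF q(2)]]]) (use A(3) in auto)
    then show ?thesis by (rule dfn_one_point_extension[OF _ D gD A(3,4)])
  qed
  then have "\<forall>q\<in>{q. finite q \<and> q \<subseteq> P}. \<exists>\<phi> :: ('f,'r,'a) form. wff M \<phi> \<and>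
      params \<phi> \<subseteq> B \<union> g ` ?D \<and> (\<forall>b\<in>carr M. sat M (\<lambda>_. b) \<phi> \<longleftrightarrow> ?E q b)" by simp
  from bchoice[OF this] obtain \<Phi> :: "(('a \<Rightarrow> 'a) \<Rightarrow> bool) set \<Rightarrow> ('f,'r,'a) form" where
    \<Phi>: "\<forall>q\<in>{q. finite q \<and> q \<subseteq> P}. wff M (\<Phi> q) \<and> params (\<Phi> q) \<subseteq> B \<union> g ` ?D \<and>
      (\<forall>b\<in>carr M. sat M (\<lambda>_. b) (\<Phi> q) \<longleftrightarrow> ?E q b)" by (rule exE)
  have \<Phi>_sat: "sat M (\<lambda>_. b) (\<Phi> q) \<longleftrightarrow> ?E q b" if "finite q" "q \<subseteq> P" "b \<in> carr M" for q b
    using bspec[OF conjunct2[OF conjunct2[OF bspec[OF \<Phi>]]] that(3), of q] that(1,2) by simp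
  let ?p = "\<Phi> ` {q. finite q \<and> q \<subseteq> P}"
  have "\<exists>b\<in>carr M. \<forall>\<phi>\<in>?p. sat M (\<lambda>_. b) \<phi>"
  proof (rule mp[OF spec[OF spec[OF monster[unfolded monster_def saturated_def, THEN conjunct2, THEN conjunct2,
          THEN conjunct2, THEN conjunct2, THEN conjunct1]]], of "B \<union> g ` ?D"], intro conjI ballI allI impI)
    show "B \<union> g ` ?D \<subseteq> carr M" using B(1) gD by blast
    show "small K (B \<union> g ` ?D)" using small_Un[OF B(2) small_image[OF small_subset[OF A(2) D]]] .
    fix \<phi> assume "\<phi> \<in> ?p"
    then obtain q where q: "\<phi> = \<Phi> q" "finite q" "q \<subseteq> P" by blast
    then have "q \<in> {q. finite q \<and> q \<subseteq> P}" by simp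
    note \<Phi>q = bspec[OF \<Phi> this]
    show params: "params \<phi> \<subseteq> B \<union> g ` ?D" unfolding q(1) by (rule conjunct1[OF conjunct2[OF \<Phi>q]])
    have "params \<phi> \<subseteq> carr M" by (rule subset_trans[OF params]) (use B(1) gD in simp)
    then show "wf_fm M \<phi>" using conjunct1[OF \<Phi>q] q(1) by (simp add: wf_fm_def)
  next
    fix r assume r: "finite r \<and> r \<subseteq> ?p"
    then obtain T where T: "T \<subseteq> {q. finite q \<and> q \<subseteq> P}" "finite T" "r = \<Phi> ` T"
      using finite_subset_image[of r \<Phi> "{q. finite q \<and> q \<subseteq> P}"] by blast
    \<comment> \<open>One solution of the finite set \<open>\<Union>T\<close> gives a value at
      \<open>x\<close> that satisfies the formulas of all \<open>q\<close> in \<open>T\<close> at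
      once.\<close>
    obtain h where h: "h ` A \<subseteq> carr M" "\<forall>p\<in>R. h (fst p) = snd p" "\<forall>Q\<in>\<Union>T. Q h"
    proof (rule partial_solutionD[OF R])
      show "finite (\<Union>T)" "\<Union>T \<subseteq> P" using T by auto
    qed
    have "h x \<in> carr M" using h(1) A(3) by blast
    moreover have "sat M (\<lambda>_. h x) (\<Phi> q)" if "q \<in> T" for q
    proof -
      have "\<forall>Q\<in>q. Q h" using h(3) that by blast
      then have "?E q (h x)" using h(1) iffD1[OF eqR h(2)] by (intro exI[of _ h] conjI refl)
      then show ?thesis using T(1) that by (intro iffD2[OF \<Phi>_sat[OF _ _ \<open>h x \<in> carr M\<close>]]) auto
    qed
    ultimately show "\<exists>b\<in>carr M. \<forall>\<phi>\<in>r. sat M (\<lambda>_. b) \<phi>" using T(3) by blast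
  qed
  then obtain b where b: "b \<in> carr M" "\<forall>\<phi>\<in>?p. sat M (\<lambda>_. b) \<phi>" by (rule bexE)
  have "partial_solution A P (insert (x, b) R)"
    unfolding partial_solution_def
  proof (intro conjI allI impI)
    show "insert (x, b) R \<subseteq> A \<times> carr M" using R A(3) b(1) by (simp add: partial_solution_def)
    fix q assume q: "finite q \<and> q \<subseteq> P"
    then have "\<Phi> q \<in> ?p" by simp
    then have "?E q b" using iffD1[OF \<Phi>_sat[OF conjunct1[OF q] conjunct2[OF q] b(1)]] bspec[OF b(2)] by simp
    then obtain h where "h ` A \<subseteq> carr M" "\<forall>z\<in>?D. h z = g z" "h x = b" "\<forall>Q\<in>q. Q h" by (elim exE conjE)
    then show "\<exists>h. h ` A \<subseteq> carr M \<and> (\<forall>p\<in>insert (x, b) R. h (fst p) = snd p) \<and> (\<forall>Q\<in>q. Q h)"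
      using eqR[of h] by (intro exI[of _ h] conjI ballI) auto
  qed
  then show thesis by (rule that)
qed

text \<open>Zorn's lemma fills in the entries one after another. A maximal partial solution is
  defined on all of \<open>A\<close>, and then each single condition holds because its solution has
  no freedom left.\<close>

lemma realize:
  assumes A: "A \<subseteq> carr M" "small K A" "A \<noteq> {}" and B: "B \<subseteq> carr M" "small K B"
    and P: "\<And>Q. Q \<in> P \<Longrightarrow> dfn A B Q"
    and fin: "\<And>q. finite q \<Longrightarrow> q \<subseteq> P \<Longrightarrow> \<exists>h. h ` A \<subseteq> carr M \<and> (\<forall>Q\<in>q. Q h)"
  obtains h where "h ` A \<subseteq> carr M" "\<forall>Q\<in>P. Q h"
proof -
  have "\<Union>C \<in> {R. partial_solution A P R}" if "subset.chain {R. partial_solution A P R} C" for C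
  proof (cases "C = {}")
    case True
    then show ?thesis using fin by (simp add: partial_solution_def)
  next
    case False
    then show ?thesis using partial_solution_chain[OF that False P A(3)] by simp
  qed
  from subset_Zorn'[OF this] obtain R where R: "partial_solution A P R"
    "\<And>R'. partial_solution A P R' \<Longrightarrow> R \<subseteq> R' \<Longrightarrow> R' = R" by blast
  have dom: "A \<subseteq> fst ` R"
  proof
    fix x assume "x \<in> A"
    show "x \<in> fst ` R"
    proof (rule ccontr)
      assume "x \<notin> fst ` R"
      obtain b where "partial_solution A P (insert (x, b) R)"
        by (rule partial_solution_extend[OF R(1) P A(1,2) \<open>x \<in> A\<close> \<open>x \<notin> fst ` R\<close> B])
      then have "insert (x, b) R = R" by (rule R(2)) blast
      then show False using \<open>x \<notin> fst ` R\<close> by (metis fst_conv image_eqI insertI1)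
    qed
  qed
  obtain g where g: "g ` A \<subseteq> carr M" "\<forall>p\<in>R. g (fst p) = snd p"
    by (rule partial_solution_function[OF R(1)])
  have "\<forall>Q\<in>P. Q g"
  proof
    fix Q assume Q: "Q \<in> P"
    have "finite {Q}" "{Q} \<subseteq> P" using Q by simp_all
    then obtain h where h: "h ` A \<subseteq> carr M" "\<forall>p\<in>R. h (fst p) = snd p" "\<forall>Q\<in>{Q}. Q h"
      by (rule partial_solutionD[OF R(1)])
    obtain F where F: "F \<subseteq> A" "supported A F Q" by (rule dfn_support[OF P[OF Q]])
    have "h x = g x" if x: "x \<in> F" for x
    proof -
      obtain p where "p \<in> R" "x = fst p" using dom F(1) x by blast
      then show ?thesis using bspec[OF g(2)] bspec[OF h(2)] by simp
    qed
    then have "Q h \<longleftrightarrow> Q g" by (rule supportedD[OF F(2) h(1) g(1)])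
    then show "Q g" using bspec[OF h(3) singletonI] by (rule iffD1)
  qed
  with g(1) show thesis by (rule that)
qed

section \<open>From realisations to automorphisms\<close>

lemma homogeneous:
  assumes "A \<subseteq> carr M" "small K A" "g ` A \<subseteq> carr M"
    and "\<And>s (\<phi> :: ('f,'r,'a) form). wff M \<phi> \<Longrightarrow> params \<phi> = {} \<Longrightarrow> range s \<subseteq> A \<Longrightarrow>
      sat M s \<phi> \<longleftrightarrow> sat M (g \<circ> s) \<phi>"
  obtains \<sigma> where "aut M \<sigma>" "\<forall>x\<in>A. \<sigma> x = g x"
proof -
  have "\<exists>\<sigma>. aut M \<sigma> \<and> (\<forall>x\<in>A. \<sigma> x = g x)"
    by (rule mp[OF spec[OF spec[OF monster[unfolded monster_def strongly_homogeneous_def, THEN conjunct2,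
          THEN conjunct2, THEN conjunct2, THEN conjunct2, THEN conjunct2]]]])
      (use assms in \<open>simp add: wf_fm_def\<close>)
  then obtain \<sigma> where "aut M \<sigma>" "\<forall>x\<in>A. \<sigma> x = g x" by (elim exE conjE)
  then show thesis by (rule that)
qed

text \<open>A realisation that in addition preserves the truth of parameter-free formulas on
  \<open>A\<close> extends to an automorphism by strong homogeneity. The conditions in
  \<open>P\<close> see only entries in \<open>A\<close>, so they pass to that automorphism.\<close>

lemma compactness:
  assumes A: "A \<subseteq> carr M" "small K A" "A \<noteq> {}" and B: "B \<subseteq> carr M" "small K B"
    and P: "\<And>Q. Q \<in> P \<Longrightarrow> dfn A B Q"
    and fin: "\<And>q. finite q \<Longrightarrow> q \<subseteq> P \<Longrightarrow> \<exists>\<sigma>. aut M \<sigma> \<and> (\<forall>Q\<in>q. Q \<sigma>)"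
  obtains \<sigma> where "aut M \<sigma>" "\<forall>Q\<in>P. Q \<sigma>"
proof -
  \<comment> \<open>These conditions say that \<open>h\<close> is elementary on \<open>A\<close>.
    Every automorphism satisfies them, so finite satisfiability has to be supplied only for
    \<open>P\<close>.\<close>
  let ?T = "{(\<lambda>h. sat M s \<phi> \<longleftrightarrow> sat M (h \<circ> s) \<phi>) | s (\<phi> :: ('f,'r,'a) form).
    wff M \<phi> \<and> params \<phi> = {} \<and> range s \<subseteq> A}"
  have T_dfn: "dfn A B Q" if Q: "Q \<in> ?T" for Q
  proof -
    from Q obtain s and \<phi> :: "('f,'r,'a) form" where *: "Q = (\<lambda>h. sat M s \<phi> \<longleftrightarrow> sat M (h \<circ> s) \<phi>)"
      "wff M \<phi>" "params \<phi> = {}" "range s \<subseteq> A" by blast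
    have "dfn A B (\<lambda>h. sat M (h \<circ> s) \<phi>)" by (rule dfnI[of s A \<phi>]) (use * in simp_all)
    then show ?thesis unfolding *(1) using dfn_not by (cases "sat M s \<phi>") simp_all
  qed
  have T_aut: "Q \<sigma>" if Q: "Q \<in> ?T" and "aut M \<sigma>" for Q \<sigma>
  proof -
    from Q obtain s and \<phi> :: "('f,'r,'a) form" where *: "Q = (\<lambda>h. sat M s \<phi> \<longleftrightarrow> sat M (h \<circ> s) \<phi>)"
      "wff M \<phi>" "params \<phi> = {}" "range s \<subseteq> A" by blast
    then show ?thesis using sat_aut_params_empty[OF struct \<open>aut M \<sigma>\<close> *(2,3), of s] A(1) by auto
  qed
  obtain g where g: "g ` A \<subseteq> carr M" "\<forall>Q\<in>P \<union> ?T. Q g"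
  proof (rule realize[OF A B])
    show "dfn A B Q" if "Q \<in> P \<union> ?T" for Q using that by (rule UnE) (rule P T_dfn, assumption)+
    fix q assume q: "finite q" "q \<subseteq> P \<union> ?T"
    obtain \<sigma> where \<sigma>: "aut M \<sigma>" "\<forall>Q\<in>q \<inter> P. Q \<sigma>" using fin[of "q \<inter> P"] q(1) by auto
    have "Q \<sigma>" if "Q \<in> q" for Q
    proof (cases "Q \<in> P")
      case True
      then show ?thesis using bspec[OF \<sigma>(2) IntI[OF that]] by simp
    next
      case False
      then have "Q \<in> ?T" using subsetD[OF q(2) that] by (simp only: Un_iff simp_thms)
      then show ?thesis by (rule T_aut[OF _ \<sigma>(1)])
    qed
    moreover have "\<sigma> ` A \<subseteq> carr M" using autD(2)[OF \<sigma>(1)] A(1) by blast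
    ultimately show "\<exists>h. h ` A \<subseteq> carr M \<and> (\<forall>Q\<in>q. Q h)" by (intro exI[of _ \<sigma>] conjI ballI)
  next
    fix h assume "h ` A \<subseteq> carr M" "\<forall>Q\<in>P \<union> ?T. Q h"
    then show thesis by (rule that)
  qed
  obtain \<sigma> where \<sigma>: "aut M \<sigma>" "\<forall>x\<in>A. \<sigma> x = g x"
  proof (rule homogeneous[OF A(1,2) g(1)])
    fix s :: "'a \<times> nat \<Rightarrow> 'a" and \<phi> :: "('f,'r,'a) form"
    assume "wff M \<phi>" "params \<phi> = {}" "range s \<subseteq> A"
    then have "(\<lambda>h. sat M s \<phi> \<longleftrightarrow> sat M (h \<circ> s) \<phi>) \<in> P \<union> ?T" by blast
    then show "sat M s \<phi> \<longleftrightarrow> sat M (g \<circ> s) \<phi>" by (rule bspec[OF g(2)])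
  qed
  have "\<forall>Q\<in>P. Q \<sigma>"
  proof
    fix Q assume Q: "Q \<in> P"
    obtain F where F: "F \<subseteq> A" "supported A F Q" by (rule dfn_support[OF P[OF Q]])
    have "\<sigma> ` A \<subseteq> carr M" using autD(2)[OF \<sigma>(1)] A(1) by blast
    then have "Q \<sigma> \<longleftrightarrow> Q g" by (rule supportedD[OF F(2)]) (use g(1) \<sigma>(2) F(1) in auto)
    then show "Q \<sigma>" using bspec[OF g(2) UnI1[OF Q]] by (rule iffD2)
  qed
  with \<sigma>(1) show thesis by (rule that)
qed

text \<open>If \<open>x\<close> is not algebraic over \<open>B\<close>, every formula in its type
  over \<open>B\<close> has a solution other than \<open>x\<close>. By saturation the whole type has
  one, \<open>b\<close>, and strong homogeneity moves \<open>x\<close> to \<open>b\<close> over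
  \<open>B\<close>.\<close>

lemma fixed_mem_acl:
  assumes "B \<subseteq> carr M" "small K B" "x \<in> carr M" and fixed: "\<And>\<sigma>. \<sigma> \<in> autC M B \<Longrightarrow> \<sigma> x = x"
  shows "x \<in> acl M B"
proof (rule ccontr)
  assume nx: "x \<notin> acl M B"
  then have "x \<notin> B" using acl_increasing[OF assms(1)] by blast
  \<comment> \<open>Any variable would do, since only constant assignments are considered.\<close>
  define v0 :: "'a \<times> nat" where "v0 = undefined"
  let ?T = "{\<phi> :: ('f,'r,'a) form. wff M \<phi> \<and> params \<phi> \<subseteq> B \<and> sat M (\<lambda>_. x) \<phi>}"
  let ?p = "insert (Neg (Eq (Var v0) (Par x))) ?T"
  have "\<exists>b\<in>carr M. \<forall>\<phi>\<in>?p. sat M (\<lambda>_. b) \<phi>"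
  proof (rule mp[OF spec[OF spec[OF monster[unfolded monster_def saturated_def, THEN conjunct2, THEN conjunct2,
          THEN conjunct2, THEN conjunct2, THEN conjunct1]]], of "insert x B"], intro conjI ballI allI impI)
    show "insert x B \<subseteq> carr M" using assms(1,3) by simp
    show "small K (insert x B)" using small_Un[OF small_finite[of "{x}"] assms(2)] by simp
    show "params \<phi> \<subseteq> insert x B" "wf_fm M \<phi>" if "\<phi> \<in> ?p" for \<phi>
      using that assms(1,3) by (auto simp: wf_fm_def)
    fix r assume r: "finite r \<and> r \<subseteq> ?p"
    let ?r = "r \<inter> ?T"
    obtain \<phi> :: "('f,'r,'a) form" where \<phi>: "params \<phi> = \<Union> (params ` ?r)" "wff M \<phi> \<longleftrightarrow> (\<forall>\<psi>\<in>?r. wff M \<psi>)"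
      "\<And>s. sat M s \<phi> \<longleftrightarrow> (\<forall>\<psi>\<in>?r. sat M s \<psi>)"
      by (rule ex_finite_conj[of ?r]) (use r in auto)
    have "wf_fm M \<phi>" "params \<phi> \<subseteq> B" "sat M (\<lambda>_. x) \<phi>"
      using \<phi> assms(1) by (auto simp: wf_fm_def)
    then have "infinite {b \<in> carr M. sat M (\<lambda>_. b) \<phi>}"
      using nx assms(3) unfolding acl_def by blast
    then obtain b where b: "b \<in> carr M" "sat M (\<lambda>_. b) \<phi>" "b \<noteq> x"
      by (metis (mono_tags, lifting) finite.emptyI finite.insertI infinite_super mem_Collect_eq singletonI subsetI)
    have "sat M (\<lambda>_. b) \<psi>" if "\<psi> \<in> r" for \<psi>
    proof (cases "\<psi> \<in> ?T")
      case True
      then show ?thesis using b(2) \<phi>(3) that by blast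
    next
      case False
      then have "\<psi> = Neg (Eq (Var v0) (Par x))" using r that by blast
      then show ?thesis using b(3) by simp
    qed
    then show "\<exists>b\<in>carr M. \<forall>\<phi>\<in>r. sat M (\<lambda>_. b) \<phi>" using b(1) by blast
  qed
  then obtain b where b: "b \<in> carr M" "\<And>\<phi>. \<phi> \<in> ?p \<Longrightarrow> sat M (\<lambda>_. b) \<phi>" by blast
  have "b \<noteq> x" using b(2)[of "Neg (Eq (Var v0) (Par x))"] by simp
  let ?g = "\<lambda>z. if z \<in> B then z else b"
  obtain \<sigma> where \<sigma>: "aut M \<sigma>" "\<forall>z\<in>insert x B. \<sigma> z = ?g z"
  proof (rule homogeneous[of "insert x B" ?g])
    show "insert x B \<subseteq> carr M" using assms(1,3) by simp
    show "small K (insert x B)" using small_Un[OF small_finite[of "{x}"] assms(2)] by simp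
    show "?g ` insert x B \<subseteq> carr M" using assms(1) b(1) by auto
    fix s :: "'a \<times> nat \<Rightarrow> 'a" and \<phi> :: "('f,'r,'a) form"
    assume \<phi>: "wff M \<phi>" "params \<phi> = {}" and s: "range s \<subseteq> insert x B"
    \<comment> \<open>Variables with values in \<open>B\<close> become parameters and all others
      denote \<open>x\<close>. The formula thus becomes one over \<open>B\<close> about
      \<open>x\<close> alone, to which the equality of types of \<open>x\<close> and
      \<open>b\<close> applies.\<close>
    let ?\<theta> = "\<lambda>v. if s v \<in> B then Some (s v) else None"
    have eq: "(\<lambda>v. case ?\<theta> v of None \<Rightarrow> b | Some c \<Rightarrow> c) = ?g \<circ> s" by (rule ext) simp
    have "s v = x" if "s v \<notin> B" for v using s that by blast
    then have eqx: "(\<lambda>v. case ?\<theta> v of None \<Rightarrow> x | Some c \<Rightarrow> c) = s" by (intro ext) simp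
    have "ran ?\<theta> \<subseteq> B" by (auto simp: ran_def split: if_splits)
    then have "params (inst ?\<theta> \<phi>) \<subseteq> B" using params_inst[of ?\<theta> \<phi>] \<phi>(2) by blast
    then have "inst ?\<theta> \<phi> \<in> ?T \<or> Neg (inst ?\<theta> \<phi>) \<in> ?T" using \<phi>(1) by (simp add: wff_inst)
    then have "sat M (\<lambda>_. x) (inst ?\<theta> \<phi>) \<longleftrightarrow> sat M (\<lambda>_. b) (inst ?\<theta> \<phi>)"
      using b(2)[of "inst ?\<theta> \<phi>"] b(2)[of "Neg (inst ?\<theta> \<phi>)"] by auto
    then show "sat M s \<phi> \<longleftrightarrow> sat M (?g \<circ> s) \<phi>" unfolding sat_inst eq eqx .
  qed
  have "\<sigma> \<in> autC M B" by (rule autC_I) (use \<sigma> in auto)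
  then show False using fixed[of \<sigma>] \<sigma>(2) \<open>x \<notin> B\<close> \<open>b \<noteq> x\<close> by simp
qed

end

section \<open>Supports\<close>

locale free_amalgamation = monster_model M K for M :: "('f,'r,'a) struc" and K :: "'k set" +
  fixes ind :: "'a set \<Rightarrow> 'a set \<Rightarrow> 'a set \<Rightarrow> bool"
  assumes free_amalgamation: "free_amalgamation_rel M K ind"
begin

abbreviation sm :: "'a set \<Rightarrow> bool" where
  "sm X \<equiv> X \<subseteq> carr M \<and> small K X"

abbreviation small_closed :: "'a set \<Rightarrow> bool" where
  "small_closed X \<equiv> closed M X \<and> small K X"

lemma small_closed_sm: "small_closed X \<Longrightarrow> sm X"
  using closedD(1) by blast

lemma sm_image: "sm A \<Longrightarrow> aut M \<sigma> \<Longrightarrow> sm (\<sigma> ` A)"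
  using autD(2)[of M \<sigma>] by (auto simp: small_image)

lemma small_closed_image: "small_closed A \<Longrightarrow> aut M \<sigma> \<Longrightarrow> small_closed (\<sigma> ` A)"
  by (simp add: small_image closed_image[OF struct])

lemma small_closed_Int: "small_closed A \<Longrightarrow> small_closed B \<Longrightarrow> small_closed (A \<inter> B)"
  by (simp add: closed_Int small_subset[of A "A \<inter> B"])

lemmas amalgamation_axioms = free_amalgamation[unfolded free_amalgamation_rel_def Let_def]

lemma ind_aut:
  "aut M \<sigma> \<Longrightarrow> sm A \<Longrightarrow> sm B \<Longrightarrow> sm C \<Longrightarrow> ind A C B \<Longrightarrow> ind (\<sigma> ` A) (\<sigma> ` C) (\<sigma> ` B)"
  by (rule amalgamation_axioms[THEN conjunct1, rule_format]) simp

lemma ind_mono: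
  "sm A \<Longrightarrow> sm B \<Longrightarrow> sm C \<Longrightarrow> ind A C B \<Longrightarrow> A' \<subseteq> A \<Longrightarrow> B' \<subseteq> B \<Longrightarrow> ind A' C B'"
  by (rule amalgamation_axioms[THEN conjunct2, THEN conjunct1, rule_format, of A B C]) simp

lemma full_existence:
  assumes "sm A" "sm B" "small_closed C"
  obtains \<sigma> where "\<sigma> \<in> autC M C" "ind (\<sigma> ` A) C B"
proof -
  have "\<exists>\<sigma>\<in>autC M C. ind (\<sigma> ` A) C B"
    by (rule amalgamation_axioms[THEN conjunct2, THEN conjunct2, THEN conjunct2, THEN conjunct2, THEN conjunct1, rule_format])
      (use assms small_closed_sm in simp)
  then show thesis using that by blast
qed

lemma stationarity:
  assumes "small_closed A" "small_closed B" "small_closed C" "C \<subseteq> A" "C \<subseteq> B"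
    "\<sigma> \<in> autC M C" "ind A C B" "ind (\<sigma> ` A) C B"
  obtains \<tau> where "\<tau> \<in> autC M C" "\<forall>x\<in>A. \<tau> x = \<sigma> x" "\<forall>x\<in>B. \<tau> x = x"
proof -
  have "\<exists>\<tau>\<in>autC M C. (\<forall>x\<in>A. \<tau> x = \<sigma> x) \<and> (\<forall>x\<in>B. \<tau> x = x)"
    by (rule amalgamation_axioms[THEN conjunct2, THEN conjunct2, THEN conjunct2, THEN conjunct2, THEN conjunct2,
          THEN conjunct1, rule_format])
      (use assms small_closed_sm in simp)
  then show thesis using that by blast
qed

lemma freedom:
  "sm A \<Longrightarrow> sm B \<Longrightarrow> sm C \<Longrightarrow> ind A C B \<Longrightarrow> C \<inter> (A \<union> B) \<subseteq> D \<Longrightarrow> D \<subseteq> C \<Longrightarrow> ind A D B"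
  by (rule amalgamation_axioms[THEN conjunct2, THEN conjunct2, THEN conjunct2, THEN conjunct2, THEN conjunct2,
          THEN conjunct2, THEN conjunct1, rule_format, of A B C D])
    (auto intro: small_subset[of C D])

section \<open>Sets free from themselves\<close>

text \<open>Since \<open>X\<close> is free from itself, stationarity forces every
  \<open>\<sigma>\<close> over \<open>B\<close> with \<open>\<sigma>\<close>
  X\<open>free from\<close>X\<open>to be the identity on\<close>X\<open>(\<close>id\<open>). Full existence provides such a\<close>\<sigma>\<open>with\<close>\<sigma>
  \<open>X\<close> free from \<open>X \<union> Y\<close>, so \<open>X\<close> is free from every
  small \<open>Y\<close> (\<open>any\<close>). Taking the image of \<open>X\<close> for
  \<open>Y\<close> and applying invariance, every automorphism over \<open>B\<close> fixes
  \<open>X\<close> pointwise, so \<open>X\<close> is contained in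
  \<open>acl M B = B\<close>.\<close>

lemma self_ind_subset:
  assumes X: "small_closed X" and B: "small_closed B" "B \<subseteq> X" and ind: "ind X B X"
  shows "X \<subseteq> B"
proof
  note smX = small_closed_sm[OF X] and smB = small_closed_sm[OF B(1)]
  have id: "\<sigma> x = x" if \<sigma>: "\<sigma> \<in> autC M B" "ind (\<sigma> ` X) B X" and x: "x \<in> X" for \<sigma> x
  proof -
    obtain \<tau> where "\<forall>x\<in>X. \<tau> x = \<sigma> x" "\<forall>x\<in>X. \<tau> x = x"
      by (rule stationarity[OF X X B(1) B(2) B(2) \<sigma>(1) ind \<sigma>(2)])
    then show ?thesis using x by simp
  qed
  have any: "ind X B Y" if Y: "sm Y" for Y
  proof -
    have XY: "sm (X \<union> Y)" using smX Y small_Un[of X Y] by simp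
    obtain \<sigma> where \<sigma>: "\<sigma> \<in> autC M B" "ind (\<sigma> ` X) B (X \<union> Y)"
      by (rule full_existence[OF smX XY B(1)])
    note smS = sm_image[OF smX autC_D(1)[OF \<sigma>(1)]]
    have "ind (\<sigma> ` X) B X" by (rule ind_mono[OF smS XY smB \<sigma>(2)]) simp_all
    then have "\<sigma> ` X = X" using id[OF \<sigma>(1)] by simp
    then show ?thesis using ind_mono[OF smS XY smB \<sigma>(2), of X Y] by simp
  qed
  fix x assume x: "x \<in> X"
  have "x \<in> acl M B"
  proof (rule fixed_mem_acl)
    show "B \<subseteq> carr M" "small K B" "x \<in> carr M" using smB smX x by auto
    fix \<sigma> assume \<sigma>: "\<sigma> \<in> autC M B"
    let ?\<rho> = "ainv M \<sigma>"
    have \<sigma>aut: "aut M \<sigma>" by (rule autC_D(1)[OF \<sigma>])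
    have \<rho>: "?\<rho> \<in> autC M B" by (rule autC_ainv[OF struct \<sigma>]) (use smB in simp)
    have "ind (?\<rho> ` X) (?\<rho> ` B) (?\<rho> ` \<sigma> ` X)"
      by (rule ind_aut[OF autC_D(1)[OF \<rho>] smX sm_image[OF smX \<sigma>aut] smB any[OF sm_image[OF smX \<sigma>aut]]])
    then have "ind (?\<rho> ` X) B X"
      using autC_image[OF \<rho>] ainv_image(1)[OF \<sigma>aut conjunct1[OF smX]] by simp
    then have "?\<rho> x = x" by (rule id[OF \<rho> _ x])
    then show "\<sigma> x = x" using ainv_simps(1)[OF \<sigma>aut, of x] smX x by auto
  qed
  then show "x \<in> B" using closedD(2)[of M B] B(1) by simp
qed

text \<open>By monotonicity the intersection is free from itself over \<open>B\<close>.\<close>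

lemma ind_Int_subset:
  assumes A: "small_closed A" and B: "small_closed B" "B \<subseteq> A" and \<sigma>: "\<sigma> \<in> autC M B"
    and ind: "ind (\<sigma> ` A) B A"
  shows "A \<inter> \<sigma> ` A \<subseteq> B"
proof (rule self_ind_subset)
  note \<sigma>A = small_closed_image[OF A autC_D(1)[OF \<sigma>]]
  show "small_closed (A \<inter> \<sigma> ` A)" by (rule small_closed_Int[OF A \<sigma>A])
  show "small_closed B" by (rule B)
  have "B = \<sigma> ` B" using autC_image[OF \<sigma>] by simp
  also have "\<dots> \<subseteq> \<sigma> ` A" using B(2) by blast
  finally show "B \<subseteq> A \<inter> \<sigma> ` A" using B(2) by blast
  show "ind (A \<inter> \<sigma> ` A) B (A \<inter> \<sigma> ` A)"
    by (rule ind_mono[OF small_closed_sm[OF \<sigma>A] small_closed_sm[OF A] small_closed_sm[OF B(1)] ind]) simp_all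
qed

end

section \<open>Groups of automorphisms and their supports\<close>

text \<open>\<open>G_cong\<close> makes membership blind to values outside the universe, where
  \<open>ainv\<close> does not obey the group laws.\<close>

locale aut_group = free_amalgamation M K ind for M :: "('f,'r,'a) struc" and K :: "'k set" and ind +
  fixes G :: "('a \<Rightarrow> 'a) set"
  assumes G_aut: "\<sigma> \<in> G \<Longrightarrow> aut M \<sigma>"
    and G_comp: "\<sigma> \<in> G \<Longrightarrow> \<tau> \<in> G \<Longrightarrow> \<sigma> \<circ> \<tau> \<in> G"
    and G_ainv: "\<sigma> \<in> G \<Longrightarrow> ainv M \<sigma> \<in> G"
    and G_cong: "\<sigma> \<in> G \<Longrightarrow> aut M \<tau> \<Longrightarrow> (\<And>x. x \<in> carr M \<Longrightarrow> \<tau> x = \<sigma> x) \<Longrightarrow> \<tau> \<in> G"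
begin

text \<open>The factor \<open>\<tau>^-1 \<sigma>\<close> fixes \<open>A\<close> pointwise, hence
  lies in \<open>G\<close>. In this way automorphisms that stationarity or compactness controls only
  on \<open>A\<close> are brought into \<open>G\<close>.\<close>

lemma support_agree:
  assumes "autC M A \<subseteq> G" "A \<subseteq> carr M" "aut M \<sigma>" "\<tau> \<in> G" and eq: "\<And>x. x \<in> A \<Longrightarrow> \<sigma> x = \<tau> x"
  shows "\<sigma> \<in> G"
proof -
  note \<tau> = G_aut[OF assms(4)]
  have "ainv M \<tau> \<circ> \<sigma> \<in> autC M A"
  proof (rule autC_I)
    show "aut M (ainv M \<tau> \<circ> \<sigma>)" by (rule aut_comp[OF aut_ainv[OF struct \<tau>] assms(3)])
    show "(ainv M \<tau> \<circ> \<sigma>) x = x" if "x \<in> A" for x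
      using eq[OF that] ainv_simps(2)[OF \<tau>, of x] assms(2) that by auto
  qed
  then have "\<tau> \<circ> (ainv M \<tau> \<circ> \<sigma>) \<in> G" using assms(1) by (intro G_comp[OF assms(4)]) blast
  then show ?thesis
  proof (rule G_cong[OF _ assms(3)])
    show "\<sigma> x = (\<tau> \<circ> (ainv M \<tau> \<circ> \<sigma>)) x" if "x \<in> carr M" for x
      using ainv_simps(1)[OF \<tau> autD(2)[OF assms(3) that]] by simp
  qed
qed

text \<open>By freedom, a conjugate of \<open>A\<close> free from \<open>A\<close> over \<open>B\<close> is already free
  from \<open>A\<close> over \<open>A \<inter> B\<close>, and by stationarity it has the same type over
  \<open>A\<close> as any other such conjugate over \<open>A \<inter> B\<close>.\<close>

lemma support_Int:
  assumes A: "small_closed A" "autC M A \<subseteq> G" and B: "small_closed B" "autC M B \<subseteq> G"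
  shows "autC M (A \<inter> B) \<subseteq> G"
proof
  let ?C = "A \<inter> B"
  note C = small_closed_Int[OF A(1) B(1)]
  note smA = small_closed_sm[OF A(1)] and smB = small_closed_sm[OF B(1)] and smC = small_closed_sm[OF C]
  obtain \<sigma> where \<sigma>: "\<sigma> \<in> autC M B" "ind (\<sigma> ` A) B A" by (rule full_existence[OF smA smA B(1)])
  note \<sigma>aut = autC_D(1)[OF \<sigma>(1)]
  have \<sigma>C: "\<sigma> \<in> autC M ?C" using \<sigma>(1) by (simp add: autC_def)
  have "B \<inter> \<sigma> ` A \<subseteq> A"
  proof
    fix y assume "y \<in> B \<inter> \<sigma> ` A"
    then obtain x where x: "y \<in> B" "y = \<sigma> x" "x \<in> A" by blast
    have "x \<in> carr M" "y \<in> carr M" using x smA smB by auto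
    moreover have "\<sigma> y = \<sigma> x" using autC_D(2)[OF \<sigma>(1) x(1)] x(2) by simp
    ultimately have "y = x" using autD(3)[OF \<sigma>aut] by (simp add: inj_on_eq_iff)
    then show "y \<in> A" using x(3) by simp
  qed
  then have ind\<sigma>: "ind (\<sigma> ` A) ?C A"
    by (intro freedom[OF sm_image[OF smA \<sigma>aut] smA smB \<sigma>(2)]) auto
  have C_\<sigma>A: "?C \<subseteq> \<sigma> ` A" using autC_image[OF \<sigma>C] image_mono[of ?C A \<sigma>] by simp
  \<comment> \<open>Stationarity compares the two free conjugates \<open>\<sigma>\<close>
    A\<open>and\<close>\<rho> \<open>A\<close>: some \<open>\<tau>\<close> fixing \<open>A\<close>
    carries one to the other as \<open>\<rho> \<sigma>^-1\<close> does. Then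
    \<open>\<tau> \<sigma>\<close>, a product of automorphisms fixing one of the two supports,
    agrees with \<open>\<rho>\<close> on \<open>A\<close>.\<close>
  have free: "\<rho> \<in> G" if \<rho>: "\<rho> \<in> autC M ?C" "ind (\<rho> ` A) ?C A" for \<rho>
  proof -
    let ?\<mu> = "\<rho> \<circ> ainv M \<sigma>"
    have \<mu>: "?\<mu> \<in> autC M ?C" by (intro autC_comp[OF \<rho>(1)] autC_ainv[OF struct \<sigma>C]) (use smC in simp)
    have "?\<mu> ` \<sigma> ` A = \<rho> ` A"
      using ainv_image(1)[OF \<sigma>aut conjunct1[OF smA]] by (simp only: image_comp[symmetric])
    then have "ind (?\<mu> ` \<sigma> ` A) ?C A" using \<rho>(2) by simp
    then obtain \<tau> where \<tau>: "\<tau> \<in> autC M ?C" "\<forall>x\<in>\<sigma> ` A. \<tau> x = ?\<mu> x" "\<forall>x\<in>A. \<tau> x = x"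
      by (rule stationarity[OF small_closed_image[OF A(1) \<sigma>aut] A(1) C C_\<sigma>A Int_lower1 \<mu> ind\<sigma>])
    have "\<tau> \<in> autC M A" by (rule autC_I[OF autC_D(1)[OF \<tau>(1)]]) (use \<tau>(3) in simp)
    then have "\<tau> \<circ> \<sigma> \<in> G" using A(2) B(2) \<sigma>(1) by (intro G_comp) auto
    then show "\<rho> \<in> G"
    proof (rule support_agree[OF A(2) conjunct1[OF smA] autC_D(1)[OF \<rho>(1)]])
      fix x assume x: "x \<in> A"
      then have "ainv M \<sigma> (\<sigma> x) = x" using smA by (intro ainv_simps(2)[OF \<sigma>aut]) auto
      then show "\<rho> x = (\<tau> \<circ> \<sigma>) x" using \<tau>(2) x by simp
    qed
  qed
  fix \<tau> assume \<tau>: "\<tau> \<in> autC M ?C"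
  note \<tau>aut = autC_D(1)[OF \<tau>]
  have A\<tau>: "sm (A \<union> \<tau> ` A)" using smA sm_image[OF smA \<tau>aut] small_Un[of A "\<tau> ` A"] by simp
  obtain \<rho> where \<rho>: "\<rho> \<in> autC M ?C" "ind (\<rho> ` A) ?C (A \<union> \<tau> ` A)"
    by (rule full_existence[OF smA A\<tau> C])
  note \<rho>aut = autC_D(1)[OF \<rho>(1)]
  note sm\<rho> = sm_image[OF smA \<rho>aut]
  have "\<rho> \<in> G" by (rule free[OF \<rho>(1) ind_mono[OF sm\<rho> A\<tau> smC \<rho>(2)]]) simp_all
  let ?\<mu> = "ainv M \<tau> \<circ> \<rho>"
  have inv\<tau>: "ainv M \<tau> \<in> autC M ?C" by (rule autC_ainv[OF struct \<tau>]) (use smC in simp)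
  have "ind (\<rho> ` A) ?C (\<tau> ` A)" by (rule ind_mono[OF sm\<rho> A\<tau> smC \<rho>(2)]) simp_all
  then have "ind (ainv M \<tau> ` \<rho> ` A) (ainv M \<tau> ` ?C) (ainv M \<tau> ` \<tau> ` A)"
    by (rule ind_aut[OF autC_D(1)[OF inv\<tau>] sm\<rho> sm_image[OF smA \<tau>aut] smC])
  then have "ind (?\<mu> ` A) ?C A"
    using autC_image[OF inv\<tau>] ainv_image(1)[OF \<tau>aut conjunct1[OF smA]] by (simp only: image_comp[symmetric])
  then have \<mu>: "?\<mu> \<in> G" by (rule free[OF autC_comp[OF inv\<tau> \<rho>(1)]])
  show "\<tau> \<in> G"
  proof (rule G_cong[OF G_comp[OF \<open>\<rho> \<in> G\<close> G_ainv[OF \<mu>]] \<tau>aut])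
    fix y assume y: "y \<in> carr M"
    let ?x = "ainv M ?\<mu> y"
    have x: "?x \<in> carr M" "?\<mu> ?x = y" using ainv_simps[OF G_aut[OF \<mu>] y] by simp_all
    have "\<tau> (ainv M \<tau> (\<rho> ?x)) = \<rho> ?x" by (rule ainv_simps(1)[OF \<tau>aut autD(2)[OF \<rho>aut x(1)]])
    then show "\<tau> y = (\<rho> \<circ> ainv M ?\<mu>) y" using x(2) by simp
  qed
qed

lemma support_image:
  assumes "autC M A \<subseteq> G" "A \<subseteq> carr M" "\<sigma> \<in> G"
  shows "autC M (\<sigma> ` A) \<subseteq> G"
proof
  fix \<tau> assume \<tau>: "\<tau> \<in> autC M (\<sigma> ` A)"
  note \<sigma>aut = G_aut[OF assms(3)] and \<tau>aut = autC_D(1)[OF \<tau>]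
  let ?\<mu> = "ainv M \<sigma> \<circ> (\<tau> \<circ> \<sigma>)"
  have "?\<mu> \<in> autC M A"
  proof (rule autC_I)
    show "aut M ?\<mu>" by (intro aut_comp aut_ainv struct \<sigma>aut \<tau>aut)
    show "?\<mu> x = x" if "x \<in> A" for x
      using autC_D(2)[OF \<tau>, of "\<sigma> x"] ainv_simps(2)[OF \<sigma>aut, of x] assms(2) that by auto
  qed
  then have "?\<mu> \<in> G" using assms(1) by blast
  then have "\<sigma> \<circ> (?\<mu> \<circ> ainv M \<sigma>) \<in> G" by (rule G_comp[OF assms(3) G_comp[OF _ G_ainv[OF assms(3)]]])
  then show "\<tau> \<in> G"
  proof (rule G_cong[OF _ \<tau>aut])
    fix x assume x: "x \<in> carr M"
    note ix = ainv_simps[OF \<sigma>aut x]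
    have "\<sigma> (ainv M \<sigma> (\<tau> x)) = \<tau> x" by (rule ainv_simps(1)[OF \<sigma>aut autD(2)[OF \<tau>aut x]])
    then show "\<tau> x = (\<sigma> \<circ> (?\<mu> \<circ> ainv M \<sigma>)) x" using ix(1) by simp
  qed
qed

section \<open>Moving finite sets off a support\<close>

text \<open>If \<open>\<sigma> x\<close> is outside \<open>A\<close>, then \<open>x\<close> is
  outside the conjugate of \<open>A\<close> under \<open>\<sigma>^-1\<close>. That conjugate is
  again a support, so intersecting with it removes \<open>x\<close>.\<close>

lemma support_avoiding:
  assumes A: "small_closed A" "autC M A \<subseteq> G" and "finite F" "F \<subseteq> A"
    and moved: "\<And>x. x \<in> F \<Longrightarrow> \<exists>\<sigma>\<in>G. \<sigma> x \<notin> A"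
  shows "\<exists>B. small_closed B \<and> B \<subseteq> A \<and> autC M B \<subseteq> G \<and> B \<inter> F = {}"
  using assms(3-5)
proof (induction F)
  case empty
  show ?case by (rule exI[of _ A]) (use A in simp)
next
  case (insert x F)
  then obtain B where B: "small_closed B" "B \<subseteq> A" "autC M B \<subseteq> G" "B \<inter> F = {}" by auto
  obtain \<sigma> where \<sigma>: "\<sigma> \<in> G" "\<sigma> x \<notin> A" using insert.prems(2) by blast
  let ?A = "ainv M \<sigma> ` A"
  have carr: "A \<subseteq> carr M" using small_closed_sm[OF A(1)] by simp
  have A': "small_closed ?A" "autC M ?A \<subseteq> G"
    by (rule small_closed_image[OF A(1) G_aut[OF G_ainv[OF \<sigma>(1)]]],
        rule support_image[OF A(2) carr G_ainv[OF \<sigma>(1)]])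
  have "x \<notin> ?A"
  proof
    assume "x \<in> ?A"
    then obtain a where "a \<in> A" "x = ainv M \<sigma> a" by blast
    then have "\<sigma> x = a" using ainv_simps(1)[OF G_aut[OF \<sigma>(1)], of a] carr by auto
    then show False using \<sigma>(2) \<open>a \<in> A\<close> by simp
  qed
  then show ?case
    using small_closed_Int[OF B(1) A'(1)] support_Int[OF B(1,3) A'] B(2,4)
    by (intro exI[of _ "B \<inter> ?A"]) auto
qed

text \<open>A separate \<open>\<sigma>\<close> is given for each point, but one for all of
  \<open>F\<close> is wanted. Any automorphism fixing a support \<open>B\<close> disjoint from
  \<open>F\<close> lies in \<open>G\<close>, so it may be chosen to make \<open>A\<close> as free
  from itself over \<open>B\<close> as possible.\<close>

lemma move_off:
  assumes A: "small_closed A" "autC M A \<subseteq> G" and F: "finite F" "F \<subseteq> A"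
    and moved: "\<And>x. x \<in> F \<Longrightarrow> \<exists>\<sigma>\<in>G. \<sigma> x \<notin> A"
  shows "\<exists>\<sigma>\<in>G. \<forall>x\<in>F. \<sigma> x \<notin> A"
proof -
  obtain B where B: "small_closed B" "B \<subseteq> A" "autC M B \<subseteq> G" "B \<inter> F = {}"
    using support_avoiding[OF A F moved] by blast
  note smA = small_closed_sm[OF A(1)]
  obtain \<sigma> where \<sigma>: "\<sigma> \<in> autC M B" "ind (\<sigma> ` A) B A" by (rule full_existence[OF smA smA B(1)])
  have sub: "A \<inter> \<sigma> ` A \<subseteq> B" by (rule ind_Int_subset[OF A(1) B(1,2) \<sigma>])
  have "\<sigma> x \<notin> A" if "x \<in> F" for x
  proof
    assume "\<sigma> x \<in> A"
    \<comment> \<open>A point of \<open>B\<close> is fixed by \<open>\<sigma>\<close>, so by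
      injectivity \<open>\<sigma> x = x\<close>, which would put \<open>x\<close> into
      \<open>B\<close>.\<close>
    then have \<sigma>x: "\<sigma> x \<in> B" using sub that F(2) by blast
    then have "\<sigma> (\<sigma> x) = \<sigma> x" by (rule autC_D(2)[OF \<sigma>(1)])
    moreover have "x \<in> carr M" "\<sigma> x \<in> carr M" using that F(2) smA \<open>\<sigma> x \<in> A\<close> by auto
    ultimately have "\<sigma> x = x" using autD(3)[OF autC_D(1)[OF \<sigma>(1)]] by (simp add: inj_on_eq_iff)
    then show False using \<sigma>x B(4) that by auto
  qed
  then show ?thesis using B(3) \<sigma>(1) by blast
qed

end

section \<open>Hyperimaginaries\<close>

lemma Erel_cong:
  assumes "\<And>\<phi>. \<phi> \<in> \<Phi> \<Longrightarrow> fv \<phi> \<subseteq> I \<times> {0,1}"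
    and "\<And>i. i \<in> I \<Longrightarrow> x i = x' i" "\<And>i. i \<in> I \<Longrightarrow> y i = y' i"
  shows "Erel M \<Phi> x y \<longleftrightarrow> Erel M \<Phi> x' y'"
  unfolding Erel_def
proof (rule ball_cong[OF refl], rule sat_cong)
  fix \<phi> v assume "\<phi> \<in> \<Phi>" "v \<in> fv \<phi>"
  then have "v \<in> I \<times> {0,1}" using assms(1) by blast
  then show "asg x y v = asg x' y' v" using assms(2,3) by (auto simp: asg_def)
qed

locale hyperimaginary = free_amalgamation M K ind for M :: "('f,'r,'a) struc" and K :: "'k set" and ind +
  fixes I :: "'a set" and \<Phi> :: "('f,'r,'a) form set" and a :: "'a \<Rightarrow> 'a"
  assumes small_index: "small K I" and hypimag: "hypimag M I \<Phi> a"
begin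

lemma form_\<Phi>:
  assumes "\<phi> \<in> \<Phi>"
  shows "wff M \<phi>" "params \<phi> = {}" "fv \<phi> \<subseteq> I \<times> {0,1}"
  using hypimag assms by (auto simp: hypimag_def wf_fm_def)

lemma a_carr: "a ` I \<subseteq> carr M"
  using hypimag by (simp add: hypimag_def)

lemma E_refl: "x ` I \<subseteq> carr M \<Longrightarrow> Erel M \<Phi> x x"
  using hypimag[unfolded hypimag_def, THEN conjunct2, THEN conjunct2, THEN conjunct1] by simp

lemma E_sym: "x ` I \<subseteq> carr M \<Longrightarrow> y ` I \<subseteq> carr M \<Longrightarrow> Erel M \<Phi> x y \<Longrightarrow> Erel M \<Phi> y x"
  using hypimag[unfolded hypimag_def, THEN conjunct2, THEN conjunct2, THEN conjunct2, THEN conjunct1,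
      rule_format, of x y] by simp

lemma E_trans:
  "x ` I \<subseteq> carr M \<Longrightarrow> y ` I \<subseteq> carr M \<Longrightarrow> z ` I \<subseteq> carr M \<Longrightarrow> Erel M \<Phi> x y \<Longrightarrow> Erel M \<Phi> y z \<Longrightarrow>
    Erel M \<Phi> x z"
  using hypimag[unfolded hypimag_def, THEN conjunct2, THEN conjunct2, THEN conjunct2, THEN conjunct2,
      rule_format, of x y z] by simp

lemma E_cong:
  "(\<And>i. i \<in> I \<Longrightarrow> x i = x' i) \<Longrightarrow> (\<And>i. i \<in> I \<Longrightarrow> y i = y' i) \<Longrightarrow> Erel M \<Phi> x y \<longleftrightarrow> Erel M \<Phi> x' y'"
  by (rule Erel_cong[OF form_\<Phi>(3)])

lemma E_aut:
  assumes "aut M \<sigma>" "x ` I \<subseteq> carr M" "y ` I \<subseteq> carr M"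
  shows "Erel M \<Phi> (\<sigma> \<circ> x) (\<sigma> \<circ> y) \<longleftrightarrow> Erel M \<Phi> x y"
  unfolding Erel_def
proof (rule ball_cong[OF refl])
  fix \<phi> assume \<phi>: "\<phi> \<in> \<Phi>"
  have "asg x y v \<in> carr M" if "v \<in> fv \<phi>" for v
  proof -
    have "v \<in> I \<times> {0,1}" using form_\<Phi>(3)[OF \<phi>] that by blast
    then show ?thesis using assms(2,3) by (auto simp: asg_def)
  qed
  then have "sat M (\<sigma> \<circ> asg x y) \<phi> \<longleftrightarrow> sat M (asg x y) \<phi>"
    by (intro sat_aut_params_empty[OF struct assms(1) form_\<Phi>(1,2)[OF \<phi>]]) blast
  moreover have "\<sigma> \<circ> asg x y = asg (\<sigma> \<circ> x) (\<sigma> \<circ> y)" by (rule ext) (simp add: asg_def split: prod.split)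
  ultimately show "sat M (asg (\<sigma> \<circ> x) (\<sigma> \<circ> y)) \<phi> \<longleftrightarrow> sat M (asg x y) \<phi>" by simp
qed

definition stab :: "('a \<Rightarrow> 'a) set" where
  "stab = {\<sigma>. aut M \<sigma> \<and> fixes_h M \<Phi> a \<sigma>}"

lemma stabI: "aut M \<sigma> \<Longrightarrow> Erel M \<Phi> (\<sigma> \<circ> a) a \<Longrightarrow> \<sigma> \<in> stab"
  by (simp add: stab_def fixes_h_def)

lemma stabD: "\<sigma> \<in> stab \<Longrightarrow> aut M \<sigma>" "\<sigma> \<in> stab \<Longrightarrow> Erel M \<Phi> (\<sigma> \<circ> a) a"
  by (simp_all add: stab_def fixes_h_def)

lemma image_a_carr: "aut M \<sigma> \<Longrightarrow> (\<sigma> \<circ> a) ` I \<subseteq> carr M"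
  using a_carr autD(2)[of M \<sigma>] by (auto simp: image_subset_iff)

sublocale aut_group M K ind stab
proof
  fix \<sigma> assume \<sigma>: "\<sigma> \<in> stab"
  note \<sigma>aut = stabD(1)[OF \<sigma>]
  show "aut M \<sigma>" by (rule \<sigma>aut)
  show "\<sigma> \<circ> \<tau> \<in> stab" if \<tau>: "\<tau> \<in> stab" for \<tau>
  proof (rule stabI)
    note \<tau>aut = stabD(1)[OF \<tau>]
    show aut: "aut M (\<sigma> \<circ> \<tau>)" by (rule aut_comp[OF \<sigma>aut \<tau>aut])
    have "Erel M \<Phi> (\<sigma> \<circ> (\<tau> \<circ> a)) (\<sigma> \<circ> a)"
      using E_aut[OF \<sigma>aut image_a_carr[OF \<tau>aut] a_carr] stabD(2)[OF \<tau>] by simp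
    then show "Erel M \<Phi> (\<sigma> \<circ> \<tau> \<circ> a) a"
      unfolding comp_assoc
      using E_trans[OF _ image_a_carr[OF \<sigma>aut] a_carr _ stabD(2)[OF \<sigma>]] image_a_carr[OF aut]
      by (simp add: comp_assoc)
  qed
  show "ainv M \<sigma> \<in> stab"
  proof (rule stabI)
    show inv: "aut M (ainv M \<sigma>)" by (rule aut_ainv[OF struct \<sigma>aut])
    have "Erel M \<Phi> (ainv M \<sigma> \<circ> (\<sigma> \<circ> a)) (ainv M \<sigma> \<circ> a)"
      using E_aut[OF inv image_a_carr[OF \<sigma>aut] a_carr] stabD(2)[OF \<sigma>] by simp
    moreover have "(ainv M \<sigma> \<circ> (\<sigma> \<circ> a)) i = a i" if "i \<in> I" for i
      using ainv_simps(2)[OF \<sigma>aut, of "a i"] a_carr that by auto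
    ultimately have "Erel M \<Phi> a (ainv M \<sigma> \<circ> a)" using E_cong[of _ a "ainv M \<sigma> \<circ> a"] by simp
    then show "Erel M \<Phi> (ainv M \<sigma> \<circ> a) a" by (rule E_sym[OF a_carr image_a_carr[OF inv]])
  qed
  show "\<tau> \<in> stab" if "aut M \<tau>" "\<And>x. x \<in> carr M \<Longrightarrow> \<tau> x = \<sigma> x" for \<tau>
  proof (rule stabI[OF that(1)])
    have "Erel M \<Phi> (\<tau> \<circ> a) a \<longleftrightarrow> Erel M \<Phi> (\<sigma> \<circ> a) a"
      by (rule E_cong) (use that(2) a_carr in auto)
    then show "Erel M \<Phi> (\<tau> \<circ> a) a" using stabD(2)[OF \<sigma>] by simp
  qed
qed

lemma id_stab: "(\<lambda>x. x) \<in> stab"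
  by (rule stabI[OF aut_id]) (use E_refl[OF a_carr] in \<open>simp add: comp_def\<close>)

lemma support_representative:
  assumes "a ` I \<subseteq> A"
  shows "autC M A \<subseteq> stab"
proof
  fix \<sigma> assume \<sigma>: "\<sigma> \<in> autC M A"
  have "Erel M \<Phi> (\<sigma> \<circ> a) a \<longleftrightarrow> Erel M \<Phi> a a"
    by (rule E_cong) (use autC_D(2)[OF \<sigma>] assms in auto)
  then show "\<sigma> \<in> stab" using E_refl[OF a_carr] by (intro stabI autC_D(1)[OF \<sigma>]) simp
qed

section \<open>Compactness for the stabiliser\<close>

abbreviation E_cond :: "('f,'r,'a) form \<Rightarrow> ('a \<Rightarrow> 'a) \<Rightarrow> bool" where
  "E_cond \<phi> h \<equiv> sat M (asg (h \<circ> a) a) \<phi>"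

lemma stab_iff_E_cond: "\<sigma> \<in> stab \<longleftrightarrow> aut M \<sigma> \<and> (\<forall>\<phi>\<in>\<Phi>. E_cond \<phi> \<sigma>)"
  by (simp add: stab_def fixes_h_def Erel_def)

lemma dfn_E_cond:
  assumes "\<phi> \<in> \<Phi>" "a ` I \<subseteq> A" "A \<noteq> {}" "a ` I \<subseteq> B"
  shows "dfn A B (E_cond \<phi>)"
proof -
  obtain d where d: "d \<in> A" using assms(3) by blast
  \<comment> \<open>The first copy of the variables denotes the moved representative, and
    \<open>?\<theta>\<close> makes the second copy the fixed parameters \<open>a i\<close>.
    Variables with index outside \<open>I\<close> are not free in \<open>\<phi>\<close>; the default
    \<open>d\<close> only keeps the range inside \<open>A\<close>.\<close>
  let ?s = "\<lambda>(i, n). if i \<in> I then a i else d"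
  let ?\<theta> = "\<lambda>(i, n). if n \<noteq> (0::nat) \<and> i \<in> I then Some (a i) else None"
  show ?thesis
  proof (rule dfnI)
    show "range ?s \<subseteq> A" using assms(2) d by (auto simp: image_subset_iff)
    show "wff M (inst ?\<theta> \<phi>)" using form_\<Phi>(1)[OF assms(1)] by (simp add: wff_inst)
    have "ran ?\<theta> \<subseteq> a ` I" by (auto simp: ran_def split: if_splits)
    then show "params (inst ?\<theta> \<phi>) \<subseteq> B"
      using params_inst[of ?\<theta> \<phi>] form_\<Phi>(2)[OF assms(1)] assms(4) by blast
    show "E_cond \<phi> h \<longleftrightarrow> sat M (h \<circ> ?s) (inst ?\<theta> \<phi>)" for h
      unfolding sat_inst
    proof (rule sat_cong)
      fix v assume "v \<in> fv \<phi>"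
      then have "v \<in> I \<times> {0,1}" using form_\<Phi>(3)[OF assms(1)] by blast
      then show "asg (h \<circ> a) a v = (case ?\<theta> v of None \<Rightarrow> (h \<circ> ?s) v | Some c \<Rightarrow> c)"
        by (auto simp: asg_def)
    qed
  qed
qed

lemma dfn_eq:
  assumes "x \<in> A" "c \<in> B"
  shows "dfn A B (\<lambda>h. h x = c)"
  by (rule dfnI[of "\<lambda>_. x" A "Eq (Var undefined) (Par c)"]) (use assms in auto)

text \<open>An automorphism lies in \<open>stab\<close> exactly when it satisfies all conditions
  \<open>E_cond \<phi>\<close>, so these are added to \<open>P\<close>.\<close>

lemma stab_compactness:
  assumes A: "A \<subseteq> carr M" "small K A" "A \<noteq> {}" "a ` I \<subseteq> A" and B: "B \<subseteq> carr M" "small K B" "a ` I \<subseteq> B"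
    and P: "\<And>Q. Q \<in> P \<Longrightarrow> dfn A B Q"
    and fin: "\<And>q. finite q \<Longrightarrow> q \<subseteq> P \<Longrightarrow> \<exists>\<sigma>\<in>stab. \<forall>Q\<in>q. Q \<sigma>"
  obtains \<sigma> where "\<sigma> \<in> stab" "\<forall>Q\<in>P. Q \<sigma>"
proof -
  obtain \<sigma> where \<sigma>: "aut M \<sigma>" "\<forall>Q\<in>E_cond ` \<Phi> \<union> P. Q \<sigma>"
  proof (rule compactness[OF A(1-3) B(1,2)])
    fix Q assume "Q \<in> E_cond ` \<Phi> \<union> P"
    then show "dfn A B Q"
    proof
      assume "Q \<in> E_cond ` \<Phi>"
      then obtain \<phi> where "\<phi> \<in> \<Phi>" "Q = E_cond \<phi>" by (rule imageE)
      then show ?thesis using dfn_E_cond[OF _ A(4,3) B(3)] by simp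
    qed (rule P)
  next
    fix q assume q: "finite q" "q \<subseteq> E_cond ` \<Phi> \<union> P"
    obtain \<sigma> where \<sigma>: "\<sigma> \<in> stab" "\<forall>Q\<in>q \<inter> P. Q \<sigma>"
      using fin[OF finite_subset[OF Int_lower1 q(1)] Int_lower2] by (rule bexE)
    have "\<forall>Q\<in>q. Q \<sigma>"
    proof
      fix Q assume Q: "Q \<in> q"
      show "Q \<sigma>"
      proof (cases "Q \<in> P")
        case True
        then show ?thesis using bspec[OF \<sigma>(2) IntI[OF Q]] by simp
      next
        case False
        then have "Q \<in> E_cond ` \<Phi>" using subsetD[OF q(2) Q] by (simp only: Un_iff simp_thms)
        then obtain \<phi> where "\<phi> \<in> \<Phi>" "Q = E_cond \<phi>" by (rule imageE)
        then show ?thesis using \<sigma>(1) stab_iff_E_cond[of \<sigma>] by simp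
      qed
    qed
    then show "\<exists>\<sigma>. aut M \<sigma> \<and> (\<forall>Q\<in>q. Q \<sigma>)" using stabD(1)[OF \<sigma>(1)] by (intro exI[of _ \<sigma>] conjI)
  next
    fix \<sigma> assume "aut M \<sigma>" "\<forall>Q\<in>E_cond ` \<Phi> \<union> P. Q \<sigma>"
    then show thesis by (rule that)
  qed
  have "\<forall>\<phi>\<in>\<Phi>. E_cond \<phi> \<sigma>"
  proof
    fix \<phi> assume "\<phi> \<in> \<Phi>"
    then show "E_cond \<phi> \<sigma>" by (rule bspec[OF \<sigma>(2) UnI1[OF imageI]])
  qed
  then have "\<sigma> \<in> stab" using \<sigma>(1) stab_iff_E_cond by simp
  moreover have "\<forall>Q\<in>P. Q \<sigma>"
  proof
    fix Q assume "Q \<in> P"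
    then show "Q \<sigma>" by (rule bspec[OF \<sigma>(2) UnI2])
  qed
  ultimately show thesis by (rule that)
qed

text \<open>Being moved off \<open>A\<close> is the infinite conjunction of the definable conditions
  \<open>\<sigma> x \<noteq> y\<close> for \<open>y\<close> in \<open>A\<close>.\<close>

lemma stab_move_off:
  assumes A: "A \<subseteq> carr M" "small K A" "A \<noteq> {}" "a ` I \<subseteq> A" and X: "X \<subseteq> A"
    and fin: "\<And>T. finite T \<Longrightarrow> T \<subseteq> X \<times> A \<Longrightarrow> \<exists>\<sigma>\<in>stab. \<forall>(x, y)\<in>T. \<sigma> x \<noteq> y"
  obtains \<sigma> where "\<sigma> \<in> stab" "\<forall>x\<in>X. \<sigma> x \<notin> A"
proof -
  let ?N = "\<lambda>(x, y) h. h x \<noteq> (y :: 'a)"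
  obtain \<sigma> where \<sigma>: "\<sigma> \<in> stab" "\<forall>Q\<in>?N ` (X \<times> A). Q \<sigma>"
  proof (rule stab_compactness[OF A A(1,2,4)])
    fix Q assume "Q \<in> ?N ` (X \<times> A)"
    then obtain x y where xy: "x \<in> X" "y \<in> A" "Q = (\<lambda>h. h x \<noteq> y)" by auto
    show "dfn A A Q" unfolding xy(3) by (rule dfn_not, rule dfn_eq) (use xy X in auto)
  next
    fix q assume q: "finite q" "q \<subseteq> ?N ` (X \<times> A)"
    obtain T where T: "T \<subseteq> X \<times> A" "finite T" "q = ?N ` T"
      using finite_subset_image[OF q] by (elim exE conjE)
    obtain \<sigma> where "\<sigma> \<in> stab" "\<forall>(x, y)\<in>T. \<sigma> x \<noteq> y" using fin[OF T(2,1)] by (rule bexE)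
    then show "\<exists>\<sigma>\<in>stab. \<forall>Q\<in>q. Q \<sigma>" unfolding T(3) by (intro bexI[of _ \<sigma>]) auto
  next
    fix \<sigma> assume "\<sigma> \<in> stab" "\<forall>Q\<in>?N ` (X \<times> A). Q \<sigma>"
    then show thesis by (rule that)
  qed
  have "\<sigma> x \<notin> A" if "x \<in> X" for x
  proof
    assume "\<sigma> x \<in> A"
    then have "(x, \<sigma> x) \<in> X \<times> A" using that by simp
    then have "?N (x, \<sigma> x) \<sigma>" by (rule bspec[OF \<sigma>(2) imageI])
    then show False by simp
  qed
  then have "\<forall>x\<in>X. \<sigma> x \<notin> A" by (rule ballI)
  with \<sigma>(1) show thesis by (rule that)
qed

text \<open>The set \<open>C\<close> in the proof is a support because it contains the intersection of
  \<open>A\<close> with a single conjugate of \<open>A\<close>.\<close>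

lemma ex_finite_orbit_support:
  obtains C where "C \<subseteq> carr M" "small K C" "autC M C \<subseteq> stab"
    "\<forall>x\<in>C. \<forall>\<sigma>\<in>stab. \<sigma> x \<in> C" "\<forall>x\<in>C. finite {\<sigma> x | \<sigma>. \<sigma> \<in> stab}"
proof -
  \<comment> \<open>The point \<open>d\<close> keeps \<open>A\<close> nonempty also when
    \<open>I\<close> is empty.\<close>
  obtain d where d: "d \<in> carr M" using struct by (auto simp: struct_def)
  have "insert d (a ` I) \<subseteq> carr M" using d a_carr by simp
  moreover have "small K (insert d (a ` I))"
    using small_Un[OF small_finite[of "{d}"] small_image[OF small_index, of a]] by simp
  ultimately obtain A where A: "insert d (a ` I) \<subseteq> A" "closed M A" "small K A" by (rule ex_small_closed)
  have scA: "small_closed A" using A by simp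
  have A': "A \<subseteq> carr M" "small K A" "A \<noteq> {}" "a ` I \<subseteq> A" using A small_closed_sm[OF scA] by auto
  have suppA: "autC M A \<subseteq> stab" by (rule support_representative[OF A'(4)])
  define C where "C = {x \<in> A. \<forall>\<sigma>\<in>stab. \<sigma> x \<in> A}"
  have inv: "\<sigma> x \<in> C" if "x \<in> C" "\<sigma> \<in> stab" for x \<sigma>
  proof -
    have "\<tau> (\<sigma> x) \<in> A" if "\<tau> \<in> stab" for \<tau>
      using G_comp[OF that \<open>\<sigma> \<in> stab\<close>] \<open>x \<in> C\<close> by (auto simp: C_def)
    then show ?thesis using that by (simp add: C_def)
  qed
  \<comment> \<open>By the definition of \<open>C\<close>, each point of \<open>A - C\<close> is
    moved off \<open>A\<close> by some element of \<open>stab\<close>. \<open>move_off\<close>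
    unites finitely many of these, and compactness unites all of them.\<close>
  obtain \<sigma> where \<sigma>: "\<sigma> \<in> stab" "\<forall>x\<in>A - C. \<sigma> x \<notin> A"
  proof (rule stab_move_off[OF A', of "A - C"])
    fix T assume T: "finite T" "T \<subseteq> (A - C) \<times> A"
    have "\<exists>\<sigma>\<in>stab. \<forall>x\<in>fst ` T. \<sigma> x \<notin> A"
    proof (rule move_off[OF scA suppA])
      show "finite (fst ` T)" using T(1) by simp
      show "fst ` T \<subseteq> A" using T(2) by auto
      show "\<exists>\<sigma>\<in>stab. \<sigma> x \<notin> A" if "x \<in> fst ` T" for x
      proof -
        have "x \<in> A - C" using that T(2) by auto
        then show ?thesis by (auto simp: C_def)
      qed
    qed
    then obtain \<sigma> where "\<sigma> \<in> stab" "\<forall>x\<in>fst ` T. \<sigma> x \<notin> A" by (rule bexE)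
    then show "\<exists>\<sigma>\<in>stab. \<forall>(x, y)\<in>T. \<sigma> x \<noteq> y" using T(2) by (intro bexI[of _ \<sigma>]) fastforce+
  next
    fix \<sigma> assume "\<sigma> \<in> stab" "\<forall>x\<in>A - C. \<sigma> x \<notin> A"
    then show thesis by (rule that)
  qed blast
  have sub: "A \<inter> \<sigma> ` A \<subseteq> C"
  proof
    fix y assume "y \<in> A \<inter> \<sigma> ` A"
    then obtain x where x: "x \<in> A" "y = \<sigma> x" "\<sigma> x \<in> A" by blast
    then have "x \<in> C" using \<sigma>(2) by blast
    then show "y \<in> C" using inv[OF _ \<sigma>(1)] x(2) by simp
  qed
  have "autC M (A \<inter> \<sigma> ` A) \<subseteq> stab"
    by (rule support_Int[OF scA suppA small_closed_image[OF scA G_aut[OF \<sigma>(1)]]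
          support_image[OF suppA A'(1) \<sigma>(1)]])
  moreover have "autC M C \<subseteq> autC M (A \<inter> \<sigma> ` A)" using sub by (auto simp: autC_def)
  ultimately have suppC: "autC M C \<subseteq> stab" by (rule subset_trans[rotated])
  have CA: "C \<subseteq> A" by (auto simp: C_def)
  \<comment> \<open>An infinite orbit is not covered by any finite part of \<open>A\<close>, so by
    compactness some \<open>\<sigma>\<close> in \<open>stab\<close> would send \<open>x\<close>
    outside \<open>A\<close>.\<close>
  have "finite {\<sigma> x | \<sigma>. \<sigma> \<in> stab}" if x: "x \<in> C" for x
  proof (rule ccontr)
    assume inf: "infinite {\<sigma> x | \<sigma>. \<sigma> \<in> stab}"
    obtain \<sigma> where "\<sigma> \<in> stab" "\<forall>x\<in>{x}. \<sigma> x \<notin> A"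
    proof (rule stab_move_off[OF A', of "{x}"])
      show "{x} \<subseteq> A" using x CA by blast
      fix T assume T: "finite T" "T \<subseteq> {x} \<times> A"
      have "\<not> {\<sigma> x | \<sigma>. \<sigma> \<in> stab} \<subseteq> snd ` T"
        using inf finite_subset[OF _ finite_imageI[OF T(1)]] by blast
      then obtain \<sigma> where "\<sigma> \<in> stab" "\<sigma> x \<notin> snd ` T" by blast
      then show "\<exists>\<sigma>\<in>stab. \<forall>(x, y)\<in>T. \<sigma> x \<noteq> y" using T(2) by (intro bexI[of _ \<sigma>]) force+
    next
      fix \<sigma> assume "\<sigma> \<in> stab" "\<forall>x\<in>{x}. \<sigma> x \<notin> A"
      then show thesis by (rule that)
    qed
    then show False using x by (simp add: C_def)
  qed
  then show thesis
    using CA A'(1) small_subset[OF A(3) CA] suppC inv by (intro that[of C]) auto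
qed

lemma ex_orbit_closure:
  assumes "finite F" "F \<subseteq> C" and C: "\<forall>x\<in>C. \<forall>\<sigma>\<in>stab. \<sigma> x \<in> C" "\<forall>x\<in>C. finite {\<sigma> x | \<sigma>. \<sigma> \<in> stab}"
  obtains F' where "finite F'" "F \<subseteq> F'" "F' \<subseteq> C" "\<forall>\<sigma>\<in>stab. \<sigma> ` F' \<subseteq> F'"
proof (rule that)
  let ?F = "\<Union>x\<in>F. {\<sigma> x | \<sigma>. \<sigma> \<in> stab}"
  show "finite ?F" using assms(1,2) C(2) by (intro finite_UN_I) auto
  show "F \<subseteq> ?F"
  proof
    fix x assume "x \<in> F"
    then show "x \<in> ?F" using id_stab by (intro UN_I[of x]) auto
  qed
  show "?F \<subseteq> C" using assms(2) C(1) by auto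
  show "\<forall>\<sigma>\<in>stab. \<sigma> ` ?F \<subseteq> ?F"
  proof (intro ballI image_subsetI)
    fix \<sigma> y assume \<sigma>: "\<sigma> \<in> stab" and "y \<in> ?F"
    then obtain x \<tau> where "x \<in> F" "\<tau> \<in> stab" "y = \<tau> x" by blast
    then show "\<sigma> y \<in> ?F" using G_comp[OF \<sigma> \<open>\<tau> \<in> stab\<close>] by (intro UN_I[of x]) (auto intro!: exI[of _ "\<sigma> \<circ> \<tau>"])
  qed
qed

text \<open>Compactness combines the finite agreements into one \<open>\<tau>\<close> in
  \<open>stab\<close> equal to \<open>\<sigma>\<close> on all of \<open>C\<close>, and a support
  decides membership. This leads from the imaginaries back to the hyperimaginary.\<close>

lemma stab_closed:
  assumes C: "C \<subseteq> carr M" "small K C" "autC M C \<subseteq> stab" and \<sigma>: "aut M \<sigma>"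
    and approx: "\<And>F. finite F \<Longrightarrow> F \<subseteq> C \<Longrightarrow> \<exists>\<tau>\<in>stab. \<forall>x\<in>F. \<tau> x = \<sigma> x"
  shows "\<sigma> \<in> stab"
proof -
  obtain d where d: "d \<in> carr M" using struct by (auto simp: struct_def)
  let ?A = "insert d (a ` I \<union> C)"
  \<comment> \<open>The conditions \<open>h x = \<sigma> x\<close> have the values of
    \<open>\<sigma>\<close> as parameters.\<close>
  let ?B = "?A \<union> \<sigma> ` C"
  have A: "?A \<subseteq> carr M" "small K ?A" "?A \<noteq> {}" "a ` I \<subseteq> ?A"
    using d a_carr C(1) small_Un[OF small_finite[of "{d}"] small_Un[OF small_image[OF small_index, of a] C(2)]]
    by auto
  have B: "?B \<subseteq> carr M" "small K ?B" "a ` I \<subseteq> ?B"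
    using A C(1) autD(2)[OF \<sigma>] small_Un[OF A(2) small_image[OF C(2), of \<sigma>]] by auto
  let ?e = "\<lambda>x h. h x = \<sigma> x"
  obtain \<tau> where \<tau>: "\<tau> \<in> stab" "\<forall>Q\<in>?e ` C. Q \<tau>"
  proof (rule stab_compactness[OF A B])
    fix Q assume "Q \<in> ?e ` C"
    then obtain x where x: "x \<in> C" "Q = ?e x" by blast
    show "dfn ?A ?B Q" unfolding x(2) by (rule dfn_eq) (use x(1) in auto)
  next
    fix q assume q: "finite q" "q \<subseteq> ?e ` C"
    obtain F where F: "F \<subseteq> C" "finite F" "q = ?e ` F"
      using finite_subset_image[OF q] by (elim exE conjE)
    show "\<exists>\<tau>\<in>stab. \<forall>Q\<in>q. Q \<tau>" unfolding F(3) using approx[OF F(2,1)] by simp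
  next
    fix \<tau> assume "\<tau> \<in> stab" "\<forall>Q\<in>?e ` C. Q \<tau>"
    then show thesis by (rule that)
  qed
  show ?thesis
  proof (rule support_agree[OF C(3,1) \<sigma> \<tau>(1)])
    show "\<sigma> x = \<tau> x" if "x \<in> C" for x using bspec[OF \<tau>(2) imageI[OF that]] by simp
  qed
qed

text \<open>The imaginary is the class of the enumeration \<open>\<lambda>x. x\<close> of \<open>F\<close>
  modulo the permutations of \<open>F\<close> induced by \<open>stab\<close>.\<close>

lemma ex_imaginary_of_invariant_set:
  assumes F: "finite F" "F \<subseteq> carr M" "\<forall>\<sigma>\<in>stab. \<sigma> ` F \<subseteq> F"
  shows "\<exists>\<phi>. imag M F \<phi> (\<lambda>x. x) \<and>
    (\<forall>\<sigma>. fixes_h M {\<phi>} (\<lambda>x. x) \<sigma> \<longleftrightarrow> (\<exists>\<tau>\<in>stab. \<forall>x\<in>F. \<tau> x = \<sigma> x))"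
proof -
  \<comment> \<open>Cutting the automorphisms down to \<open>F\<close>, with a fixed value
    elsewhere, leaves finitely many functions, so the equivalence relation is a finite
    disjunction.\<close>
  let ?H = "(\<lambda>\<sigma> x. if x \<in> F then \<sigma> x else undefined) ` stab"
  have H_F: "\<pi> i \<in> F" if "\<pi> \<in> ?H" "i \<in> F" for \<pi> i
    using that F(3) by (auto simp: image_subset_iff)
  have "?H \<subseteq> {f. \<forall>x. (x \<in> F \<longrightarrow> f x \<in> F) \<and> (x \<notin> F \<longrightarrow> f x = undefined)}"
    using F(3) by (auto simp: image_subset_iff)
  then have finH: "finite ?H" by (rule finite_subset) (rule finite_set_of_finite_funs[OF F(1,1)])
  let ?eqs = "\<lambda>\<pi>. (\<lambda>i. Eq (Var (i, 0)) (Var (\<pi> i, 1)) :: ('f,'r,'a) form) ` F"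
  have "\<exists>\<psi> :: ('f,'r,'a) form. wff M \<psi> \<and> params \<psi> = {} \<and> fv \<psi> \<subseteq> F \<times> {0,1} \<and>
      (\<forall>s. sat M s \<psi> \<longleftrightarrow> (\<forall>i\<in>F. s (i, 0) = s (\<pi> i, 1)))" if \<pi>: "\<pi> \<in> ?H" for \<pi>
  proof -
    obtain \<psi> :: "('f,'r,'a) form" where \<psi>: "params \<psi> = \<Union> (params ` ?eqs \<pi>)" "fv \<psi> = \<Union> (fv ` ?eqs \<pi>)"
      "wff M \<psi> \<longleftrightarrow> (\<forall>\<chi>\<in>?eqs \<pi>. wff M \<chi>)" "\<And>s. sat M s \<psi> \<longleftrightarrow> (\<forall>\<chi>\<in>?eqs \<pi>. sat M s \<chi>)"
      by (rule ex_finite_conj[of "?eqs \<pi>"]) (use F(1) in auto)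
    have "fv \<psi> \<subseteq> F \<times> {0,1}" unfolding \<psi>(2) using H_F[OF \<pi>] by auto
    then show ?thesis using \<psi>(1,3,4) by (intro exI[of _ \<psi>]) simp
  qed
  then have "\<forall>\<pi>\<in>?H. \<exists>\<psi> :: ('f,'r,'a) form. wff M \<psi> \<and> params \<psi> = {} \<and> fv \<psi> \<subseteq> F \<times> {0,1} \<and>
      (\<forall>s. sat M s \<psi> \<longleftrightarrow> (\<forall>i\<in>F. s (i, 0) = s (\<pi> i, 1)))" by (rule ballI)
  from bchoice[OF this] obtain \<Psi> :: "('a \<Rightarrow> 'a) \<Rightarrow> ('f,'r,'a) form" where
    \<Psi>: "\<forall>\<pi>\<in>?H. wff M (\<Psi> \<pi>) \<and> params (\<Psi> \<pi>) = {} \<and> fv (\<Psi> \<pi>) \<subseteq> F \<times> {0,1} \<and>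
      (\<forall>s. sat M s (\<Psi> \<pi>) \<longleftrightarrow> (\<forall>i\<in>F. s (i, 0) = s (\<pi> i, 1)))" by (rule exE)
  obtain \<phi> :: "('f,'r,'a) form" where \<phi>: "params \<phi> = \<Union> (params ` \<Psi> ` ?H)" "fv \<phi> = \<Union> (fv ` \<Psi> ` ?H)"
    "wff M \<phi> \<longleftrightarrow> (\<forall>\<chi>\<in>\<Psi> ` ?H. wff M \<chi>)" "\<And>s. sat M s \<phi> \<longleftrightarrow> (\<exists>\<chi>\<in>\<Psi> ` ?H. sat M s \<chi>)"
    by (rule ex_finite_disj[of "\<Psi> ` ?H"]) (use finH in auto)
  have wf: "wff M \<phi>" "params \<phi> = {}" "fv \<phi> \<subseteq> F \<times> {0,1}"
    unfolding \<phi>(1-3) using \<Psi> by (simp_all add: UN_subset_iff)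
  have E: "Erel M {\<phi>} x y \<longleftrightarrow> (\<exists>\<sigma>\<in>stab. \<forall>i\<in>F. x i = y (\<sigma> i))" for x y
  proof -
    have "Erel M {\<phi>} x y \<longleftrightarrow> (\<exists>\<pi>\<in>?H. sat M (asg x y) (\<Psi> \<pi>))" by (simp add: Erel_def \<phi>(4))
    also have "\<dots> \<longleftrightarrow> (\<exists>\<pi>\<in>?H. \<forall>i\<in>F. x i = y (\<pi> i))"
    proof (rule bex_cong[OF refl])
      fix \<pi> assume "\<pi> \<in> ?H"
      then have "sat M (asg x y) (\<Psi> \<pi>) \<longleftrightarrow> (\<forall>i\<in>F. asg x y (i, 0) = asg x y (\<pi> i, 1))"
        by (rule spec[OF conjunct2[OF conjunct2[OF conjunct2[OF bspec[OF \<Psi>]]]]])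
      then show "sat M (asg x y) (\<Psi> \<pi>) \<longleftrightarrow> (\<forall>i\<in>F. x i = y (\<pi> i))" by (simp add: asg_def)
    qed
    finally show ?thesis by simp
  qed
  have "hypimag M F {\<phi>} (\<lambda>x. x)"
    unfolding hypimag_def
  proof (intro conjI allI impI)
    show "\<forall>\<chi>\<in>{\<phi>}. wf_fm M \<chi> \<and> params \<chi> = {} \<and> fv \<chi> \<subseteq> F \<times> {0,1}" using wf by (simp add: wf_fm_def)
    show "(\<lambda>x. x) ` F \<subseteq> carr M" using F(2) by simp
    show "Erel M {\<phi>} x x" for x unfolding E by (rule bexI[OF _ id_stab]) simp
    show "Erel M {\<phi>} y x" if xy: "x ` F \<subseteq> carr M \<and> y ` F \<subseteq> carr M \<and> Erel M {\<phi>} x y" for x y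
    proof -
      obtain \<sigma> where \<sigma>: "\<sigma> \<in> stab" "\<forall>i\<in>F. x i = y (\<sigma> i)" using xy unfolding E by blast
      have "y i = x (ainv M \<sigma> i)" if "i \<in> F" for i
      proof -
        have "ainv M \<sigma> i \<in> F" using F(3) G_ainv[OF \<sigma>(1)] that by blast
        moreover have "\<sigma> (ainv M \<sigma> i) = i" using ainv_simps(1)[OF G_aut[OF \<sigma>(1)]] F(2) that by blast
        ultimately show ?thesis using \<sigma>(2) by simp
      qed
      then show ?thesis unfolding E by (intro bexI[OF _ G_ainv[OF \<sigma>(1)]] ballI)
    qed
    show "Erel M {\<phi>} x z" if xyz: "x ` F \<subseteq> carr M \<and> y ` F \<subseteq> carr M \<and> z ` F \<subseteq> carr M \<and>
      Erel M {\<phi>} x y \<and> Erel M {\<phi>} y z" for x y z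
    proof -
      obtain \<sigma> where \<sigma>: "\<sigma> \<in> stab" "\<forall>i\<in>F. x i = y (\<sigma> i)" using xyz unfolding E by blast
      obtain \<tau> where \<tau>: "\<tau> \<in> stab" "\<forall>i\<in>F. y i = z (\<tau> i)" using xyz unfolding E by blast
      have "x i = z ((\<tau> \<circ> \<sigma>) i)" if "i \<in> F" for i
      proof -
        have "\<sigma> i \<in> F" using F(3) \<sigma>(1) that by blast
        then show ?thesis using \<sigma>(2) \<tau>(2) that by simp
      qed
      then show ?thesis unfolding E by (intro bexI[OF _ G_comp[OF \<tau>(1) \<sigma>(1)]] ballI)
    qed
  qed
  \<comment> \<open>With \<open>x = \<sigma>\<close> and \<open>y\<close> the identity,
    \<open>E\<close> says that \<open>\<sigma>\<close> agrees on \<open>F\<close> with an element of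
    \<open>stab\<close>.\<close>
  moreover have "fixes_h M {\<phi>} (\<lambda>x. x) \<sigma> \<longleftrightarrow> (\<exists>\<tau>\<in>stab. \<forall>x\<in>F. \<tau> x = \<sigma> x)" for \<sigma>
    unfolding fixes_h_def E by (simp add: eq_commute)
  ultimately show ?thesis using F(1) by (intro exI[of _ \<phi>]) (simp add: imag_def)
qed

text \<open>Since orbits on \<open>C\<close> are finite, every finite subset of \<open>C\<close>
  lies in a finite invariant one. Fixing all the imaginaries therefore means agreeing with elements
  of \<open>stab\<close> on each finite subset of \<open>C\<close>, and \<open>stab_closed\<close>
  applies.\<close>

lemma ex_interdefinable_imaginaries:
  "\<exists>S :: ('a set \<times> ('f,'r,'a) form \<times> ('a \<Rightarrow> 'a)) set. small K S \<and> (\<forall>(J,\<phi>,b)\<in>S. imag M J \<phi> b) \<and>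
    (\<forall>\<sigma>. aut M \<sigma> \<longrightarrow> (fixes_h M \<Phi> a \<sigma> \<longleftrightarrow> (\<forall>(J,\<phi>,b)\<in>S. fixes_h M {\<phi>} b \<sigma>)))"
proof -
  obtain C where C: "C \<subseteq> carr M" "small K C" "autC M C \<subseteq> stab"
    "\<forall>x\<in>C. \<forall>\<sigma>\<in>stab. \<sigma> x \<in> C" "\<forall>x\<in>C. finite {\<sigma> x | \<sigma>. \<sigma> \<in> stab}"
    by (rule ex_finite_orbit_support)
  let ?\<F> = "{F. finite F \<and> F \<subseteq> C \<and> (\<forall>\<sigma>\<in>stab. \<sigma> ` F \<subseteq> F)}"
  have "\<forall>F\<in>?\<F>. \<exists>\<phi>. imag M F \<phi> (\<lambda>x. x) \<and>
    (\<forall>\<sigma>. fixes_h M {\<phi>} (\<lambda>x. x) \<sigma> \<longleftrightarrow> (\<exists>\<tau>\<in>stab. \<forall>x\<in>F. \<tau> x = \<sigma> x))"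
  proof
    fix F assume "F \<in> ?\<F>"
    then show "\<exists>\<phi>. imag M F \<phi> (\<lambda>x. x) \<and>
      (\<forall>\<sigma>. fixes_h M {\<phi>} (\<lambda>x. x) \<sigma> \<longleftrightarrow> (\<exists>\<tau>\<in>stab. \<forall>x\<in>F. \<tau> x = \<sigma> x))"
      using C(1) by (intro ex_imaginary_of_invariant_set) auto
  qed
  from bchoice[OF this] obtain f where f: "\<forall>F\<in>?\<F>. imag M F (f F) (\<lambda>x. x) \<and>
    (\<forall>\<sigma>. fixes_h M {f F} (\<lambda>x. x) \<sigma> \<longleftrightarrow> (\<exists>\<tau>\<in>stab. \<forall>x\<in>F. \<tau> x = \<sigma> x))" by (rule exE)
  let ?S = "(\<lambda>F. (F, f F, \<lambda>x. x)) ` ?\<F>"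
  have "small K ?\<F>" by (rule small_subset[OF small_finite_subsets[OF C(2)]]) blast
  then have "small K ?S" by (rule small_image)
  moreover have "\<forall>(J,\<phi>,b)\<in>?S. imag M J \<phi> b" using f by auto
  moreover have "fixes_h M \<Phi> a \<sigma> \<longleftrightarrow> (\<forall>(J,\<phi>,b)\<in>?S. fixes_h M {\<phi>} b \<sigma>)" if \<sigma>: "aut M \<sigma>" for \<sigma>
  proof -
    have "(\<forall>(J,\<phi>,b)\<in>?S. fixes_h M {\<phi>} b \<sigma>) \<longleftrightarrow> (\<forall>F\<in>?\<F>. \<exists>\<tau>\<in>stab. \<forall>x\<in>F. \<tau> x = \<sigma> x)"
      using f by simp
    also have "\<dots> \<longleftrightarrow> \<sigma> \<in> stab"
    proof
      assume all: "\<forall>F\<in>?\<F>. \<exists>\<tau>\<in>stab. \<forall>x\<in>F. \<tau> x = \<sigma> x"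
      show "\<sigma> \<in> stab"
      proof (rule stab_closed[OF C(1-3) \<sigma>])
        fix F assume F: "finite F" "F \<subseteq> C"
        obtain F' where F': "finite F'" "F \<subseteq> F'" "F' \<subseteq> C" "\<forall>\<sigma>\<in>stab. \<sigma> ` F' \<subseteq> F'"
          by (rule ex_orbit_closure[OF F C(4,5)])
        then have "\<exists>\<tau>\<in>stab. \<forall>x\<in>F'. \<tau> x = \<sigma> x" by (intro bspec[OF all]) simp
        then show "\<exists>\<tau>\<in>stab. \<forall>x\<in>F. \<tau> x = \<sigma> x" using F'(2) by blast
      qed
    next
      assume "\<sigma> \<in> stab"
      then show "\<forall>F\<in>?\<F>. \<exists>\<tau>\<in>stab. \<forall>x\<in>F. \<tau> x = \<sigma> x" by (intro ballI bexI[of _ \<sigma>] refl)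
    qed
    finally show ?thesis using \<sigma> by (simp add: stab_def)
  qed
  ultimately show ?thesis by (intro exI[of _ ?S] conjI allI impI)
qed

text \<open>If no finite part of the support were a support, compactness would yield an automorphism
  fixing the whole support and moving the imaginary.\<close>

lemma ex_weak_canonical_parameter:
  assumes \<Phi>: "\<Phi> = {\<phi>}"
  shows "\<exists>c. set c \<subseteq> carr M \<and> finite {map \<sigma> c | \<sigma>. aut M \<sigma> \<and> fixes_h M {\<phi>} a \<sigma>} \<and>
    (\<forall>\<sigma>. aut M \<sigma> \<and> (\<forall>x\<in>set c. \<sigma> x = x) \<longrightarrow> fixes_h M {\<phi>} a \<sigma>)"
proof -
  obtain C where C: "C \<subseteq> carr M" "small K C" "autC M C \<subseteq> stab"
    "\<forall>x\<in>C. \<forall>\<sigma>\<in>stab. \<sigma> x \<in> C" "\<forall>x\<in>C. finite {\<sigma> x | \<sigma>. \<sigma> \<in> stab}"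
    by (rule ex_finite_orbit_support)
  obtain d where d: "d \<in> carr M" using struct by (auto simp: struct_def)
  let ?A = "insert d (a ` I \<union> C)"
  have A: "?A \<subseteq> carr M" "small K ?A" "?A \<noteq> {}" "a ` I \<subseteq> ?A"
    using d a_carr C(1) small_Un[OF small_finite[of "{d}"] small_Un[OF small_image[OF small_index, of a] C(2)]]
    by auto
  \<comment> \<open>Here it matters that \<open>\<Phi>\<close> is a single formula: being outside
    \<open>stab\<close> is then itself a definable condition, so it may enter the compactness
    argument.\<close>
  let ?e = "\<lambda>x h. h x = x" and ?n = "\<lambda>h. \<not> E_cond \<phi> h"
  have stab: "\<sigma> \<in> stab \<longleftrightarrow> aut M \<sigma> \<and> E_cond \<phi> \<sigma>" for \<sigma> using stab_iff_E_cond[of \<sigma>] \<Phi> by simp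
  have "\<exists>F. finite F \<and> F \<subseteq> C \<and> autC M F \<subseteq> stab"
  proof (rule ccontr)
    assume no: "\<not> ?thesis"
    obtain \<sigma> where \<sigma>: "aut M \<sigma>" "\<forall>Q\<in>insert ?n (?e ` C). Q \<sigma>"
    proof (rule compactness[OF A(1-3) A(1,2)])
      fix Q assume "Q \<in> insert ?n (?e ` C)"
      then show "dfn ?A ?A Q"
      proof
        assume Q: "Q = ?n"
        show ?thesis unfolding Q by (rule dfn_not, rule dfn_E_cond) (use \<Phi> in auto)
      next
        assume "Q \<in> ?e ` C"
        then obtain x where x: "x \<in> C" "Q = ?e x" by blast
        show ?thesis unfolding x(2) by (rule dfn_eq) (use x(1) in auto)
      qed
    next
      fix q assume q: "finite q" "q \<subseteq> insert ?n (?e ` C)"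
      have "finite (q - {?n})" "q - {?n} \<subseteq> ?e ` C" using q by auto
      from finite_subset_image[OF this] obtain F where F: "F \<subseteq> C" "finite F" "q - {?n} = ?e ` F"
        by (elim exE conjE)
      \<comment> \<open>Apart from \<open>?n\<close>, the conditions in \<open>q\<close> fix the
        points of \<open>F\<close>; as \<open>F\<close> is not a support, some automorphism
        satisfies them together with \<open>?n\<close>.\<close>
      obtain \<sigma> where \<sigma>: "\<sigma> \<in> autC M F" "\<sigma> \<notin> stab" using no F(1,2) by blast
      have "Q \<sigma>" if "Q \<in> q" for Q
      proof (cases "Q = ?n")
        case True
        then show ?thesis using \<sigma> stab[of \<sigma>] autC_D(1)[OF \<sigma>(1)] by simp
      next
        case False
        then have "Q \<in> ?e ` F" using that F(3) by blast
        then obtain x where "x \<in> F" "Q = ?e x" by blast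
        then show ?thesis using autC_D(2)[OF \<sigma>(1)] by simp
      qed
      then have "\<forall>Q\<in>q. Q \<sigma>" by (rule ballI)
      then show "\<exists>\<sigma>. aut M \<sigma> \<and> (\<forall>Q\<in>q. Q \<sigma>)" using autC_D(1)[OF \<sigma>(1)] by (intro exI[of _ \<sigma>] conjI)
    next
      fix \<sigma> assume "aut M \<sigma>" "\<forall>Q\<in>insert ?n (?e ` C). Q \<sigma>"
      then show thesis by (rule that)
    qed
    have "\<sigma> x = x" if "x \<in> C" for x using bspec[OF \<sigma>(2) insertI2[OF imageI[OF that]]] .
    then have "\<sigma> \<in> stab" using C(3) autC_I[OF \<sigma>(1), of C] by blast
    moreover have "\<not> E_cond \<phi> \<sigma>" by (rule bspec[OF \<sigma>(2) insertI1])
    ultimately show False using stab[of \<sigma>] by simp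
  qed
  then obtain F where F: "finite F" "F \<subseteq> C" "autC M F \<subseteq> stab" by blast
  obtain c where c: "set c = F" using finite_list[OF F(1)] by blast
  \<comment> \<open>All entries of the conjugates of \<open>c\<close> under \<open>stab\<close> lie
    in this finite union of orbits, which bounds the number of conjugates.\<close>
  let ?O = "\<Union>x\<in>F. {\<sigma> x | \<sigma>. \<sigma> \<in> stab}"
  have "finite ?O" using F(1,2) C(5) by (intro finite_UN_I) auto
  then have "finite {xs. set xs \<subseteq> ?O \<and> length xs = length c}" by (rule finite_lists_length_eq)
  moreover have "{map \<sigma> c | \<sigma>. \<sigma> \<in> stab} \<subseteq> {xs. set xs \<subseteq> ?O \<and> length xs = length c}"
  proof
    fix xs assume "xs \<in> {map \<sigma> c | \<sigma>. \<sigma> \<in> stab}"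
    then obtain \<sigma> where "\<sigma> \<in> stab" "xs = map \<sigma> c" by blast
    moreover from this have "\<sigma> x \<in> ?O" if "x \<in> F" for x using that by (intro UN_I[of x]) auto
    ultimately show "xs \<in> {xs. set xs \<subseteq> ?O \<and> length xs = length c}" using c by (simp add: image_subset_iff)
  qed
  ultimately have "finite {map \<sigma> c | \<sigma>. \<sigma> \<in> stab}" by (rule finite_subset[rotated])
  moreover have "stab = {\<sigma>. aut M \<sigma> \<and> fixes_h M {\<phi>} a \<sigma>}" unfolding stab_def unfolding \<Phi> ..
  moreover have "set c \<subseteq> carr M" using c F(2) C(1) by blast
  ultimately show ?thesis using F(3) c by (intro exI[of _ c]) (auto simp: autC_def)
qed

end

theorem theorem5p6:
  fixes M :: "('f,'r,'a) struc" and K :: "'k set"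
  assumes "monster M K"
    and "\<exists>ind. free_amalgamation_rel M K ind"
  shows "EHI M K \<and> WEI M"
proof
  obtain ind where "free_amalgamation_rel M K ind" using assms(2) by (rule exE)
  then interpret free_amalgamation M K ind
    using assms(1) by unfold_locales
  show "EHI M K"
    unfolding EHI_def
  proof (intro allI impI)
    fix I and \<Phi> :: "('f,'r,'a) form set" and a
    assume "small K I \<and> hypimag M I \<Phi> a"
    then interpret hyperimaginary M K ind I \<Phi> a by unfold_locales simp_all
    show "\<exists>S :: ('a set \<times> ('f,'r,'a) form \<times> ('a \<Rightarrow> 'a)) set. small K S \<and> (\<forall>(J,\<phi>,b)\<in>S. imag M J \<phi> b) \<and>
      (\<forall>\<sigma>. aut M \<sigma> \<longrightarrow> (fixes_h M \<Phi> a \<sigma> \<longleftrightarrow> (\<forall>(J,\<phi>,b)\<in>S. fixes_h M {\<phi>} b \<sigma>)))"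
      by (rule ex_interdefinable_imaginaries)
  qed
  show "WEI M"
    unfolding WEI_def
  proof (intro allI impI)
    fix I and \<phi> :: "('f,'r,'a) form" and a
    assume "imag M I \<phi> a"
    then interpret hyperimaginary M K ind I "{\<phi>}" a
      by unfold_locales (simp_all add: imag_def small_finite)
    show "\<exists>c :: 'a list. set c \<subseteq> carr M \<and> finite {map \<sigma> c | \<sigma>. aut M \<sigma> \<and> fixes_h M {\<phi>} a \<sigma>} \<and>
      (\<forall>\<sigma>. aut M \<sigma> \<and> (\<forall>x\<in>set c. \<sigma> x = x) \<longrightarrow> fixes_h M {\<phi>} a \<sigma>)"
      by (rule ex_weak_canonical_parameter[OF refl])
  qed
qed

end
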